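(* Let $1\le p<\infty$, $0<r<\infty$, $0<q\le\infty$, $\frac1s:=\left(\frac1r-\frac1p\right)_+$. Let $u,v,w\in\mathfrak M^+$ with $\int_0^t u<\infty$ for all $t>0$, and let $k$ be an Oinarov kernel with constant $D$. Let $C_{\mathbf T}\in[0,\infty]$ be the least constant such that $\|\mathbf Tf\|_{L^r_u}\le C_{\mathbf T}\|f\|_{L^p_v}$ for all $f\in\mathfrak M^+$, where $$(\mathbf Tf)(x)=\left(\int_x^\infty k(y,x)w(y)\left(\int_0^y f(z)\,dz\right)^q dy\right)^{1/q}\ (q<\infty),\qquad (\mathbf Tf)(x)=\operatorname*{ess\,sup}_{y\ge x} k(y,x)w(y)\int_0^y f(z)\,dz\ (q=\infty).$$ If $q<\infty$, let $B_0,B_1\in[0,\infty]$ be the least constants such that for all $f\in\mathfrak M^+$ $$\left(\int_0^\infty u(x)\left(\int_x^\infty k(y,x)w(y)\,dy\right)^{\frac rq}\left(\int_0^x f\right)^r dx\right)^{\frac1r}\le B_0\|f\|_{L^p_v},$$ $$\left(\int_0^\infty u(x)[k(\sigma^2(x),x)]^{\frac rq}\left(\int_{\sigma^2(x)}^\infty w(y)\left(\int_0^y f\right)^q dy\right)^{\frac rq} dx\right)^{\frac1r}\le B_1\|f\|_{L^p_v};$$ if $q=\infty$, let $B_0,B_1\in[0,\infty]$ be the least constants such that for all $f\in\mathfrak M^+$ $$\left(\int_0^\infty u(x)\left[\operatorname*{ess\,sup}_{y\ge x}k(y,x)w(y)\right]^r\left(\int_0^x f\right)^r dx\right)^{\frac1r}\le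 B_0\|f\|_{L^p_v},$$ $$\left(\int_0^\infty u(x)[k(\sigma^2(x),x)]^r\left(\operatorname*{ess\,sup}_{y\ge\sigma^2(x)}w(y)\int_0^y f\right)^r dx\right)^{\frac1r}\le B_1\|f\|_{L^p_v}.$$ Let $$B_2:=\begin{cases}\displaystyle\sup_{t>0}\left(\int_0^t u\right)^{\frac1r}\|\mathbf H_t\|_{L^p_v\to L^q_{w(\cdot)k(\cdot,t)}},& p\le r,\\[2mm] \displaystyle\left(\int_0^\infty u(x)\left(\int_0^x u\right)^{\frac sp}\|\mathbf H_{\sigma^{-1}(x),\sigma^2(x)}\|^s_{L^p_v\to L^q_{w(\cdot)k(\cdot,\sigma^{-1}(x))}}\,dx\right)^{\frac1s},& r<p.\end{cases}$$ Then $C_{\mathbf T}<\infty$ if and only if $B:=B_0+B_1+B_2<\infty$. Moreover, $C_{\mathbf T}\approx B$, i.e. each side is bounded by the other times a positive constant depending only on $p,q,r,D$.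
   Context: $\mathfrak M$ is the set of measurable functions on $[0,\infty)$, $\mathfrak M^+\subset\mathfrak M$ the non-negative ones. For $0<p<\infty$, $v\in\mathfrak M^+$: $\|f\|_{L^p_v}:=\left(\int_0^\infty|f|^pv\right)^{1/p}$; for $p=\infty$: $\|f\|_{L^\infty_v}:=\operatorname{ess\,sup}_{x\ge0}v(x)|f(x)|$. $L^q_{w(\cdot)k(\cdot,t)}$ is the weighted space with weight $y\mapsto w(y)k(y,t)$. For a positive operator $H$ on $\mathfrak M^+$ and a weight $\omega$, $\|H\|_{L^p_v\to L^q_\omega}\in[0,\infty]$ is the least $C$ with $\|Hf\|_{L^q_\omega}\le C\|f\|_{L^p_v}$ for all $f\in\mathfrak M^+$. Expressions $0\cdot\infty$, $\frac\infty\infty$, $\frac00$ are taken to be $0$. $(a)_+=\max(a,0)$ ($s$ is used only when $r<p$). Oinarov kernel with constant $D\ge1$: a Borel function $k(x,y)\ge0$ on $[0,\infty)^2$ with $k(x,y)=0$ if $x<y$ and $\frac1D(k(x,z)+k(z,y))\le k(x,y)\le D(k(x,z)+k(z,y))$ for all $x\ge z\ge y\ge0$. The functions $\sigma:[0,\infty)\to[0,\infty]$ and $\sigma^{-1}:[0,\infty)\to[0,\infty)$ are defined (with $\inf\varnothing=\infty$) by $$\sigma(x):=\inf\left\{y>0:\int_0^y u\ge2\int_0^x u\right\},\qquad \sigma^{-1}(x):=\inf\left\{y>0:\int_0^y u\ge\tfrac12\int_0^x u\right\}.$$ Put $\sigma(\infty):=\infty$; $\sigma^2=\sigma\circ\sigma$.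 At points $x$ with $\sigma^2(x)=\infty$ the integral (or essential supremum) over $y\ge\sigma^2(x)$ is $0$ and the integrand in the inequality defining $B_1$ is $0$. For $0<c<d\le\infty$ and $f\in\mathfrak M^+$: $$(\mathbf H_{c,d}f)(x):=\chi_{[c,d)}(x)\int_{\sigma^{-1}(c)}^x f(z)\,dz,\qquad (\mathbf H_cf)(x):=\chi_{[c,\infty)}(x)\int_0^x f(z)\,dz.$$ (In $B_2$ with $r<p$, the integrand is $0$ at points $x$ with $\int_0^xu=0$.) *)

theory Defs
  imports "HOL-Probability.Essential_Supremum"
begin

text \<open>
  Functions on the half line are represented by functions of type
  \<open>real \<Rightarrow> ennreal\<close>, of which only the values on \<open>{0..}\<close> matter.
  Extended values are admitted because the operators below can produce them; the
  multiplication of \<open>ennreal\<close> satisfies \<open>0 * \<infinity> = 0\<close>.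
\<close>

definition Mplus :: "(real \<Rightarrow> ennreal) set" where
  "Mplus = borel_measurable (lebesgue_on {0..})"

text \<open>Only exponents \<open>a > 0\<close> occur.\<close>

definition epowr :: "ennreal \<Rightarrow> real \<Rightarrow> ennreal"  (infixr \<open>epowr\<close> 80) where
  "x epowr a = (if x = \<infinity> then \<infinity> else ennreal (enn2real x powr a))"

definition Lnorm :: "ennreal \<Rightarrow> (real \<Rightarrow> ennreal) \<Rightarrow> (real \<Rightarrow> ennreal) \<Rightarrow> ennreal" where
  "Lnorm p v f =
    (if p = \<infinity> then esssup (lebesgue_on {0..}) (\<lambda>x. v x * f x)
     else (\<integral>\<^sup>+x\<in>{0..}. (f x epowr enn2real p) * v x \<partial>lebesgue) epowr (1 / enn2real p))"

text \<open>
  The infimum of the empty set is \<open>\<infinity>\<close>. This covers the case of an \<open>f\<close> with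
  \<open>\<Phi> f > 0\<close> and vanishing norm, where \<open>C = \<infinity>\<close> does not satisfy the
  inequality either, since \<open>\<infinity> * 0 = 0\<close>.
\<close>

definition least_const ::
    "real \<Rightarrow> (real \<Rightarrow> ennreal) \<Rightarrow> ((real \<Rightarrow> ennreal) \<Rightarrow> ennreal) \<Rightarrow> ennreal" where
  "least_const p v \<Phi> = Inf {C. \<forall>f\<in>Mplus. \<Phi> f \<le> C * Lnorm (ennreal p) v f}"

definition opnorm ::
    "real \<Rightarrow> (real \<Rightarrow> ennreal) \<Rightarrow> ennreal \<Rightarrow> (real \<Rightarrow> ennreal) \<Rightarrow>
     ((real \<Rightarrow> ennreal) \<Rightarrow> real \<Rightarrow> ennreal) \<Rightarrow> ennreal" where
  "opnorm p v q \<omega> H = least_const p v (\<lambda>f. Lnorm q \<omega> (H f))"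

definition oinarov_kernel :: "real \<Rightarrow> (real \<Rightarrow> real \<Rightarrow> real) \<Rightarrow> bool" where
  "oinarov_kernel D k \<longleftrightarrow>
     1 \<le> D \<and>
     (\<lambda>z. k (fst z) (snd z)) \<in> borel_measurable (restrict_space borel ({0..} \<times> {0..})) \<and>
     (\<forall>x\<ge>0. \<forall>y\<ge>0. 0 \<le> k x y) \<and>
     (\<forall>x\<ge>0. \<forall>y\<ge>0. x < y \<longrightarrow> k x y = 0) \<and>
     (\<forall>x y z. 0 \<le> y \<and> y \<le> z \<and> z \<le> x \<longrightarrow>
        1 / D * (k x z + k z y) \<le> k x y \<and> k x y \<le> D * (k x z + k z y))"

definition prim :: "(real \<Rightarrow> ennreal) \<Rightarrow> real \<Rightarrow> ennreal" where
  "prim f x = (\<integral>\<^sup>+z\<in>{0..x}. f z \<partial>lebesgue)"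

definition sigma :: "(real \<Rightarrow> ennreal) \<Rightarrow> real \<Rightarrow> ereal" where
  "sigma u x = Inf (ereal ` {y. 0 < y \<and> prim u y \<ge> 2 * prim u x})"

definition sigma2 :: "(real \<Rightarrow> ennreal) \<Rightarrow> real \<Rightarrow> ereal" where
  "sigma2 u x = (if sigma u x = \<infinity> then \<infinity> else sigma u (real_of_ereal (sigma u x)))"

text \<open>
  The set is bounded below, and for \<open>x \<ge> 0\<close> it is nonempty (it contains \<open>x\<close> if
  \<open>x > 0\<close>), so the infimum in \<open>real\<close> is the intended one.
\<close>

definition sigma_inv :: "(real \<Rightarrow> ennreal) \<Rightarrow> real \<Rightarrow> real" where
  "sigma_inv u x = Inf {y. 0 < y \<and> prim u y \<ge> prim u x / 2}"

definition Hop_cd ::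
    "(real \<Rightarrow> ennreal) \<Rightarrow> real \<Rightarrow> ereal \<Rightarrow> (real \<Rightarrow> ennreal) \<Rightarrow> real \<Rightarrow> ennreal" where
  "Hop_cd u c d f x =
    (if c \<le> x \<and> ereal x < d then \<integral>\<^sup>+z\<in>{sigma_inv u c..x}. f z \<partial>lebesgue else 0)"

definition Hop :: "real \<Rightarrow> (real \<Rightarrow> ennreal) \<Rightarrow> real \<Rightarrow> ennreal" where
  "Hop c f x = (if c \<le> x then prim f x else 0)"

definition Top ::
    "ennreal \<Rightarrow> (real \<Rightarrow> real \<Rightarrow> real) \<Rightarrow> (real \<Rightarrow> ennreal) \<Rightarrow> (real \<Rightarrow> ennreal) \<Rightarrow> real \<Rightarrow> ennreal" where
  "Top q k w f x =
    (if q = \<infinity> then esssup (lebesgue_on {x..}) (\<lambda>y. ennreal (k y x) * w y * prim f y)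
     else (\<integral>\<^sup>+y\<in>{x..}. ennreal (k y x) * w y * (prim f y epowr enn2real q) \<partial>lebesgue)
            epowr (1 / enn2real q))"

definition C_T ::
    "real \<Rightarrow> ennreal \<Rightarrow> real \<Rightarrow> (real \<Rightarrow> ennreal) \<Rightarrow> (real \<Rightarrow> ennreal) \<Rightarrow> (real \<Rightarrow> ennreal) \<Rightarrow>
     (real \<Rightarrow> real \<Rightarrow> real) \<Rightarrow> ennreal" where
  "C_T p q r u v w k = opnorm p v (ennreal r) u (Top q k w)"

definition B0 ::
    "real \<Rightarrow> ennreal \<Rightarrow> real \<Rightarrow> (real \<Rightarrow> ennreal) \<Rightarrow> (real \<Rightarrow> ennreal) \<Rightarrow> (real \<Rightarrow> ennreal) \<Rightarrow>
     (real \<Rightarrow> real \<Rightarrow> real) \<Rightarrow> ennreal" where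
  "B0 p q r u v w k = least_const p v (\<lambda>f.
    (if q = \<infinity> then
       \<integral>\<^sup>+x\<in>{0..}. u x * (esssup (lebesgue_on {x..}) (\<lambda>y. ennreal (k y x) * w y) epowr r)
                   * (prim f x epowr r) \<partial>lebesgue
     else
       \<integral>\<^sup>+x\<in>{0..}. u x * ((\<integral>\<^sup>+y\<in>{x..}. ennreal (k y x) * w y \<partial>lebesgue) epowr (r / enn2real q))
                   * (prim f x epowr r) \<partial>lebesgue)
    epowr (1 / r))"

definition B1 ::
    "real \<Rightarrow> ennreal \<Rightarrow> real \<Rightarrow> (real \<Rightarrow> ennreal) \<Rightarrow> (real \<Rightarrow> ennreal) \<Rightarrow> (real \<Rightarrow> ennreal) \<Rightarrow>
     (real \<Rightarrow> real \<Rightarrow> real) \<Rightarrow> ennreal" where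
  "B1 p q r u v w k = least_const p v (\<lambda>f.
    (\<integral>\<^sup>+x\<in>{0..}.
       (if sigma2 u x = \<infinity> then 0
        else
          (let z = real_of_ereal (sigma2 u x) in
             if q = \<infinity> then
               u x * (ennreal (k z x) epowr r)
                   * (esssup (lebesgue_on {z..}) (\<lambda>y. w y * prim f y) epowr r)
             else
               u x * (ennreal (k z x) epowr (r / enn2real q))
                   * ((\<integral>\<^sup>+y\<in>{z..}. w y * (prim f y epowr enn2real q) \<partial>lebesgue)
                        epowr (r / enn2real q)))) \<partial>lebesgue)
    epowr (1 / r))"

definition B2 ::
    "real \<Rightarrow> ennreal \<Rightarrow> real \<Rightarrow> (real \<Rightarrow> ennreal) \<Rightarrow> (real \<Rightarrow> ennreal) \<Rightarrow> (real \<Rightarrow> ennreal) \<Rightarrow>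
     (real \<Rightarrow> real \<Rightarrow> real) \<Rightarrow> ennreal" where
  "B2 p q r u v w k =
    (if p \<le> r then
       (SUP t\<in>{0<..}. (prim u t epowr (1 / r)) * opnorm p v q (\<lambda>y. w y * ennreal (k y t)) (Hop t))
     else
       (let s = 1 / max (1 / r - 1 / p) 0 in
         (\<integral>\<^sup>+x\<in>{0..}.
            (if prim u x = 0 then 0
             else u x * (prim u x epowr (s / p))
                  * (opnorm p v q (\<lambda>y. w y * ennreal (k y (sigma_inv u x)))
                       (Hop_cd u (sigma_inv u x) (sigma2 u x)) epowr s)) \<partial>lebesgue)
         epowr (1 / s)))"

end

(* Write U for the primitive of u and xi for its generalized inverse, so that u(x)dx is the
   image under xi of Lebesgue measure on {t. t <= U y for some y}. In the variable t the map
   sigma becomes t -> 2t, and integrals scale exactly: a dilation by a multiplies the L^r norm by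
   a^(-1/r). The function Phi(x) = || k(.,x)^(1/q) w^(1/q) F ||_q over [x,oo), F the primitive of f,
   satisfies, by the Oinarov inequality at z = sigma^n(x),
     Phi(x) <= c (local part over [x, z) + k(z,x)^(1/q) tail at z + Phi(z)),
   with c independent of n. For n large the last term carries the small factor 2^(-n/r) and is
   absorbed, after truncating to make the norm finite; the tail is controlled by B1. In the local
   part F(y) <= F(x) + int_x^y f: the first term is controlled by B0, the second by B2 together
   with int Gam(t) dt/t <= int f^p v, where Gam(t) is the integral of f^p v over the dyadic window
   {t <= U < 2t} (and Hoelder's inequality if r < p).
   Conversely B0, B1 and, for p <= r, B2 are immediate from monotonicity. For r < p one tests T
   on f = sup_m a_m f_m, where f_m is almost extremal for the Hardy operator starting at xi(2^m). *)

theory Submission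
  imports Defs "HOL-Probability.Distribution_Functions"
begin

text \<open>The kernel inequality at \<open>z\<close> is used once, for one large fixed
  \<open>n\<close>, and is not iterated from \<open>n = 1\<close>. Each iteration would multiply the
  remainder by a fixed power of the constants, which may outweigh the gain
  \<open>2 powr (-1/r)\<close> of a doubling. In a single step the coefficient of the remainder is
  independent of \<open>n\<close>; the price is paid by the local part and the tail, whose constants
  grow geometrically in \<open>n\<close>. This is harmless because \<open>n\<close> depends only on
  \<open>q\<close>, \<open>r\<close> and \<open>D\<close>. For exponents below 1 the spaces are only
  quasi-normed, hence the powers of one common constant in every estimate. Moving weight and kernel
  inside the norm, with exponent \<open>1/q\<close> or with exponent 1 if
  \<open>q = \<infinity>\<close>, treats all \<open>q\<close> alike. For \<open>r < p\<close> the
  operator norm in \<open>B2\<close> may fail to be measurable in \<open>x\<close>, so that its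
  integral is merely monotone. One direction therefore works with a measurable minorant, the other
  with a measurable majorant built from the norms at countably many dyadic levels.\<close>

section \<open>Powers and norms on the half line\<close>

lemma epowr_ennreal: "0 \<le> x \<Longrightarrow> ennreal x epowr a = ennreal (x powr a)"
  by (simp add: epowr_def)

lemma epowr_top [simp]: "top epowr a = top"
  by (simp add: epowr_def)

lemma epowr_zero [simp]: "0 epowr a = 0"
  by (simp add: epowr_def)

lemma epowr_one_exp [simp]: "x epowr 1 = x"
  by (cases x) (auto simp: epowr_def)

lemma epowr_one [simp]: "1 epowr a = 1"
  by (simp add: epowr_def)

lemma epowr_mono: assumes "x \<le> y" "0 < a" shows "x epowr a \<le> y epowr a"
proof (cases "y = top")
  case False
  then obtain s where s: "y = ennreal s" "0 \<le> s" by (cases y) auto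
  moreover obtain t where t: "x = ennreal t" "0 \<le> t"
    using assms(1) s by (cases x) (auto simp: top_unique)
  ultimately show ?thesis using assms by (auto simp: epowr_ennreal intro!: ennreal_leI powr_mono2)
qed simp

lemma epowr_epowr: assumes "0 < a" "0 < b" shows "(x epowr a) epowr b = x epowr (a * b)"
  by (cases x) (auto simp: epowr_ennreal powr_powr)

lemma epowr_mult: assumes "0 < a" shows "(x * y) epowr a = (x epowr a) * (y epowr a)"
proof (cases "x = 0 \<or> y = 0")
  case False
  have pos: "z epowr a \<noteq> 0" if "z \<noteq> 0" for z
    using that by (cases z) (auto simp: epowr_ennreal)
  show ?thesis
    using False pos by (cases x; cases y)
      (auto simp: epowr_ennreal powr_mult ennreal_mult[symmetric] ennreal_mult_top ennreal_top_mult ennreal_mult_eq_top_iff)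
qed auto

lemma epowr_add: assumes "0 < a" "0 < b" shows "x epowr (a + b) = (x epowr a) * (x epowr b)"
  by (cases x) (auto simp: epowr_ennreal powr_add ennreal_mult ennreal_mult_top)

lemma epowr_inverse: "0 < a \<Longrightarrow> (x epowr a) epowr (1 / a) = x"
  and epowr_inverse': "0 < a \<Longrightarrow> (x epowr (1 / a)) epowr a = x"
  by (simp_all add: epowr_epowr)

lemma epowr_le_iff: "0 < a \<Longrightarrow> x epowr a \<le> y \<longleftrightarrow> x \<le> y epowr (1 / a)"
  using epowr_mono[of "x epowr a" y "1 / a"] epowr_mono[of x "y epowr (1 / a)" a]
  by (auto simp: epowr_inverse epowr_inverse')

lemma epowr_less_top_iff: "x epowr a < top \<longleftrightarrow> x < top"
  by (cases x) (auto simp: epowr_ennreal)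

lemma epowr_eq_0_iff: "x epowr a = 0 \<longleftrightarrow> x = 0"
  by (cases x) (auto simp: epowr_ennreal)

lemma epowr_SUP: assumes "0 < a" shows "(SUP i\<in>I. f i) epowr a = (SUP i\<in>I. f i epowr a)"
proof (rule order.antisym)
  have "f i \<le> (SUP i\<in>I. f i epowr a) epowr (1 / a)" if "i \<in> I" for i
    using that assms by (intro iffD1[OF epowr_le_iff] SUP_upper)
  then show "(SUP i\<in>I. f i) epowr a \<le> (SUP i\<in>I. f i epowr a)"
    using assms by (simp add: epowr_le_iff SUP_least)
  show "(SUP i\<in>I. f i epowr a) \<le> (SUP i\<in>I. f i) epowr a"
    using assms by (intro SUP_least epowr_mono SUP_upper)
qed

lemma epowr_measurable [measurable]:
  "f \<in> borel_measurable M \<Longrightarrow> (\<lambda>x. f x epowr a) \<in> borel_measurable M"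
proof -
  assume [measurable]: "f \<in> borel_measurable M"
  have "(\<lambda>x. enn2real (f x) powr a) \<in> borel_measurable M"
    by (intro powr_real_measurable) auto
  moreover have "{x \<in> space M. f x = \<infinity>} \<in> sets M" by measurable
  ultimately show ?thesis
    unfolding epowr_def by (intro measurable_If) auto
qed

lemma divide_le_iff_ennreal:
  assumes "0 < c" "c < top" shows "a / c \<le> b \<longleftrightarrow> a \<le> c * (b :: ennreal)"
proof
  assume "a / c \<le> b"
  then have "c * (a / c) \<le> c * b" by (rule mult_left_mono) simp
  then show "a \<le> c * b" using assms by (simp add: ennreal_times_divide ennreal_mult_divide_eq mult.commute)
next
  assume "a \<le> c * b"
  then show "a / c \<le> b" using assms by (intro divide_le_posI_ennreal) (auto simp: mult.commute)
qed

text \<open>Twice the maximum dominates the sum, which serves convex and concave powers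
  alike.\<close>

lemma epowr_add_le: assumes "0 < a" shows "(x + y) epowr a \<le> ennreal (2 powr a) * (x epowr a + y epowr a)"
proof -
  have "(x + y) epowr a \<le> (2 * max x y) epowr a"
    using assms by (intro epowr_mono) (auto simp: mult_2 max_def intro!: add_mono)
  also have "\<dots> = ennreal (2 powr a) * (max x y epowr a)"
    using assms by (simp add: epowr_mult epowr_ennreal flip: ennreal_numeral)
  also have "\<dots> \<le> ennreal (2 powr a) * (x epowr a + y epowr a)"
    by (intro mult_left_mono) (auto simp: max_def)
  finally show ?thesis .
qed

section \<open>Quasi-norms of L^q on the half line\<close>

abbreviation half_line :: "real measure" where "half_line \<equiv> lebesgue_on {0..}"

lemma sigma_finite_half_line: "sigma_finite_measure half_line"
proof
  show "\<exists>A::real set set. countable A \<and> A \<subseteq> sets half_line \<and> \<Union> A = space half_line \<and>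
      (\<forall>a\<in>A. emeasure half_line a \<noteq> \<infinity>)"
    by (intro exI[of _ "range (\<lambda>n::nat. {0..real n})"])
       (auto simp: sets_restrict_space_iff emeasure_restrict_space real_arch_simple)
qed

interpretation half_line: sigma_finite_measure half_line by (rule sigma_finite_half_line)

lemma nn_integral_half_line:
  "(\<integral>\<^sup>+x\<in>{0..}. f x \<partial>lebesgue) = (\<integral>\<^sup>+x. f x \<partial>half_line)"
  by (simp add: nn_integral_restrict_space)

lemma measurable_id_half_line [measurable]: "(\<lambda>x. x) \<in> half_line \<rightarrow>\<^sub>M borel"
  by (intro measurable_restrict_space1 measurable_completion) auto

lemma borel_measurable_half_line: "f \<in> borel_measurable borel \<Longrightarrow> f \<in> borel_measurable half_line"
  using measurable_compose[OF measurable_id_half_line] by simp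

text \<open>Unweighted on purpose: a weight becomes a factor of \<open>g\<close>, as
  \<open>w\<close> to the power \<open>1/q\<close> for finite \<open>q\<close> and as
  \<open>w\<close> itself for \<open>q = \<infinity>\<close>.\<close>

definition Nrm :: "ennreal \<Rightarrow> (real \<Rightarrow> ennreal) \<Rightarrow> ennreal" where
  "Nrm q g = (if q = \<infinity> then esssup half_line g
     else (\<integral>\<^sup>+x. g x epowr enn2real q \<partial>half_line) epowr (1 / enn2real q))"

text \<open>The quasi-triangle constant. The first 2 is the root of the factor
  \<open>2 powr q\<close> of \<open>epowr_add_le\<close>, the second factor comes from the same
  lemma applied to the outer root. At \<open>q = \<infinity>\<close> the exponent is
  \<open>1 / 0 = 0\<close> and the value is 2.\<close>

definition qconst :: "ennreal \<Rightarrow> real" where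
  "qconst q = 2 * 2 powr (1 / enn2real q)"

lemma ennreal_pos_cases:
  assumes "0 < q"
  obtains (top) "q = \<infinity>" | (real) a where "q = ennreal a" "0 < a"
  using assms by (cases q) auto

lemma esssup_le_iff:
  fixes f :: "'a \<Rightarrow> ennreal"
  assumes "f \<in> borel_measurable M" shows "esssup M f \<le> c \<longleftrightarrow> (AE x in M. f x \<le> c)"
  using esssup_I[OF assms] esssup_AE[of f M] by (auto elim: eventually_mono intro: order.trans)

lemma Nrm_mono_AE:
  assumes "0 < q" "g \<in> borel_measurable half_line" "AE x in half_line. g x \<le> h x"
  shows "Nrm q g \<le> Nrm q h"
  using assms(1)
proof (cases rule: ennreal_pos_cases)
  case top
  then show ?thesis using assms by (simp add: Nrm_def esssup_AE_mono)
next
  case (real a)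
  have "AE x in half_line. g x epowr a \<le> h x epowr a"
    using assms(3) by eventually_elim (use real in \<open>auto intro: epowr_mono\<close>)
  then show ?thesis using real
    by (auto simp: Nrm_def intro!: epowr_mono nn_integral_mono_AE)
qed

lemma Nrm_mono:
  assumes "0 < q" "g \<in> borel_measurable half_line" "\<And>x. 0 \<le> x \<Longrightarrow> g x \<le> h x"
  shows "Nrm q g \<le> Nrm q h"
  using assms by (intro Nrm_mono_AE) auto

text \<open>Since \<open>esssup\<close> has a default value at non-measurable functions, equality on
  the half line has to be shown to transfer measurability as well.\<close>

lemma Nrm_cong:
  assumes "\<And>x. 0 \<le> x \<Longrightarrow> g x = h x"
  shows "Nrm q g = Nrm q h"
proof -
  have "(\<integral>\<^sup>+x. g x epowr a \<partial>half_line) = (\<integral>\<^sup>+x. h x epowr a \<partial>half_line)" for a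
    using assms by (intro nn_integral_cong) auto
  moreover have "esssup half_line g = esssup half_line h"
  proof (cases "g \<in> borel_measurable half_line")
    case True
    then have "h \<in> borel_measurable half_line"
      using assms by (subst measurable_cong[of _ _ g]) auto
    then show ?thesis using True assms by (intro esssup_AE_cong) auto
  next
    case False
    then have "h \<notin> borel_measurable half_line"
      using assms by (subst measurable_cong[of _ _ g]) auto
    then show ?thesis using False by (simp add: esssup_non_measurable)
  qed
  ultimately show ?thesis by (simp add: Nrm_def)
qed

lemma Nrm_zero [simp]: "0 < q \<Longrightarrow> Nrm q (\<lambda>x. 0) = 0"
  by (cases rule: ennreal_pos_cases[of q]) (auto simp: Nrm_def esssup_le_iff simp flip: le_zero_eq)

lemma Nrm_cmult:
  assumes "0 < q" and [measurable]: "g \<in> borel_measurable half_line"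
  shows "Nrm q (\<lambda>x. c * g x) = c * Nrm q g"
  using assms(1)
proof (cases rule: ennreal_pos_cases)
  case top
  have 1: "esssup half_line (\<lambda>x. c * g x) \<le> c * esssup half_line g"
    using esssup_AE[of g half_line]
    by (auto simp: esssup_le_iff elim!: eventually_mono intro: mult_left_mono)
  have 2: "c * esssup half_line g \<le> esssup half_line (\<lambda>x. c * g x)"
  proof -
    \<comment> \<open>An infinite factor obeys \<open>\<infinity> * 0 = 0\<close>: the product is
      \<open>\<infinity>\<close> exactly where \<open>g\<close> is positive, and what counts is
      whether that set is null.\<close>
    consider "c = 0" | "c = \<infinity>" "AE x in half_line. g x = 0" | "c = \<infinity>" "\<not> (AE x in half_line. g x = 0)"
      | "c \<noteq> 0" "c \<noteq> \<infinity>" by blast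
    then show ?thesis
    proof cases
      case 2
      then have "esssup half_line g \<le> 0" by (subst esssup_le_iff) auto
      then show ?thesis using 2 by simp
    next
      case 3
      have "esssup half_line (\<lambda>x. c * g x) = \<infinity>"
      proof (rule ccontr)
        assume "esssup half_line (\<lambda>x. c * g x) \<noteq> \<infinity>"
        then have "AE x in half_line. c * g x < \<infinity>"
          using esssup_AE[of "\<lambda>x. c * g x" half_line]
          by (auto elim!: eventually_mono simp: less_top[symmetric] top_unique)
        then have "AE x in half_line. g x = 0"
          using 3 by (auto elim!: eventually_mono simp: ennreal_top_mult split: if_splits)
        then show False using 3 by simp
      qed
      then show ?thesis by simp
    next
      case 4
      then obtain d where d: "c = ennreal d" "0 < d" by (cases c) auto
      have eq: "y \<le> ennreal (1 / d) * z \<longleftrightarrow> c * y \<le> z" for y z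
      proof
        assume "y \<le> ennreal (1 / d) * z"
        then have "c * y \<le> c * (ennreal (1 / d) * z)" by (rule mult_left_mono) simp
        then show "c * y \<le> z" using d by (simp add: mult.assoc[symmetric] ennreal_mult[symmetric])
      next
        assume "c * y \<le> z"
        then have "ennreal (1 / d) * (c * y) \<le> ennreal (1 / d) * z" by (rule mult_left_mono) simp
        then show "y \<le> ennreal (1 / d) * z" using d by (simp add: mult.assoc[symmetric] ennreal_mult[symmetric])
      qed
      have "AE x in half_line. g x \<le> ennreal (1 / d) * esssup half_line (\<lambda>x. c * g x)"
        using esssup_AE[of "\<lambda>x. c * g x" half_line] by (simp add: eq)
      then have "esssup half_line g \<le> ennreal (1 / d) * esssup half_line (\<lambda>x. c * g x)"
        by (simp add: esssup_le_iff)
      then show ?thesis by (simp add: eq)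
    qed auto
  qed
  show ?thesis using top 1 2 by (simp add: Nrm_def order.antisym)
next
  case (real a)
  then show ?thesis by (simp add: Nrm_def epowr_mult nn_integral_cmult epowr_inverse)
qed

lemma Nrm_add:
  assumes "0 < q" and [measurable]: "g \<in> borel_measurable half_line" "h \<in> borel_measurable half_line"
  shows "Nrm q (\<lambda>x. g x + h x) \<le> ennreal (qconst q) * (Nrm q g + Nrm q h)"
  using assms(1)
proof (cases rule: ennreal_pos_cases)
  case top
  have "esssup half_line (\<lambda>x. g x + h x) \<le> esssup half_line g + esssup half_line h"
    using esssup_AE[of g half_line] esssup_AE[of h half_line]
    by (subst esssup_le_iff) (auto elim!: eventually_elim2 intro: add_mono)
  also have "\<dots> \<le> ennreal 2 * \<dots>" by (simp add: mult_2)
  finally show ?thesis using top by (simp add: Nrm_def qconst_def)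
next
  case (real a)
  have "(\<integral>\<^sup>+x. (g x + h x) epowr a \<partial>half_line) \<le> (\<integral>\<^sup>+x. ennreal (2 powr a) * (g x epowr a + h x epowr a) \<partial>half_line)"
    using real by (intro nn_integral_mono epowr_add_le)
  also have "\<dots> = ennreal (2 powr a) * ((\<integral>\<^sup>+x. g x epowr a \<partial>half_line) + (\<integral>\<^sup>+x. h x epowr a \<partial>half_line))"
    by (simp add: nn_integral_cmult nn_integral_add)
  finally have "Nrm q (\<lambda>x. g x + h x) \<le>
    (ennreal (2 powr a) * ((\<integral>\<^sup>+x. g x epowr a \<partial>half_line) + (\<integral>\<^sup>+x. h x epowr a \<partial>half_line))) epowr (1 / a)"
    using real by (simp add: Nrm_def epowr_mono)
  also have "\<dots> = 2 * (((\<integral>\<^sup>+x. g x epowr a \<partial>half_line) + (\<integral>\<^sup>+x. h x epowr a \<partial>half_line)) epowr (1 / a))"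
    using real by (simp add: epowr_mult epowr_ennreal powr_powr)
  also have "\<dots> \<le> 2 * (ennreal (2 powr (1/a)) * (Nrm q g + Nrm q h))"
    using real by (intro mult_left_mono order.trans[OF epowr_add_le]) (auto simp: Nrm_def)
  finally show ?thesis using real by (simp add: qconst_def ennreal_mult mult.assoc)
qed

lemma Nrm_SUP:
  assumes "0 < q" and [measurable]: "\<And>i::nat. g i \<in> borel_measurable half_line"
    and inc: "\<And>i x. g i x \<le> g (Suc i) x"
  shows "Nrm q (\<lambda>x. SUP i. g i x) = (SUP i. Nrm q (g i))"
  using assms(1)
proof (cases rule: ennreal_pos_cases)
  case top
  have "AE x in half_line. (SUP i. g i x) \<le> (SUP i. esssup half_line (g i))"
  proof -
    have "AE x in half_line. \<forall>i. g i x \<le> esssup half_line (g i)"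
      by (subst AE_all_countable) (simp add: esssup_AE)
    then show ?thesis by eventually_elim (auto intro!: SUP_mono)
  qed
  then have "esssup half_line (\<lambda>x. SUP i. g i x) \<le> (SUP i. esssup half_line (g i))"
    by (subst esssup_le_iff) auto
  moreover have "(SUP i. esssup half_line (g i)) \<le> esssup half_line (\<lambda>x. SUP i. g i x)"
    by (intro SUP_least esssup_mono) (auto intro: SUP_upper)
  ultimately show ?thesis using top by (simp add: Nrm_def order.antisym)
next
  case (real a)
  have "(\<integral>\<^sup>+x. (SUP i. g i x) epowr a \<partial>half_line) = (\<integral>\<^sup>+x. (SUP i. g i x epowr a) \<partial>half_line)"
    using real by (simp add: epowr_SUP)
  also have "\<dots> = (SUP i. \<integral>\<^sup>+x. g i x epowr a \<partial>half_line)"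
    using real inc by (intro nn_integral_monotone_convergence_SUP)
      (auto simp: incseq_Suc_iff le_fun_def intro!: epowr_mono)
  finally show ?thesis using real by (simp add: Nrm_def epowr_SUP)
qed

text \<open>For finite \<open>q\<close> this is measurability of parameter integrals. For
  \<open>q = \<infinity>\<close> a sublevel set consists of the \<open>t\<close> for which a slice
  of a measurable subset of the product is null, and slice measures depend measurably on
  \<open>t\<close> by sigma-finiteness.\<close>

lemma Nrm_measurable:
  assumes "0 < q" and [measurable]: "case_prod g \<in> borel_measurable (M \<Otimes>\<^sub>M half_line)"
  shows "(\<lambda>t. Nrm q (g t)) \<in> borel_measurable M"
  using assms(1)
proof (cases rule: ennreal_pos_cases)
  case top
  have "{t \<in> space M. esssup half_line (g t) \<le> c} \<in> sets M" for c
  proof -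
    have "{t \<in> space M. esssup half_line (g t) \<le> c} = {t \<in> space M. AE y in half_line. g t y \<le> c}"
      by (auto simp: esssup_le_iff)
    also have "\<dots> = {t \<in> space M. emeasure half_line {y \<in> space half_line. \<not> (g t y \<le> c)} = 0}"
    proof (intro Collect_cong conj_cong refl AE_iff_measurable)
      fix t assume "t \<in> space M"
      then have [measurable]: "g t \<in> borel_measurable half_line"
        using measurable_Pair2[OF assms(2)] by auto
      show "{y \<in> space half_line. \<not> g t y \<le> c} \<in> sets half_line" by measurable
    qed
    also have "\<dots> \<in> sets M"
    proof -
      let ?Q = "{z \<in> space (M \<Otimes>\<^sub>M half_line). \<not> case_prod g z \<le> c}"
      have "?Q \<in> sets (M \<Otimes>\<^sub>M half_line)" by measurable
      then have [measurable]: "(\<lambda>t. emeasure half_line (Pair t -` ?Q)) \<in> borel_measurable M"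
        by (rule half_line.measurable_emeasure_Pair)
      have "{t \<in> space M. emeasure half_line {y \<in> space half_line. \<not> (g t y \<le> c)} = 0} =
          {t \<in> space M. emeasure half_line (Pair t -` ?Q) = 0}"
        by (intro Collect_cong conj_cong refl arg_cong2[where f="(=)"] arg_cong[where f="emeasure half_line"])
           (auto simp: space_pair_measure)
      also have "\<dots> \<in> sets M" by measurable
      finally show ?thesis .
    qed
    finally show ?thesis .
  qed
  then show ?thesis using top by (auto simp: Nrm_def intro!: borel_measurableI_le)
next
  case (real a)
  then show ?thesis by (simp add: Nrm_def)
qed

lemma Nrm_indicator_finite:
  assumes "0 < q"
  shows "Nrm q (indicator {0..b}) < \<infinity>"
  using assms
proof (cases rule: ennreal_pos_cases)
  case top
  have "esssup half_line (indicator {0..b} :: real \<Rightarrow> ennreal) \<le> 1"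
    by (intro esssup_I borel_measurable_half_line) (auto simp: indicator_def)
  then show ?thesis using top by (auto simp: Nrm_def top_unique intro: le_less_trans)
next
  case (real a)
  have "(\<integral>\<^sup>+x. (indicator {0..b} x) epowr a \<partial>half_line) = (\<integral>\<^sup>+x. indicator {0..b} x \<partial>half_line)"
    by (intro nn_integral_cong) (auto simp: indicator_def)
  also have "\<dots> = (\<integral>\<^sup>+x. indicator {0..b} x \<partial>lebesgue)"
    by (subst nn_integral_restrict_space) (auto simp flip: indicator_inter_arith intro!: nn_integral_cong split: split_indicator)
  also have "\<dots> < \<infinity>" by (simp add: emeasure_lborel_Icc_eq)
  finally show ?thesis using real by (simp add: Nrm_def epowr_less_top_iff)
qed

lemma Nrm_scale:
  assumes a: "0 < a" and r: "0 < r" and [measurable]: "h \<in> borel_measurable borel"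
  shows "Nrm (ennreal r) (\<lambda>t. h (a * t)) = ennreal (a powr (- 1 / r)) * Nrm (ennreal r) h"
proof -
  have *: "(\<integral>\<^sup>+x. g x \<partial>half_line) = (\<integral>\<^sup>+x. g x * indicator {0..} x \<partial>lborel)" for g :: "real \<Rightarrow> ennreal"
    by (subst nn_integral_restrict_space) (auto simp: nn_integral_completion)
  have "(\<integral>\<^sup>+x. h x epowr r \<partial>half_line) = (\<integral>\<^sup>+x. h x epowr r * indicator {0..} x \<partial>lborel)"
    by (rule *)
  also have "\<dots> = ennreal a * (\<integral>\<^sup>+x. h (0 + a * x) epowr r * indicator {0..} (0 + a * x) \<partial>lborel)"
    using a by (subst nn_integral_real_affine[of _ a 0]) auto
  also have "(\<integral>\<^sup>+x. h (0 + a * x) epowr r * indicator {0..} (0 + a * x) \<partial>lborel) =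
      (\<integral>\<^sup>+x. h (a * x) epowr r * indicator {0..} x \<partial>lborel)"
    using a by (intro nn_integral_cong) (auto simp: indicator_def zero_le_mult_iff)
  finally have "ennreal (1 / a) * (\<integral>\<^sup>+x. h x epowr r \<partial>half_line) = (\<integral>\<^sup>+x. h (a * x) epowr r \<partial>half_line)"
    using a by (simp add: * mult.assoc[symmetric] ennreal_mult'[symmetric])
  then show ?thesis using a r
    by (simp add: Nrm_def flip: \<open>ennreal (1 / a) * _ = _\<close>)
       (simp add: epowr_mult epowr_ennreal powr_divide powr_minus_divide)
qed

section \<open>Least constants\<close>

lemma least_const_apply:
  assumes "least_const p v \<Phi> < \<infinity>" "f \<in> Mplus" "Lnorm (ennreal p) v f < \<infinity>"
  shows "\<Phi> f \<le> least_const p v \<Phi> * Lnorm (ennreal p) v f"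
proof -
  let ?S = "{C. \<forall>f\<in>Mplus. \<Phi> f \<le> C * Lnorm (ennreal p) v f}"
  have ne: "?S \<noteq> {}"
  proof
    assume "?S = {}"
    then have "least_const p v \<Phi> = \<infinity>" unfolding least_const_def by (simp only:) simp
    then show False using assms(1) by simp
  qed
  show ?thesis
  proof (cases "Lnorm (ennreal p) v f = 0")
    case True
    then show ?thesis using ne assms(2) by auto
  next
    case False
    then have "0 < Lnorm (ennreal p) v f" by (simp add: zero_less_iff_neq_zero)
    note eq = divide_le_iff_ennreal[OF this assms(3)[unfolded infinity_ennreal_def]]
    have "\<Phi> f / Lnorm (ennreal p) v f \<le> Inf ?S"
      using assms(2) by (intro Inf_greatest) (auto simp: eq mult.commute)
    then show ?thesis by (simp add: eq least_const_def mult.commute)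
  qed
qed

text \<open>Functions of infinite norm may be ignored at the cost of an \<epsilon>: with
  \<open>C = 0\<close> the product \<open>0 * \<infinity>\<close> would be 0, whereas
  \<open>C + \<epsilon>\<close> makes the right-hand side infinite.\<close>

lemma least_const_le:
  assumes "\<And>f. f \<in> Mplus \<Longrightarrow> Lnorm (ennreal p) v f < \<infinity> \<Longrightarrow> \<Phi> f \<le> C * Lnorm (ennreal p) v f"
  shows "least_const p v \<Phi> \<le> C"
proof (rule ennreal_le_epsilon)
  fix e :: real assume "0 < e"
  have "\<Phi> f \<le> (C + ennreal e) * Lnorm (ennreal p) v f" if f: "f \<in> Mplus" for f
  proof (cases "Lnorm (ennreal p) v f < \<infinity>")
    case True
    then show ?thesis using assms[OF f True] by (auto simp: distrib_right intro: order.trans)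
  next
    case False
    then have "(C + ennreal e) * Lnorm (ennreal p) v f = \<infinity>"
      using \<open>0 < e\<close> by (simp add: less_top[symmetric] ennreal_mult_top)
    then show ?thesis by simp
  qed
  then show "least_const p v \<Phi> \<le> C + ennreal e"
    unfolding least_const_def by (intro Inf_lower) auto
qed

lemma least_const_greater:
  assumes "c < least_const p v \<Phi>"
  obtains f where "f \<in> Mplus" "Lnorm (ennreal p) v f < \<infinity>" "\<not> \<Phi> f \<le> c * Lnorm (ennreal p) v f"
  using least_const_le[of p v \<Phi> c] assms by (meson leD)

section \<open>The primitive of the weight and its inverse\<close>

lemma prim_eq: "prim f x = (\<integral>\<^sup>+z. f z * indicator {..x} z \<partial>half_line)"
  unfolding prim_def
  by (subst nn_integral_restrict_space) (auto intro!: nn_integral_cong split: split_indicator)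

lemma prim_mono: "x \<le> y \<Longrightarrow> prim f x \<le> prim f y"
  unfolding prim_eq by (intro nn_integral_mono mult_left_mono) (auto split: split_indicator)

lemma prim_mono_fun: "(\<And>z. 0 \<le> z \<Longrightarrow> z \<le> x \<Longrightarrow> f z \<le> g z) \<Longrightarrow> prim f x \<le> prim g x"
  unfolding prim_eq by (intro nn_integral_mono) (auto split: split_indicator)

text \<open>A monotone function is Borel, because its sublevel sets are intervals.\<close>

lemma prim_measurable [measurable]: "prim f \<in> borel_measurable borel"
proof (rule borel_measurableI_le)
  fix c :: ennreal
  have "is_interval {x. prim f x \<le> c}"
    by (auto simp: is_interval_1 intro: order.trans[OF prim_mono])
  then show "{x \<in> space borel. prim f x \<le> c} \<in> sets borel"
    by (simp add: real_interval_borel_measurable)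
qed

lemma prim_cmult:
  "f \<in> Mplus \<Longrightarrow> prim (\<lambda>z. c * f z) x = c * prim f x"
  unfolding prim_eq Mplus_def by (simp add: mult.assoc nn_integral_cmult)

lemma Icc_integral_eq_prim:
  "(\<integral>\<^sup>+z\<in>{c..y}. f z \<partial>lebesgue) = prim (\<lambda>z. f z * indicator {c..} z) y" if "0 \<le> c"
  unfolding prim_def using that by (intro nn_integral_cong) (auto split: split_indicator)

lemma prim_split_le:
  assumes "f \<in> Mplus"
  shows "prim f y \<le> prim f x + prim (\<lambda>z. f z * indicator {x..} z) y"
proof -
  have [measurable]: "f \<in> borel_measurable half_line" using assms by (simp add: Mplus_def)
  have "prim f y \<le> (\<integral>\<^sup>+z. f z * indicator {..x} z + f z * indicator {x..} z * indicator {..y} z \<partial>half_line)"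
    unfolding prim_eq by (intro nn_integral_mono) (auto split: split_indicator)
  also have "\<dots> = prim f x + prim (\<lambda>z. f z * indicator {x..} z) y"
    unfolding prim_eq by (intro nn_integral_add) auto
  finally show ?thesis .
qed

locale primitive_weight =
  fixes u :: "real \<Rightarrow> ennreal"
  assumes u_Mplus: "u \<in> Mplus"
    and prim_finite: "\<And>t. 0 < t \<Longrightarrow> prim u t < \<infinity>"
begin

lemma u_measurable [measurable]: "u \<in> borel_measurable half_line"
  using u_Mplus by (simp add: Mplus_def)

definition U :: "real \<Rightarrow> real" where "U y = enn2real (prim u y)"

text \<open>The value 0 is excluded because \<open>0 \<le> U y\<close> holds for every real
  \<open>y\<close>, so its level set has no infimum.\<close>

definition T :: "real set" where "T = {t. 0 < t \<and> (\<exists>y. t \<le> U y)}"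

definition \<xi> :: "real \<Rightarrow> real" where "\<xi> t = (if t \<in> T then Inf {y. t \<le> U y} else 0)"

lemma prim_u: "prim u y = ennreal (U y)"
proof -
  have "prim u y \<le> prim u (max y 1)" by (intro prim_mono) auto
  also have "\<dots> < \<infinity>" by (intro prim_finite) auto
  finally show ?thesis by (simp add: U_def)
qed

lemma U_nonneg: "0 \<le> U y"
  by (simp add: U_def)

lemma U_mono: "x \<le> y \<Longrightarrow> U x \<le> U y"
  using prim_mono[of x y u] by (simp add: prim_u ennreal_le_iff U_nonneg)

lemma U_zero: "x \<le> 0 \<Longrightarrow> U x = 0"
proof -
  assume "x \<le> 0"
  then have "prim u x = (\<integral>\<^sup>+z. u z * indicator {..x} z \<partial>half_line)" by (simp add: prim_eq)
  also have "\<dots> = (\<integral>\<^sup>+z. 0 \<partial>half_line)"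
  proof (intro nn_integral_cong_AE)
    have "AE z in lebesgue. z \<noteq> (0::real)" by (intro AE_completion AE_lborel_singleton)
    then have "AE z in half_line. z \<noteq> (0::real)" by (auto simp: AE_restrict_space_iff)
    then show "AE z in half_line. u z * indicator {..x} z = 0"
      using AE_space[of half_line] by eventually_elim (use \<open>x \<le> 0\<close> in \<open>auto split: split_indicator\<close>)
  qed
  finally show ?thesis by (simp add: U_def)
qed

text \<open>Near \<open>x\<close>, \<open>U\<close> is the distribution function of a finite measure
  without atoms. Cutting \<open>u\<close> off at \<open>x + 1\<close> provides the finiteness
  without changing \<open>U\<close> near \<open>x\<close>.\<close>

lemma isCont_U: "isCont U x"
proof -
  define b where "b = x + 1"
  define M where "M = distr (density half_line (\<lambda>z. u z * indicator {..b} z)) borel (\<lambda>z. z)"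
  have eM: "emeasure M A = (\<integral>\<^sup>+z. u z * indicator {..b} z * indicator A z \<partial>half_line)" if "A \<in> sets borel" for A
    using that by (simp add: M_def emeasure_distr emeasure_density measurable_sets_borel)
       (auto intro!: nn_integral_cong split: split_indicator)
  have "emeasure M UNIV = prim u b" by (subst eM) (simp_all add: prim_eq)
  moreover have "space M = UNIV" "sets M = sets borel" by (simp_all add: M_def)
  ultimately interpret M: finite_borel_measure M
    by (intro finite_borel_measure.intro finite_measureI finite_borel_measure_axioms.intro)
       (simp_all add: prim_u)
  have cdf: "cdf M y = U y" if "y \<le> b" for y
  proof -
    have "emeasure M {..y} = prim u y"
      using that by (subst eM) (auto simp: prim_eq intro!: nn_integral_cong split: split_indicator)
    then show ?thesis by (simp add: cdf_def measure_def U_def)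
  qed
  have "emeasure M {x} = 0"
  proof -
    have "AE z in lebesgue. z \<noteq> x" by (intro AE_completion AE_lborel_singleton)
    then have "AE z in half_line. z \<noteq> x" by (auto simp: AE_restrict_space_iff)
    then have "AE z in half_line. u z * indicator {..b} z * indicator {x} z = 0"
      by eventually_elim auto
    then have "(\<integral>\<^sup>+z. u z * indicator {..b} z * indicator {x} z \<partial>half_line) = (\<integral>\<^sup>+z. 0 \<partial>half_line)"
      by (rule nn_integral_cong_AE)
    moreover have "emeasure M {x} = (\<integral>\<^sup>+z. u z * indicator {..b} z * indicator {x} z \<partial>half_line)"
      by (rule eM) simp
    ultimately show ?thesis by simp
  qed
  then have "isCont (cdf M) x" by (simp add: M.isCont_cdf measure_def)
  moreover have "eventually (\<lambda>y. cdf M y = U y) (nhds x)"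
    using eventually_nhds_in_open[of "{..<b}" x] by (auto simp: b_def cdf elim!: eventually_mono)
  ultimately show ?thesis by (simp add: isCont_cong)
qed

lemma continuous_U: "continuous_on A U"
  by (simp add: continuous_at_imp_continuous_on isCont_U)

lemma U_measurable [measurable]: "U \<in> borel_measurable borel"
  by (intro borel_measurable_continuous_onI continuous_U)

text \<open>By continuity the superlevel set is closed, so its infimum is attained. The resulting
  Galois connection stands in for the infimum from here on.\<close>

lemma xi_le_iff: assumes "t \<in> T" shows "\<xi> t \<le> y \<longleftrightarrow> t \<le> U y"
proof -
  let ?S = "{y. t \<le> U y}"
  have t: "0 < t" and ne: "?S \<noteq> {}" using assms by (auto simp: T_def)
  have bdd: "bdd_below ?S"
    using t U_zero by (intro bdd_belowI[of _ 0]) (metis linorder_le_cases mem_Collect_eq not_less)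
  have "closed ?S"
    using closed_Collect_le[of "\<lambda>_. t" U] continuous_U by auto
  then have "Inf ?S \<in> ?S" using closed_contains_Inf[OF ne bdd] by simp
  then show ?thesis
    using assms U_mono[of "Inf ?S" y] cInf_lower[of y ?S] bdd by (auto simp: \<xi>_def)
qed

lemma U_xi: assumes "t \<in> T" shows "U (\<xi> t) = t"
proof (rule order.antisym)
  show "t \<le> U (\<xi> t)" using xi_le_iff[OF assms, of "\<xi> t"] by simp
  show "U (\<xi> t) \<le> t"
  proof (rule ccontr)
    \<comment> \<open>If \<open>U\<close> exceeded \<open>t\<close> at \<xi> t, then by continuity
      it would do so slightly to the left, against the minimality of \<xi> t.\<close>
    assume *: "\<not> U (\<xi> t) \<le> t"
    then have "((\<lambda>y. U y) \<longlongrightarrow> U (\<xi> t)) (at_left (\<xi> t))"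
      using isCont_U[of "\<xi> t"] by (auto simp: isCont_def filterlim_at_split)
    then have "eventually (\<lambda>y. t < U y) (at_left (\<xi> t))"
      using * by (intro order_tendstoD) auto
    moreover have "eventually (\<lambda>y. y < \<xi> t) (at_left (\<xi> t))"
      by (simp add: eventually_at_filter)
    ultimately have "eventually (\<lambda>y. False) (at_left (\<xi> t))"
      by eventually_elim (use xi_le_iff[OF assms] in \<open>auto simp: not_le[symmetric]\<close>)
    then show False by simp
  qed
qed

lemma xi_pos: "t \<in> T \<Longrightarrow> 0 < \<xi> t"
  using xi_le_iff[of t 0] U_zero[of 0] by (auto simp: T_def)

lemma xi_nonneg [simp]: "0 \<le> \<xi> t"
  using xi_pos[of t] by (cases "t \<in> T") (auto simp: \<xi>_def)

lemma T_down: "t \<in> T \<Longrightarrow> 0 < s \<Longrightarrow> s \<le> t \<Longrightarrow> s \<in> T"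
  by (auto simp: T_def intro: order.trans)

lemma T_I: "0 < t \<Longrightarrow> t \<le> U y \<Longrightarrow> t \<in> T"
  by (auto simp: T_def)

lemma T_pos: "t \<in> T \<Longrightarrow> 0 < t"
  by (auto simp: T_def)

lemma xi_mono: "t \<in> T \<Longrightarrow> 0 < s \<Longrightarrow> s \<le> t \<Longrightarrow> \<xi> s \<le> \<xi> t"
  by (simp add: xi_le_iff T_down U_xi)

lemma T_sets [measurable]: "T \<in> sets borel"
proof -
  have "T = (\<Union>n::nat. {0<..U (real n)})"
    by (auto simp: T_def) (meson U_mono order.trans real_arch_simple)
  also have "\<dots> \<in> sets borel" by auto
  finally show ?thesis .
qed

lemma xi_measurable [measurable]: "\<xi> \<in> borel_measurable borel"
proof (rule borel_measurableI_le)
  fix y :: real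
  have "{t \<in> space borel. \<xi> t \<le> y} = ({t\<in>T. t \<le> U y} \<union> (if 0 \<le> y then - T else {}))"
    by (auto simp: xi_le_iff) (use xi_nonneg in \<open>auto simp: \<xi>_def intro: order.trans\<close>)
  also have "\<dots> \<in> sets borel" by auto
  finally show "{t \<in> space borel. \<xi> t \<le> y} \<in> sets borel" .
qed

text \<open>Both integrals are taken against Borel measures with distribution function
  \<open>U\<close>: by \<open>xi_le_iff\<close> the condition \<open>\<xi> t \<le> x\<close> cuts
  out the interval from 0 to \<open>U x\<close>. Finite measures on the half-lines
  \<open>{..x}\<close> determine a Borel measure.\<close>

lemma nn_integral_weight_eq:
  assumes [measurable]: "\<Psi> \<in> borel_measurable borel"
  shows "(\<integral>\<^sup>+x. \<Psi> x * u x \<partial>half_line) = (\<integral>\<^sup>+t. \<Psi> (\<xi> t) * indicator T t \<partial>half_line)"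
proof -
  let ?\<mu> = "distr (density half_line u) borel (\<lambda>z. z)"
  let ?\<nu> = "distr (density half_line (indicator T)) borel \<xi>"
  have [measurable]: "indicator T \<in> borel_measurable half_line" "\<xi> \<in> borel_measurable half_line"
    by (auto intro!: borel_measurable_half_line)
  have 1: "emeasure ?\<mu> {..x} = ennreal (U x)" for x
    by (simp add: emeasure_distr emeasure_density measurable_sets_borel flip: prim_u)
       (auto simp: prim_eq intro!: nn_integral_cong split: split_indicator)
  have 2: "emeasure ?\<nu> {..x} = ennreal (U x)" for x
  proof -
    have "emeasure ?\<nu> {..x} = (\<integral>\<^sup>+t. indicator T t * indicator (\<xi> -` {..x} \<inter> {0..}) t \<partial>half_line)"
      by (subst emeasure_distr) (auto simp: emeasure_density)
    also have "\<dots> = (\<integral>\<^sup>+t. indicator {0<..U x} t \<partial>half_line)"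
      by (intro nn_integral_cong) (auto simp: xi_le_iff intro: T_I dest: T_pos split: split_indicator)
    also have "\<dots> = emeasure half_line {0<..U x}"
      by (intro nn_integral_indicator) (auto simp: sets_restrict_space_iff)
    also have "\<dots> = ennreal (U x)" by (subst emeasure_restrict_space) (auto simp: U_nonneg)
    finally show ?thesis .
  qed
  have eq: "?\<mu> = ?\<nu>"
  proof (rule measure_eqI_generator_eq[where E="range atMost" and \<Omega>=UNIV and A="\<lambda>i. {..real i}"])
    show "Int_stable (range (atMost :: real \<Rightarrow> real set))" by (auto simp: Int_stable_def)
    show "sets ?\<mu> = sigma_sets UNIV (range atMost)" "sets ?\<nu> = sigma_sets UNIV (range atMost)"
      by (auto simp: borel_eq_atMost)
    show "(\<Union>i::nat. {..real i}) = UNIV" by (auto simp: real_arch_simple)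
  qed (auto simp: 1 2)
  have "(\<integral>\<^sup>+x. \<Psi> x * u x \<partial>half_line) = (\<integral>\<^sup>+x. \<Psi> x \<partial>?\<mu>)"
    by (simp add: nn_integral_distr nn_integral_density borel_measurable_half_line mult.commute)
  also have "\<dots> = (\<integral>\<^sup>+t. \<Psi> (\<xi> t) * indicator T t \<partial>half_line)"
    unfolding eq by (simp add: nn_integral_distr nn_integral_density borel_measurable_half_line mult.commute)
  finally show ?thesis .
qed

lemma Lnorm_weight_eq:
  assumes [measurable]: "\<Psi> \<in> borel_measurable borel" and r: "0 < r"
  shows "Lnorm (ennreal r) u \<Psi> = Nrm (ennreal r) (\<lambda>t. \<Psi> (\<xi> t) * indicator T t)"
proof -
  have "(\<integral>\<^sup>+x. (\<Psi> x epowr r) * u x \<partial>half_line) = (\<integral>\<^sup>+t. (\<Psi> (\<xi> t) epowr r) * indicator T t \<partial>half_line)"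
    by (rule nn_integral_weight_eq) measurable
  also have "\<dots> = (\<integral>\<^sup>+t. (\<Psi> (\<xi> t) * indicator T t) epowr r \<partial>half_line)"
    by (intro nn_integral_cong) (auto split: split_indicator)
  finally show ?thesis using r by (simp add: Lnorm_def Nrm_def nn_integral_half_line)
qed

section \<open>The maps sigma in terms of the generalized inverse\<close>

lemma Inf_level_set:
  assumes "0 < t"
  shows "Inf (ereal ` {y. 0 < y \<and> ennreal t \<le> prim u y}) = (if t \<in> T then ereal (\<xi> t) else \<infinity>)"
proof (cases "t \<in> T")
  case True
  then have "{y. 0 < y \<and> ennreal t \<le> prim u y} = {\<xi> t..}"
    using assms less_le_trans[OF xi_pos[OF True]] by (auto simp: prim_u U_nonneg xi_le_iff[OF True])
  then have "Inf (ereal ` {y. 0 < y \<and> ennreal t \<le> prim u y}) = Inf (ereal ` {\<xi> t..})" by simp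
  also have "\<dots> = ereal (\<xi> t)"
    by (intro Inf_eqI) auto
  finally show ?thesis using True by simp
next
  case False
  then have "{y. 0 < y \<and> ennreal t \<le> prim u y} = {}"
    using assms by (auto simp: prim_u ennreal_le_iff U_nonneg T_def)
  then show ?thesis using False by (simp only:) (simp add: top_ereal_def)
qed

lemma sigma_eq: assumes "0 < U x"
  shows "sigma u x = (if 2 * U x \<in> T then ereal (\<xi> (2 * U x)) else \<infinity>)"
  using Inf_level_set[of "2 * U x"] assms
  by (simp add: sigma_def prim_u ennreal_mult U_nonneg)

text \<open>Since \<open>U (\<xi> (2 * U x)) = 2 * U x\<close>, the second application doubles the
  same quantity again; and if \<open>2 * U x\<close> is already outside \<open>T\<close>, so is
  \<open>4 * U x\<close>.\<close>

lemma sigma2_eq: assumes "0 < U x"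
  shows "sigma2 u x = (if 4 * U x \<in> T then ereal (\<xi> (4 * U x)) else \<infinity>)"
  using assms sigma_eq[of x] sigma_eq[of "\<xi> (2 * U x)"] T_down[of "4 * U x" "2 * U x"]
  by (auto simp: sigma2_def U_xi)

lemma sigma_inv_eq: assumes "0 < U x" shows "sigma_inv u x = \<xi> (U x / 2)"
proof -
  have T: "U x / 2 \<in> T" using assms by (intro T_I[of _ x]) auto
  have "prim u x / 2 = ennreal (U x / 2)" by (simp add: prim_u U_nonneg ennreal_divide_numeral)
  then have "{y. 0 < y \<and> prim u x / 2 \<le> prim u y} = {\<xi> (U x / 2)..}"
    using assms less_le_trans[OF xi_pos[OF T]]
    unfolding \<open>prim u x / 2 = _\<close> by (auto simp: prim_u U_nonneg xi_le_iff[OF T])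
  then show ?thesis by (simp add: sigma_inv_def)
qed

end

section \<open>The constants in terms of one norm\<close>

text \<open>The exponent with which weight and kernel enter the norm.\<close>

definition rt_exp :: "ennreal \<Rightarrow> real" where
  "rt_exp q = (if q = \<infinity> then 1 else 1 / enn2real q)"

text \<open>One constant above all three that occur: the quasi-triangle constants for
  \<open>q\<close> and \<open>r\<close>, and the kernel constant \<open>D\<close> raised to
  \<open>rt_exp q\<close>, with the 2 from splitting a power of a sum.\<close>

definition Acst :: "ennreal \<Rightarrow> real \<Rightarrow> real \<Rightarrow> real" where
  "Acst q r D = qconst q + qconst (ennreal r) + (2 * D) powr rt_exp q"

locale weights = primitive_weight u for u :: "real \<Rightarrow> ennreal" +
  fixes p r D :: real and q :: ennreal and v w :: "real \<Rightarrow> ennreal" and k :: "real \<Rightarrow> real \<Rightarrow> real"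
  assumes p: "1 \<le> p" and r: "0 < r" and q: "0 < q"
    and v_Mplus: "v \<in> Mplus" and w_Mplus: "w \<in> Mplus"
    and oinarov: "oinarov_kernel D k"
begin

definition om :: "real \<Rightarrow> ennreal" where "om y = w y epowr rt_exp q"

text \<open>Extension by zero makes the kernel Borel on the whole plane; for nonnegative arguments
  it changes nothing, as \<open>k y x\<close> vanishes for \<open>y < x\<close>.\<close>

definition K :: "real \<Rightarrow> real \<Rightarrow> ennreal" where
  "K y x = (if 0 \<le> x \<and> x \<le> y then ennreal (k y x) epowr rt_exp q else 0)"

abbreviation "A \<equiv> Acst q r D"

abbreviation fnorm :: "(real \<Rightarrow> ennreal) \<Rightarrow> ennreal" where "fnorm \<equiv> Lnorm (ennreal p) v"

lemma v_measurable [measurable]: "v \<in> borel_measurable half_line"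
  and w_measurable [measurable]: "w \<in> borel_measurable half_line"
  using v_Mplus w_Mplus by (simp_all add: Mplus_def)

lemma om_measurable [measurable]: "om \<in> borel_measurable half_line"
  unfolding om_def by measurable

lemma U_half_line [measurable]: "U \<in> borel_measurable half_line"
  by (intro borel_measurable_half_line U_measurable)

lemma prim_half_line [measurable]: "prim f \<in> borel_measurable half_line"
  by (intro borel_measurable_half_line prim_measurable)

lemma rt_exp_pos: "0 < rt_exp q"
  using q by (cases rule: ennreal_pos_cases) (auto simp: rt_exp_def)

lemma D_ge_1: "1 \<le> D"
  using oinarov by (simp add: oinarov_kernel_def)

lemma qconst_ge_1: "1 \<le> qconst a"
proof -
  have "1 \<le> 2 powr (1 / enn2real a)" by (intro ge_one_powr_ge_zero) auto
  then show ?thesis by (simp add: qconst_def)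
qed

lemma A_ge_1: "1 \<le> A" and qconst_q_le: "qconst q \<le> A" and qconst_r_le: "qconst (ennreal r) \<le> A"
  and D_le_A: "(2 * D) powr rt_exp q \<le> A"
  using qconst_ge_1[of q] qconst_ge_1[of "ennreal r"] powr_ge_zero[of "2 * D" "rt_exp q"]
  unfolding Acst_def by linarith+

lemma k_pos: "0 \<le> x \<Longrightarrow> 0 \<le> y \<Longrightarrow> 0 \<le> k y x"
  and k_zero: "0 \<le> y \<Longrightarrow> y < x \<Longrightarrow> k y x = 0"
  using oinarov by (auto simp: oinarov_kernel_def)

lemma k_upper: "0 \<le> x \<Longrightarrow> x \<le> z \<Longrightarrow> z \<le> y \<Longrightarrow> k y x \<le> D * (k y z + k z x)"
  and k_lower: "0 \<le> x \<Longrightarrow> x \<le> z \<Longrightarrow> z \<le> y \<Longrightarrow> k y z + k z x \<le> D * k y x"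
  using oinarov D_ge_1 by (auto simp: oinarov_kernel_def field_simps)

lemma K_eq: "0 \<le> x \<Longrightarrow> 0 \<le> y \<Longrightarrow> K y x = ennreal (k y x) epowr rt_exp q"
  using k_zero[of y x] by (auto simp: K_def)

lemma K_finite: "K y x < \<infinity>"
  by (simp add: K_def epowr_less_top_iff)

lemma K_zero: "y < x \<Longrightarrow> K y x = 0"
  by (simp add: K_def)

lemma K_measurable: "(\<lambda>z. K (fst z) (snd z)) \<in> borel_measurable (borel \<Otimes>\<^sub>M borel)"
proof -
  have "(\<lambda>z. k (fst z) (snd z)) \<in> borel_measurable (restrict_space borel ({0..} \<times> {0..}))"
    using oinarov by (simp add: oinarov_kernel_def)
  moreover have "({0..} \<times> {0..} :: (real \<times> real) set) \<in> sets borel"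
    by (intro borel_closed closed_Times) auto
  ultimately have [measurable]:
    "(\<lambda>z. if z \<in> {0..} \<times> {0..} then k (fst z) (snd z) else 0) \<in> borel_measurable (borel \<Otimes>\<^sub>M borel)"
    by (simp add: measurable_restrict_space_iff[of _ _ 0] borel_prod)
  have "(\<lambda>z. K (fst z) (snd z)) = (\<lambda>z. if 0 \<le> snd z \<and> snd z \<le> fst z then
      ennreal (if z \<in> {0..} \<times> {0..} then k (fst z) (snd z) else 0) epowr rt_exp q else 0)"
    by (auto simp: K_def fun_eq_iff)
  also have "\<dots> \<in> borel_measurable (borel \<Otimes>\<^sub>M borel)" by measurable
  finally show ?thesis .
qed

lemma K_measurable_comp [measurable (raw)]:
  "f \<in> borel_measurable M \<Longrightarrow> g \<in> borel_measurable M \<Longrightarrow> (\<lambda>t. K (f t) (g t)) \<in> borel_measurable M"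
  using measurable_compose[OF measurable_Pair K_measurable] by simp

lemma K_upper: assumes "0 \<le> x" "x \<le> z" "z \<le> y" shows "K y x \<le> ennreal A * (K y z + K z x)"
proof -
  let ?e = "rt_exp q"
  have "ennreal (k y x) epowr ?e \<le> (ennreal D * (ennreal (k y z) + ennreal (k z x))) epowr ?e"
    using k_upper[OF assms] k_pos assms D_ge_1 rt_exp_pos
    by (intro epowr_mono) (auto simp: ennreal_mult[symmetric] ennreal_plus[symmetric] ennreal_leI simp del: ennreal_plus)
  also have "\<dots> = ennreal (D powr ?e) * ((ennreal (k y z) + ennreal (k z x)) epowr ?e)"
    using D_ge_1 rt_exp_pos by (simp add: epowr_mult epowr_ennreal)
  also have "\<dots> \<le> ennreal (D powr ?e) * (ennreal (2 powr ?e) * (ennreal (k y z) epowr ?e + ennreal (k z x) epowr ?e))"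
    using rt_exp_pos by (intro mult_left_mono epowr_add_le) auto
  also have "\<dots> = ennreal ((2 * D) powr ?e) * (K y z + K z x)"
    using assms D_ge_1 by (simp add: K_def powr_mult ennreal_mult mult_ac)
  also have "\<dots> \<le> ennreal A * (K y z + K z x)"
    using D_le_A by (intro mult_right_mono ennreal_leI) auto
  finally show ?thesis using assms by (simp add: K_def)
qed

lemma K_mono_aux: assumes "0 \<le> a" "a \<le> D * b" "0 \<le> b"
  shows "ennreal a epowr rt_exp q \<le> ennreal A * (ennreal b epowr rt_exp q)"
proof -
  let ?e = "rt_exp q"
  have "a powr ?e \<le> (D * b) powr ?e" using assms rt_exp_pos by (intro powr_mono2) auto
  also have "\<dots> = D powr ?e * b powr ?e" using D_ge_1 assms by (simp add: powr_mult)
  also have "\<dots> \<le> (2 * D) powr ?e * b powr ?e"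
    using D_ge_1 rt_exp_pos by (intro mult_right_mono powr_mono2) auto
  also have "\<dots> \<le> A * b powr ?e" using D_le_A by (intro mult_right_mono) auto
  finally show ?thesis using assms A_ge_1
    by (simp add: epowr_ennreal ennreal_mult[symmetric] ennreal_leI)
qed

text \<open>Dropping one of the two summands in the lower Oinarov bound leaves almost monotonicity:
  up to a constant the kernel decreases in its second argument and, by dropping the other summand in
  \<open>K_right\<close>, increases in its first.\<close>

lemma K_left: assumes "0 \<le> x" "x \<le> z" shows "K y z \<le> ennreal A * K y x"
proof (cases "z \<le> y")
  case True
  then show ?thesis using assms k_lower[of x z y] k_pos[of x z] k_pos[of z y] k_pos[of x y]
    K_mono_aux[of "k y z" "k y x"] by (auto simp: K_def)
qed (simp add: K_def)

lemma K_right: assumes "z \<le> y" shows "K z x \<le> ennreal A * K y x"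
proof (cases "0 \<le> x \<and> x \<le> z")
  case True
  then show ?thesis using assms k_lower[of x z y] k_pos[of x z] k_pos[of z y] k_pos[of x y]
    K_mono_aux[of "k z x" "k y x"] by (auto simp: K_def)
qed (auto simp: K_def)

lemma Nrm_q_add:
  assumes "g \<in> borel_measurable half_line" "h \<in> borel_measurable half_line"
  shows "Nrm q (\<lambda>x. g x + h x) \<le> ennreal A * (Nrm q g + Nrm q h)"
  by (rule order.trans[OF Nrm_add[OF q assms]]) (intro mult_right_mono ennreal_leI qconst_q_le, simp)

lemma Nrm_r_add:
  assumes "g \<in> borel_measurable half_line" "h \<in> borel_measurable half_line"
  shows "Nrm (ennreal r) (\<lambda>x. g x + h x) \<le> ennreal A * (Nrm (ennreal r) g + Nrm (ennreal r) h)"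
  using r by (intro order.trans[OF Nrm_add[OF _ assms]])
    (simp, intro mult_right_mono ennreal_leI qconst_r_le, simp)

text \<open>Passing from the weighted expressions to \<open>Nrm q\<close> removes the distinction between
  finite and infinite \<open>q\<close>.\<close>

lemma weighted_Nrm:
  assumes a: "\<And>y. 0 \<le> y \<Longrightarrow> a y = b y epowr rt_exp q"
  shows "Nrm q (\<lambda>y. a y * h y) =
    (if q = \<infinity> then esssup half_line (\<lambda>y. b y * h y)
     else (\<integral>\<^sup>+y. b y * (h y epowr enn2real q) \<partial>half_line) epowr (1 / enn2real q))"
  using q
proof (cases rule: ennreal_pos_cases)
  case top
  have "Nrm q (\<lambda>y. a y * h y) = Nrm q (\<lambda>y. b y * h y)"
    using a top by (intro Nrm_cong) (simp add: rt_exp_def)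
  then show ?thesis using top by (simp add: Nrm_def)
next
  case (real c)
  have "(\<integral>\<^sup>+y. (a y * h y) epowr c \<partial>half_line) = (\<integral>\<^sup>+y. b y * (h y epowr c) \<partial>half_line)"
    using real a by (intro nn_integral_cong) (simp add: epowr_mult rt_exp_def epowr_inverse')
  then show ?thesis using real by (simp add: Nrm_def)
qed

lemma Lnorm_q: "Lnorm q b h =
    (if q = \<infinity> then esssup half_line (\<lambda>y. b y * h y)
     else (\<integral>\<^sup>+y. b y * (h y epowr enn2real q) \<partial>half_line) epowr (1 / enn2real q))"
  unfolding Lnorm_def nn_integral_half_line by (simp add: mult.commute)

lemma Lnorm_r: "Lnorm (ennreal r) u h = (\<integral>\<^sup>+x. u x * (h x epowr r) \<partial>half_line) epowr (1 / r)"
  unfolding Lnorm_def nn_integral_half_line using r by (simp add: mult.commute)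

lemma wk_eq: "0 \<le> t \<Longrightarrow> 0 \<le> y \<Longrightarrow> K y t * om y = (w y * ennreal (k y t)) epowr rt_exp q"
  using rt_exp_pos by (simp add: K_eq om_def epowr_mult mult.commute)

lemma opnorm_eq:
  assumes "0 \<le> t"
  shows "opnorm p v q (\<lambda>y. w y * ennreal (k y t)) H = least_const p v (\<lambda>f. Nrm q (\<lambda>y. K y t * om y * H f y))"
  unfolding opnorm_def Lnorm_q
  by (subst weighted_Nrm[where b="\<lambda>y. w y * ennreal (k y t)"]) (simp_all add: wk_eq assms)

text \<open>Functions with the same upper bounds have the same essential supremum, and the zeros put
  on the rest of the half line satisfy every bound in \<open>[0, \<infinity>]\<close>.\<close>

lemma esssup_tail:
  fixes g :: "real \<Rightarrow> ennreal"
  assumes [measurable]: "g \<in> borel_measurable half_line" and "0 \<le> x"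
  shows "esssup (lebesgue_on {x..}) g = esssup half_line (\<lambda>y. g y * indicator {x..} y)"
proof -
  have m: "g \<in> borel_measurable (lebesgue_on {x..})"
    using assms by (intro measurable_restrict_mono[OF assms(1)]) auto
  have [measurable]: "(\<lambda>y. g y * indicator {x..} y) \<in> borel_measurable half_line"
    by measurable
  have "esssup (lebesgue_on {x..}) g \<le> c \<longleftrightarrow> esssup half_line (\<lambda>y. g y * indicator {x..} y) \<le> c" for c
  proof -
    have "(\<lambda>y. y \<in> {x..} \<longrightarrow> g y \<le> c) = (\<lambda>y. y \<in> {0..} \<longrightarrow> g y * indicator {x..} y \<le> c)"
      using \<open>0 \<le> x\<close> by (auto simp: fun_eq_iff split: split_indicator)
    moreover have "(AE y in lebesgue_on {x..}. g y \<le> c) \<longleftrightarrow> (AE y in lebesgue. y \<in> {x..} \<longrightarrow> g y \<le> c)"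
      by (rule AE_restrict_space_iff) simp
    moreover have "(AE y in half_line. g y * indicator {x..} y \<le> c) \<longleftrightarrow>
        (AE y in lebesgue. y \<in> {0..} \<longrightarrow> g y * indicator {x..} y \<le> c)"
      by (rule AE_restrict_space_iff) simp
    moreover have "(\<lambda>y. g y * indicator {x..} y) \<in> borel_measurable half_line" by measurable
    ultimately show ?thesis using m by (simp only: esssup_le_iff)
  qed
  then show ?thesis by (meson order.antisym order.refl)
qed

lemma integral_tail:
  assumes "0 \<le> x"
  shows "(\<integral>\<^sup>+y\<in>{x..}. g y \<partial>lebesgue) = (\<integral>\<^sup>+y. g y * indicator {x..} y \<partial>half_line)"
  using assms by (subst nn_integral_restrict_space) (auto intro!: nn_integral_cong split: split_indicator)

lemma tail_Nrm:
  assumes a: "\<And>y. 0 \<le> y \<Longrightarrow> a y = (b y * indicator {x..} y) epowr rt_exp q" and "0 \<le> x"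
    and [measurable]: "b \<in> borel_measurable half_line" "h \<in> borel_measurable half_line"
  shows "Nrm q (\<lambda>y. a y * h y) =
    (if q = \<infinity> then esssup (lebesgue_on {x..}) (\<lambda>y. b y * h y)
     else (\<integral>\<^sup>+y\<in>{x..}. b y * (h y epowr enn2real q) \<partial>lebesgue) epowr (1 / enn2real q))"
proof -
  have "Nrm q (\<lambda>y. a y * h y) = (if q = \<infinity> then esssup half_line (\<lambda>y. b y * indicator {x..} y * h y)
     else (\<integral>\<^sup>+y. b y * indicator {x..} y * (h y epowr enn2real q) \<partial>half_line) epowr (1 / enn2real q))"
    by (rule weighted_Nrm[OF a])
  also have "(\<lambda>y. b y * indicator {x..} y * h y) = (\<lambda>y. b y * h y * indicator {x..} y)"
    by (simp add: mult_ac)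
  also have "esssup half_line \<dots> = esssup (lebesgue_on {x..}) (\<lambda>y. b y * h y)"
    by (rule esssup_tail[symmetric]) (auto simp: \<open>0 \<le> x\<close>)
  also have "(\<integral>\<^sup>+y. b y * indicator {x..} y * (h y epowr enn2real q) \<partial>half_line) =
      (\<integral>\<^sup>+y\<in>{x..}. b y * (h y epowr enn2real q) \<partial>lebesgue)"
    unfolding integral_tail[OF \<open>0 \<le> x\<close>] by (simp add: mult_ac)
  finally show ?thesis .
qed

lemma kernel_section_measurable:
  assumes "0 \<le> x"
  shows "(\<lambda>y. ennreal (k y x)) \<in> borel_measurable half_line"
proof -
  have "(\<lambda>y. K y x epowr (1 / rt_exp q)) \<in> borel_measurable half_line" by measurable
  then show ?thesis
    using assms rt_exp_pos by (subst measurable_cong[where g="\<lambda>y. K y x epowr (1 / rt_exp q)"])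
      (auto simp: K_eq epowr_inverse)
qed

lemma Top_eq:
  assumes "0 \<le> x"
  shows "Top q k w f x = Nrm q (\<lambda>y. K y x * (om y * prim f y))"
proof -
  note [measurable] = kernel_section_measurable[OF assms]
  have "Nrm q (\<lambda>y. K y x * om y * prim f y) = Top q k w f x"
    unfolding Top_def using k_zero assms
    by (intro tail_Nrm) (auto simp: wk_eq mult.commute[of "w _"] split: split_indicator)
  then show ?thesis by (simp add: mult.assoc)
qed

lemma C_T_eq:
  "C_T p q r u v w k = least_const p v (\<lambda>f. Lnorm (ennreal r) u (\<lambda>x. Nrm q (\<lambda>y. K y x * (om y * prim f y))))"
proof -
  have "Lnorm (ennreal r) u (Top q k w f) = Lnorm (ennreal r) u (\<lambda>x. Nrm q (\<lambda>y. K y x * (om y * prim f y)))" for f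
    unfolding Lnorm_r by (intro arg_cong2[where f="(epowr)"] nn_integral_cong) (simp_all add: Top_eq)
  then show ?thesis by (simp add: C_T_def opnorm_def)
qed

lemma B0_eq:
  "B0 p q r u v w k = least_const p v (\<lambda>f. Lnorm (ennreal r) u (\<lambda>x. Nrm q (\<lambda>y. K y x * om y) * prim f x))"
proof -
  have *: "Nrm q (\<lambda>y. K y x * om y) = (if q = \<infinity> then esssup (lebesgue_on {x..}) (\<lambda>y. ennreal (k y x) * w y)
     else (\<integral>\<^sup>+y\<in>{x..}. ennreal (k y x) * w y \<partial>lebesgue) epowr (1 / enn2real q))" if "0 \<le> x" for x
  proof -
    note [measurable] = kernel_section_measurable[OF that]
    show ?thesis
      using tail_Nrm[where a="\<lambda>y. K y x * om y" and b="\<lambda>y. ennreal (k y x) * w y" and x=x and h="\<lambda>_. 1"] that k_zero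
      by (auto simp: wk_eq mult.commute[of "w _"] split: split_indicator)
  qed
  have "Lnorm (ennreal r) u (\<lambda>x. Nrm q (\<lambda>y. K y x * om y) * prim f x) =
     (if q = \<infinity> then
       \<integral>\<^sup>+x\<in>{0..}. u x * (esssup (lebesgue_on {x..}) (\<lambda>y. ennreal (k y x) * w y) epowr r)
                   * (prim f x epowr r) \<partial>lebesgue
     else
       \<integral>\<^sup>+x\<in>{0..}. u x * ((\<integral>\<^sup>+y\<in>{x..}. ennreal (k y x) * w y \<partial>lebesgue) epowr (r / enn2real q))
                   * (prim f x epowr r) \<partial>lebesgue)
    epowr (1 / r)" for f
  proof (cases "q = \<infinity>")
    case True
    then have [simp]: "(q = top) = True" by simp
    show ?thesis unfolding if_P[OF True] Lnorm_r nn_integral_half_line using r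
      by (intro arg_cong2[where f="(epowr)"] nn_integral_cong)
         (simp_all add: * epowr_mult mult.assoc)
  next
    case False
    then have [simp]: "0 < enn2real q" using q by (simp add: enn2real_positive_iff top.not_eq_extremum)
    have [simp]: "(q = top) = False" using False by simp
    show ?thesis unfolding if_not_P[OF False] Lnorm_r nn_integral_half_line using r
      by (intro arg_cong2[where f="(epowr)"] nn_integral_cong)
         (simp_all add: * epowr_mult epowr_epowr mult.assoc)
  qed
  then show ?thesis by (simp add: B0_def)
qed

text \<open>Every positive \<open>y\<close> is admissible in the infimum, even if
  \<open>x > 0\<close>, so \<open>sigma u x\<close> may fall below \<open>x\<close>. The case is met
  in \<open>sigma2_nonneg\<close>, which covers all \<open>x\<close>.\<close>

lemma sigma_zero: assumes "U x = 0" shows "sigma u x = 0"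
proof -
  have "sigma u x = Inf (ereal ` {0<..})"
    using assms by (simp add: sigma_def prim_u greaterThan_def)
  also have "\<dots> = 0"
  proof (rule order.antisym)
    show "Inf (ereal ` {0<..}) \<le> 0"
    proof (rule dense_ge)
      fix y :: ereal assume "0 < y"
      then obtain z where "0 < ereal z" "ereal z < y" using ereal_dense2 by blast
      then show "Inf (ereal ` {0<..}) \<le> y" by (intro order.trans[OF Inf_lower[of "ereal z"]]) auto
    qed
    show "0 \<le> Inf (ereal ` {0<..})" by (auto intro!: Inf_greatest)
  qed
  finally show ?thesis .
qed

lemma sigma2_nonneg: "sigma2 u x \<noteq> \<infinity> \<Longrightarrow> 0 \<le> real_of_ereal (sigma2 u x)"
  using sigma2_eq[of x] sigma_zero[of x] sigma_zero[of 0] U_nonneg[of x] U_zero[of 0]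
  by (cases "U x = 0") (auto simp: sigma2_def split: if_splits)

definition B1_op :: "(real \<Rightarrow> ennreal) \<Rightarrow> real \<Rightarrow> ennreal" where
  "B1_op f x = (if sigma2 u x = \<infinity> then 0 else
     K (real_of_ereal (sigma2 u x)) x *
     Nrm q (\<lambda>y. indicator {real_of_ereal (sigma2 u x)..} y * (om y * prim f y)))"

lemma B1_eq: "B1 p q r u v w k = least_const p v (\<lambda>f. Lnorm (ennreal r) u (B1_op f))"
proof -
  have *: "Nrm q (\<lambda>y. indicator {z..} y * (om y * prim f y)) =
    (if q = \<infinity> then esssup (lebesgue_on {z..}) (\<lambda>y. w y * prim f y)
     else (\<integral>\<^sup>+y\<in>{z..}. w y * (prim f y epowr enn2real q) \<partial>lebesgue) epowr (1 / enn2real q))"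
    if "0 \<le> z" for z f
    using tail_Nrm[where a="\<lambda>y. indicator {z..} y * om y" and b=w and x=z and h="prim f"] that rt_exp_pos
    by (auto simp: om_def mult.assoc split: split_indicator)
  have "Lnorm (ennreal r) u (B1_op f) =
    (\<integral>\<^sup>+x\<in>{0..}.
       (if sigma2 u x = \<infinity> then 0
        else
          (let z = real_of_ereal (sigma2 u x) in
             if q = \<infinity> then
               u x * (ennreal (k z x) epowr r)
                   * (esssup (lebesgue_on {z..}) (\<lambda>y. w y * prim f y) epowr r)
             else
               u x * (ennreal (k z x) epowr (r / enn2real q))
                   * ((\<integral>\<^sup>+y\<in>{z..}. w y * (prim f y epowr enn2real q) \<partial>lebesgue)
                        epowr (r / enn2real q)))) \<partial>lebesgue)
    epowr (1 / r)" for f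
  proof (cases "q = \<infinity>")
    case True
    then have [simp]: "(q = top) = True" by simp
    show ?thesis unfolding if_P[OF True] Lnorm_r nn_integral_half_line B1_op_def using r sigma2_nonneg
      by (intro arg_cong2[where f="(epowr)"] nn_integral_cong)
         (auto simp: * Let_def K_eq rt_exp_def epowr_mult mult.assoc)
  next
    case False
    then have [simp]: "0 < enn2real q" using q by (simp add: enn2real_positive_iff top.not_eq_extremum)
    have [simp]: "(q = top) = False" using False by simp
    show ?thesis unfolding if_not_P[OF False] Lnorm_r nn_integral_half_line B1_op_def using r sigma2_nonneg
      by (intro arg_cong2[where f="(epowr)"] nn_integral_cong)
         (auto simp: * Let_def K_eq rt_exp_def epowr_mult epowr_epowr mult.assoc)
  qed
  then show ?thesis by (simp add: B1_def)
qed

end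

section \<open>Absorption of the tail\<close>

lemma ennreal_absorb:
  fixes x y :: ennreal
  assumes "x \<le> y + c * x" "2 * c \<le> 1" "x < \<infinity>"
  shows "x \<le> 2 * y"
proof -
  have "x + x \<le> 2 * y + (2 * c) * x"
    using mult_left_mono[OF assms(1), of 2] by (simp add: distrib_left mult_2 mult.assoc distrib_right)
  also have "\<dots> \<le> 2 * y + 1 * x"
    by (intro add_left_mono mult_right_mono assms(2)) simp
  finally have "x + x \<le> x + 2 * y" by (simp add: add.commute)
  then show ?thesis using assms(3) by (subst (asm) ennreal_add_left_cancel_le) auto
qed

text \<open>Origin of the fifth power. The innermost terms collect three constants from a kernel
  step (\<open>phi_step\<close> has \<alpha> outside and its square inside) and one from each of two
  uses of \<open>J_add\<close>.\<close>

lemma ennreal_nested_power_le: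
  fixes a e b c M :: ennreal
  assumes "1 \<le> a"
  shows "a * (a * (e + a\<^sup>2 * (a * (b + M)))) \<le> a ^ 5 * ((e + b) + M)"
proof -
  have "e \<le> a ^ 3 * e" using mult_right_mono[OF one_le_power[OF assms], of e 3] by simp
  then have "a * (a * (e + a\<^sup>2 * (a * (b + M)))) \<le> a * (a * (a ^ 3 * e + a\<^sup>2 * (a * (b + M))))"
    by (intro mult_left_mono add_right_mono) auto
  also have "\<dots> = a ^ 5 * ((e + b) + M)"
    by (simp add: algebra_simps power2_eq_square power3_eq_cube eval_nat_numeral)
  finally show ?thesis .
qed

lemma half_line_snd [measurable]: "(\<lambda>x. snd x) \<in> borel_measurable (M \<Otimes>\<^sub>M half_line)"
  using measurable_compose[OF measurable_snd measurable_id_half_line] .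

context weights
begin

abbreviation "\<alpha> \<equiv> ennreal A"
abbreviation J :: "(real \<Rightarrow> ennreal) \<Rightarrow> ennreal" where "J \<equiv> Nrm (ennreal r)"

lemma alpha_ge_1: "1 \<le> \<alpha>"
  using A_ge_1 by (simp add: ennreal_leI flip: ennreal_1)

lemma alpha_le_mult: "x \<le> \<alpha> * x" "x \<le> \<alpha> ^ n * x"
  using mult_right_mono[OF alpha_ge_1, of x] mult_right_mono[OF one_le_power[OF alpha_ge_1], of x n] by auto

text \<open>With \<open>x = \<xi> t\<close>, \<open>a = 2 ^ n\<close> and \<open>z = \<xi> (a * t) = \<sigma>\<^sup>n x\<close>, these are the function \<open>\<Phi>\<close>,
  its local part over \<open>[x, z)\<close>, and the tail term at \<open>z\<close>.\<close>

definition phi :: "(real \<Rightarrow> ennreal) \<Rightarrow> real \<Rightarrow> ennreal" where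
  "phi g t = indicator T t * Nrm q (\<lambda>y. K y (\<xi> t) * g y)"

definition En :: "real \<Rightarrow> (real \<Rightarrow> ennreal) \<Rightarrow> real \<Rightarrow> ennreal" where
  "En a g t = phi (\<lambda>y. indicator {y. U y < a * t} y * g y) t"

definition be :: "real \<Rightarrow> (real \<Rightarrow> ennreal) \<Rightarrow> real \<Rightarrow> ennreal" where
  "be a g t = indicator T (a * t) * (K (\<xi> (a * t)) (\<xi> t) * Nrm q (\<lambda>y. indicator {\<xi> (a * t)..} y * g y))"

lemma phi_mono:
  assumes [measurable]: "g \<in> borel_measurable half_line" and "\<And>y. 0 \<le> y \<Longrightarrow> g y \<le> h y"
  shows "phi g t \<le> phi h t"
  unfolding phi_def using q assms by (intro mult_left_mono Nrm_mono) auto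

lemma be_mono:
  assumes [measurable]: "g \<in> borel_measurable half_line" and "\<And>y. 0 \<le> y \<Longrightarrow> g y \<le> h y"
  shows "be a g t \<le> be a h t"
  unfolding be_def using q assms by (intro mult_left_mono Nrm_mono) auto

lemma phi_measurable [measurable]:
  assumes [measurable]: "g \<in> borel_measurable half_line"
  shows "phi g \<in> borel_measurable borel"
proof -
  have [measurable]: "(\<lambda>t. Nrm q (\<lambda>y. K y (\<xi> t) * g y)) \<in> borel_measurable borel"
    by (rule Nrm_measurable[OF q]) measurable
  show ?thesis unfolding phi_def by measurable
qed

lemma En_measurable [measurable]:
  assumes [measurable]: "g \<in> borel_measurable half_line"
  shows "En a g \<in> borel_measurable borel"
proof -
  have [measurable]: "(\<lambda>t. Nrm q (\<lambda>y. K y (\<xi> t) * (indicator {y. U y < a * t} y * g y))) \<in> borel_measurable borel"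
    by (rule Nrm_measurable[OF q]) (simp add: indicator_def, measurable)
  show ?thesis unfolding En_def phi_def by measurable
qed

lemma be_measurable [measurable]:
  assumes [measurable]: "g \<in> borel_measurable half_line"
  shows "be a g \<in> borel_measurable borel"
proof -
  have [measurable]: "(\<lambda>t. Nrm q (\<lambda>y. indicator {\<xi> (a * t)..} y * g y)) \<in> borel_measurable borel"
    by (rule Nrm_measurable[OF q]) (simp add: indicator_def, measurable)
  show ?thesis unfolding be_def by measurable
qed

text \<open>Beyond \<open>z\<close> the Oinarov inequality splits the kernel into
  \<open>K y z\<close>, which rebuilds \<open>phi\<close> at \<open>a * t\<close>, and
  \<open>K z (\<xi> t)\<close>, which is constant in \<open>y\<close>. The outer \<alpha> is the
  price of separating the local part, the inner square that of the kernel inequality and of the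
  second separation. None of them depends on \<open>a\<close>, which is what makes absorption
  possible.\<close>

lemma phi_step:
  assumes [measurable]: "g \<in> borel_measurable half_line" and a: "1 \<le> a"
  shows "phi g t \<le> \<alpha> * (En a g t + \<alpha>\<^sup>2 * (be a g t + phi g (a * t)))"
proof (cases "t \<in> T")
  case True
  have t: "0 < t" using True by (rule T_pos)
  show ?thesis
  proof (cases "a * t \<in> T")
    \<comment> \<open>Here \<open>U\<close> never reaches \<open>a * t\<close>, so the local part is
      everything.\<close>
    case False
    then have "U y < a * t" for y using T_I[of "a * t" y] t a by fastforce
    then have "phi g t = En a g t" by (simp add: En_def)
    also have "\<dots> \<le> En a g t + \<alpha>\<^sup>2 * (be a g t + phi g (a * t))" by simp
    also have "\<dots> \<le> \<alpha> * \<dots>" by (rule alpha_le_mult)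
    finally show ?thesis .
  next
    case at: True
    let ?z = "\<xi> (a * t)"
    have tz: "\<xi> t \<le> ?z" using at t a by (intro xi_mono) auto
    let ?g1 = "\<lambda>y. K y (\<xi> t) * (indicator {y. U y < a * t} y * g y)"
    let ?h1 = "\<lambda>y. K ?z (\<xi> t) * (indicator {?z..} y * g y)"
    let ?h2 = "\<lambda>y. K y ?z * g y"
    have "K y (\<xi> t) * g y \<le> ?g1 y + \<alpha> * (?h1 y + ?h2 y)" for y
    proof (cases "U y < a * t")
      case False
      then have "?z \<le> y" using xi_le_iff[OF at] by simp
      then have "K y (\<xi> t) * g y \<le> \<alpha> * (K y ?z + K ?z (\<xi> t)) * g y"
        using tz by (intro mult_right_mono K_upper) auto
      also have "\<dots> = \<alpha> * (?h1 y + ?h2 y)"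
        using \<open>?z \<le> y\<close> by (simp add: ring_distribs mult_ac add_ac)
      finally show ?thesis by (simp add: add_increasing)
    qed simp
    then have "Nrm q (\<lambda>y. K y (\<xi> t) * g y) \<le> Nrm q (\<lambda>y. ?g1 y + \<alpha> * (?h1 y + ?h2 y))"
      using q by (intro Nrm_mono) auto
    also have "\<dots> \<le> \<alpha> * (Nrm q ?g1 + Nrm q (\<lambda>y. \<alpha> * (?h1 y + ?h2 y)))"
      by (intro Nrm_q_add) auto
    also have "Nrm q (\<lambda>y. \<alpha> * (?h1 y + ?h2 y)) = \<alpha> * Nrm q (\<lambda>y. ?h1 y + ?h2 y)"
      using q by (intro Nrm_cmult) auto
    also have "\<dots> \<le> \<alpha> * (\<alpha> * (Nrm q ?h1 + Nrm q ?h2))"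
      by (intro mult_left_mono Nrm_q_add) auto
    also have "Nrm q ?h1 = K ?z (\<xi> t) * Nrm q (\<lambda>y. indicator {?z..} y * g y)"
      using q by (intro Nrm_cmult) auto
    finally show ?thesis using True at
      by (simp add: phi_def En_def be_def power2_eq_square mult.assoc add_left_mono mult_left_mono)
  qed
qed (simp add: phi_def)

text \<open>This is \<open>phi_step\<close> with \<open>a = 2\<close>, applied to \<open>g\<close>
  cut off at the level \<open>2 * a * t\<close>: seen from \<open>2 * t\<close>, the same cut-off is
  a local part with ratio \<open>a\<close>.\<close>

lemma En_step:
  assumes [measurable]: "g \<in> borel_measurable half_line"
  shows "En (2 * a) g t \<le> \<alpha> * (En 2 g t + \<alpha>\<^sup>2 * (be 2 g t + En a g (2 * t)))"
proof -
  let ?g = "\<lambda>y. indicator {y. U y < 2 * a * t} y * g y"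
  have [measurable]: "?g \<in> borel_measurable half_line" by measurable
  have "En (2 * a) g t = phi ?g t" by (simp add: En_def)
  also have "\<dots> \<le> \<alpha> * (En 2 ?g t + \<alpha>\<^sup>2 * (be 2 ?g t + phi ?g (2 * t)))"
    by (intro phi_step) auto
  also have "phi ?g (2 * t) = En a g (2 * t)" by (simp add: En_def mult_ac)
  also have "En 2 ?g t \<le> En 2 g t"
    unfolding En_def by (intro phi_mono) (auto split: split_indicator)
  also have "be 2 ?g t \<le> be 2 g t"
    by (intro be_mono) (auto split: split_indicator)
  finally show ?thesis by (simp add: add_mono mult_left_mono)
qed

text \<open>The kernel across the long jump is split at \<open>\<xi> (2 * t)\<close>. One piece
  keeps the tail and is the jump of ratio \<open>a\<close> from \<open>2 * t\<close>; in the other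
  the tail is enlarged to begin at \<open>\<xi> (2 * t)\<close>.\<close>

lemma be_step:
  assumes [measurable]: "g \<in> borel_measurable half_line" and a: "1 \<le> a"
  shows "be (2 * a) g t \<le> \<alpha> * (be a g (2 * t) + be 2 g t)"
proof (cases "2 * a * t \<in> T")
  case True
  have t: "0 < t" using T_pos[OF True] a by (simp add: zero_less_mult_iff)
  let ?x = "\<xi> (2 * a * t)" and ?z = "\<xi> (2 * t)"
  have t2: "2 * t \<in> T" using True t a by (rule_tac T_down[of "2 * a * t"]) auto
  have 1: "?z \<le> ?x" using t a by (intro xi_mono True) auto
  have 2: "\<xi> t \<le> ?z" using t by (intro xi_mono t2) auto
  let ?n = "\<lambda>x. Nrm q (\<lambda>y. indicator {x..} y * g y)"
  have "K ?x (\<xi> t) * ?n ?x \<le> \<alpha> * (K ?x ?z + K ?z (\<xi> t)) * ?n ?x"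
    using 1 2 by (intro mult_right_mono K_upper) auto
  also have "\<dots> = \<alpha> * (K ?x ?z * ?n ?x + K ?z (\<xi> t) * ?n ?x)"
    by (simp add: ring_distribs mult_ac)
  also have "\<dots> \<le> \<alpha> * (K ?x ?z * ?n ?x + K ?z (\<xi> t) * ?n ?z)"
    using q 1 by (intro mult_left_mono add_left_mono Nrm_mono) (auto split: split_indicator)
  finally have "K ?x (\<xi> t) * ?n ?x \<le> \<alpha> * (K ?x ?z * ?n ?x + K ?z (\<xi> t) * ?n ?z)" .
  moreover have "a * (2 * t) = 2 * a * t" by simp
  ultimately show ?thesis using True t2 by (simp only: be_def) simp
qed (simp add: be_def)

text \<open>The recursion produces one application of \<sigma>, but \<open>B1\<close> contains two.
  Moving the base point back from \<xi> t to \<open>\<xi> (t / 2)\<close> by \<open>K_left\<close>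
  turns a ratio 2 into a ratio 4; the shift of \<open>t\<close> will cost a dilation factor
  only.\<close>

lemma be_2_le_4:
  assumes [measurable]: "g \<in> borel_measurable half_line"
  shows "be 2 g t \<le> \<alpha> * be 4 g ((1 / 2) * t)"
proof (cases "2 * t \<in> T")
  case True
  have t: "0 < t" using T_pos[OF True] by simp
  then have "t \<in> T" using T_down[OF True, of t] by simp
  then have "\<xi> ((1 / 2) * t) \<le> \<xi> t" using t by (intro xi_mono) auto
  then have "K (\<xi> (2 * t)) (\<xi> t) \<le> \<alpha> * K (\<xi> (2 * t)) (\<xi> ((1 / 2) * t))"
    by (intro K_left) auto
  then show ?thesis using True mult_right_mono
    by (simp add: be_def mult.assoc[symmetric] mult_right_mono)
qed (simp add: be_def)

lemma J_mono:
  assumes "g \<in> borel_measurable borel" "\<And>x. 0 \<le> x \<Longrightarrow> g x \<le> h x"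
  shows "J g \<le> J h"
  using assms r by (intro Nrm_mono borel_measurable_half_line) auto

lemma J_add:
  assumes "g \<in> borel_measurable borel" "h \<in> borel_measurable borel"
  shows "J (\<lambda>x. g x + h x) \<le> \<alpha> * (J g + J h)"
  using assms by (intro Nrm_r_add borel_measurable_half_line) auto

lemma J_cmult:
  assumes "g \<in> borel_measurable borel"
  shows "J (\<lambda>x. c * g x) = c * J g"
  using assms r by (intro Nrm_cmult borel_measurable_half_line) auto

lemma J_scale_le:
  assumes "g \<in> borel_measurable borel" "1 \<le> a"
  shows "J (\<lambda>t. g (a * t)) \<le> J g"
proof -
  have "a powr (- 1 / r) \<le> a powr 0" using assms r by (intro powr_mono) auto
  also have "\<dots> = 1" using assms by simp
  finally have "a powr (- 1 / r) \<le> 1" .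
  then have "ennreal (a powr (- 1 / r)) \<le> 1" by (simp add: ennreal_le_1)
  then show ?thesis using assms r mult_right_mono[of "ennreal (a powr (- 1 / r))" 1 "J g"]
    by (subst Nrm_scale) auto
qed

lemma J_be:
  assumes [measurable]: "g \<in> borel_measurable half_line"
  shows "J (be (2 * 2 ^ n) g) \<le> (2 * \<alpha> ^ 5) ^ n * J (be 2 g)"
proof (induction n)
  case (Suc n)
  have "J (be (2 * 2 ^ Suc n) g) \<le> J (\<lambda>t. \<alpha> * (be (2 * 2 ^ n) g (2 * t) + be 2 g t))"
    using be_step[of g "2 * 2 ^ n"] by (intro J_mono) (auto simp: two_realpow_ge_one mult_ge1_I)
  also have "\<dots> = \<alpha> * J (\<lambda>t. be (2 * 2 ^ n) g (2 * t) + be 2 g t)"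
    by (intro J_cmult) measurable
  also have "\<dots> \<le> \<alpha> * (\<alpha> * (J (\<lambda>t. be (2 * 2 ^ n) g (2 * t)) + J (be 2 g)))"
    by (intro mult_left_mono J_add) auto
  also have "\<dots> \<le> \<alpha> * (\<alpha> * ((2 * \<alpha> ^ 5) ^ n * J (be 2 g) + J (be 2 g)))"
    using J_scale_le[of "be (2 * 2 ^ n) g" 2] Suc
    by (intro mult_left_mono add_right_mono) (auto intro: order.trans)
  \<comment> \<open>The cube is padding that brings the growth per doubling to the rate of
    \<open>J_En\<close>.\<close>
  also have "\<dots> \<le> \<alpha> * (\<alpha> * (\<alpha> ^ 3 * ((2 * \<alpha> ^ 5) ^ n * J (be 2 g) + (2 * \<alpha> ^ 5) ^ n * J (be 2 g))))"
  proof -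
    have "1 \<le> 2 * \<alpha> ^ 5" using one_le_power[OF alpha_ge_1, of 5] by (simp add: mult_2 add_increasing)
    then have "J (be 2 g) \<le> (2 * \<alpha> ^ 5) ^ n * J (be 2 g)"
      using mult_right_mono[OF one_le_power, of "2 * \<alpha> ^ 5" "J (be 2 g)" n] by simp
    then show ?thesis by (intro mult_left_mono order.trans[OF _ alpha_le_mult(2)] add_left_mono) auto
  qed
  also have "\<dots> = (2 * \<alpha> ^ 5) ^ Suc n * J (be 2 g)"
    by (simp add: mult.assoc flip: mult_2) (simp add: mult_ac eval_nat_numeral)
  finally show ?case .
qed simp

text \<open>A local part of ratio \<open>2 * 2 ^ n\<close> is assembled from local parts of ratio 2
  at dilated points, and dilation by 2 does not increase \<open>J\<close>. The geometric loss is
  acceptable since \<open>n\<close> will be fixed.\<close>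

lemma J_En:
  assumes [measurable]: "g \<in> borel_measurable half_line"
  shows "J (En (2 * 2 ^ n) g) \<le> (2 * \<alpha> ^ 5) ^ n * (J (En 2 g) + J (be 2 g))"
proof (induction n)
  case (Suc n)
  let ?X = "J (En 2 g) + J (be 2 g)"
  let ?M = "(2 * \<alpha> ^ 5) ^ n * ?X"
  have 1: "J (\<lambda>t. be 2 g t + En (2 * 2 ^ n) g (2 * t)) \<le> \<alpha> * (J (be 2 g) + ?M)"
  proof -
    have "J (\<lambda>t. be 2 g t + En (2 * 2 ^ n) g (2 * t)) \<le> \<alpha> * (J (be 2 g) + J (\<lambda>t. En (2 * 2 ^ n) g (2 * t)))"
      by (intro J_add) auto
    also have "\<dots> \<le> \<alpha> * (J (be 2 g) + ?M)"
      using J_scale_le[of "En (2 * 2 ^ n) g" 2] Suc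
      by (intro mult_left_mono add_left_mono) (auto intro: order.trans)
    finally show ?thesis .
  qed
  have "J (En (2 * 2 ^ Suc n) g) \<le> J (\<lambda>t. \<alpha> * (En 2 g t + \<alpha>\<^sup>2 * (be 2 g t + En (2 * 2 ^ n) g (2 * t))))"
    using En_step[of g "2 * 2 ^ n"] by (intro J_mono) auto
  also have "\<dots> = \<alpha> * J (\<lambda>t. En 2 g t + \<alpha>\<^sup>2 * (be 2 g t + En (2 * 2 ^ n) g (2 * t)))"
    by (intro J_cmult) measurable
  also have "\<dots> \<le> \<alpha> * (\<alpha> * (J (En 2 g) + J (\<lambda>t. \<alpha>\<^sup>2 * (be 2 g t + En (2 * 2 ^ n) g (2 * t)))))"
    by (intro mult_left_mono J_add) auto
  also have "\<dots> = \<alpha> * (\<alpha> * (J (En 2 g) + \<alpha>\<^sup>2 * J (\<lambda>t. be 2 g t + En (2 * 2 ^ n) g (2 * t))))"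
    by (subst J_cmult) auto
  also have "\<dots> \<le> \<alpha> * (\<alpha> * (J (En 2 g) + \<alpha>\<^sup>2 * (\<alpha> * (J (be 2 g) + ?M))))"
    by (intro mult_left_mono add_left_mono 1) auto
  also have "\<dots> \<le> \<alpha> ^ 5 * (?X + ?M)"
    by (rule ennreal_nested_power_le[OF alpha_ge_1])
  also have "\<dots> \<le> \<alpha> ^ 5 * (?M + ?M)"
  proof -
    have "1 \<le> 2 * \<alpha> ^ 5" using one_le_power[OF alpha_ge_1, of 5] by (simp add: mult_2 add_increasing)
    then have "?X \<le> ?M"
      using mult_right_mono[OF one_le_power, of "2 * \<alpha> ^ 5" ?X n] by simp
    then show ?thesis by (intro mult_left_mono add_right_mono) auto
  qed
  also have "\<dots> = (2 * \<alpha> ^ 5) ^ Suc n * ?X"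
    by (simp add: mult.assoc flip: mult_2) (simp add: mult_ac)
  finally show ?case .
qed simp

text \<open>So many doublings that the dilation factor \<open>(2 * 2 ^ n) powr (-1/r)\<close> brings
  the coefficient \<alpha>^5 of the remainder below 1/2. Only \<open>A\<close> and \<open>r\<close>
  enter, never the weights.\<close>

definition nsteps :: nat where "nsteps = (SOME n. (2 * A ^ 5) powr r \<le> 2 ^ n)"

lemma nsteps: "2 * (\<alpha> ^ 5 * ennreal ((2 * 2 ^ nsteps) powr (- 1 / r))) \<le> 1"
proof -
  have "\<exists>n. (2 * A ^ 5) powr r \<le> 2 ^ n"
    using real_arch_pow[of 2 "(2 * A ^ 5) powr r"] by (auto intro: less_imp_le)
  then have "(2 * A ^ 5) powr r \<le> 2 ^ nsteps"
    unfolding nsteps_def by (rule someI_ex)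
  then have *: "(2 * A ^ 5) powr r \<le> 2 * 2 ^ nsteps"
    by (rule order.trans) simp
  have "2 * A ^ 5 = ((2 * A ^ 5) powr r) powr (1 / r)" using r A_ge_1 by (simp add: powr_powr)
  also have "\<dots> \<le> (2 * 2 ^ nsteps) powr (1 / r)" using * r A_ge_1 by (intro powr_mono2) auto
  finally have "2 * A ^ 5 * (2 * 2 ^ nsteps) powr (- 1 / r) \<le> 1"
    by (simp add: powr_minus_divide field_simps)
  then have "ennreal (2 * A ^ 5 * (2 * 2 ^ nsteps) powr (- 1 / r)) \<le> 1"
    by (simp add: ennreal_le_1)
  then show ?thesis using A_ge_1 by (simp add: ennreal_power[symmetric] ennreal_mult mult.assoc)
qed

text \<open>A factor 2 from the absorption, another from adding the bounds of \<open>J_En\<close>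
  and \<open>J_be\<close>, the fifth power from the kernel step of large ratio, and the last factor
  from \<open>nsteps\<close> doublings.\<close>

definition Rcst :: real where "Rcst = 4 * A ^ 5 * (2 * A ^ 5) ^ nsteps"

lemma J_phi_finite_case:
  assumes [measurable]: "g \<in> borel_measurable half_line" and fin: "J (phi g) < \<infinity>"
  shows "J (phi g) \<le> ennreal Rcst * (J (En 2 g) + J (be 2 g))"
proof -
  let ?a = "2 * 2 ^ nsteps :: real" and ?X = "J (En 2 g) + J (be 2 g)"
  have a: "1 \<le> ?a" using one_le_power[of "2::real" nsteps] by linarith
  have "J (phi g) \<le> J (\<lambda>t. \<alpha> * (En ?a g t + \<alpha>\<^sup>2 * (be ?a g t + phi g (?a * t))))"
    using a by (intro J_mono phi_step) auto
  also have "\<dots> = \<alpha> * J (\<lambda>t. En ?a g t + \<alpha>\<^sup>2 * (be ?a g t + phi g (?a * t)))"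
    by (intro J_cmult) measurable
  also have "\<dots> \<le> \<alpha> * (\<alpha> * (J (En ?a g) + J (\<lambda>t. \<alpha>\<^sup>2 * (be ?a g t + phi g (?a * t)))))"
    by (intro mult_left_mono J_add) auto
  also have "\<dots> = \<alpha> * (\<alpha> * (J (En ?a g) + \<alpha>\<^sup>2 * J (\<lambda>t. be ?a g t + phi g (?a * t))))"
    by (subst J_cmult) auto
  also have "\<dots> \<le> \<alpha> * (\<alpha> * (J (En ?a g) + \<alpha>\<^sup>2 * (\<alpha> * (J (be ?a g) + J (\<lambda>t. phi g (?a * t))))))"
    by (intro mult_left_mono add_left_mono J_add) auto
  also have "\<dots> \<le> \<alpha> ^ 5 * ((J (En ?a g) + J (be ?a g)) + J (\<lambda>t. phi g (?a * t)))"
    by (rule ennreal_nested_power_le[OF alpha_ge_1])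
  also have "J (\<lambda>t. phi g (?a * t)) = ennreal (?a powr (- 1 / r)) * J (phi g)"
    using r a by (intro Nrm_scale) auto
  finally have "J (phi g) \<le> \<alpha> ^ 5 * (J (En ?a g) + J (be ?a g)) + \<alpha> ^ 5 * ennreal (?a powr (- 1 / r)) * J (phi g)"
    by (simp add: distrib_left mult.assoc)
  from ennreal_absorb[OF this nsteps fin]
  have "J (phi g) \<le> 2 * (\<alpha> ^ 5 * (J (En ?a g) + J (be ?a g)))" .
  also have "\<dots> \<le> 2 * (\<alpha> ^ 5 * ((2 * \<alpha> ^ 5) ^ nsteps * ?X + (2 * \<alpha> ^ 5) ^ nsteps * ?X))"
    by (intro mult_left_mono add_mono J_En order.trans[OF J_be]) auto
  also have "\<dots> = ennreal Rcst * ?X"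
  proof -
    have "ennreal Rcst = 4 * \<alpha> ^ 5 * (2 * \<alpha> ^ 5) ^ nsteps"
      using A_ge_1 by (simp add: Rcst_def ennreal_mult ennreal_power[symmetric])
    moreover have "2 * (a * (x + x)) = 4 * a * (x :: ennreal)" for a x
      by (simp add: mult_ac flip: mult_2)
    ultimately show ?thesis by (simp add: mult.assoc)
  qed
  finally show ?thesis .
qed

section \<open>Truncation and monotone convergence\<close>

definition trunc :: "(real \<Rightarrow> ennreal) \<Rightarrow> nat \<Rightarrow> real \<Rightarrow> ennreal" where
  "trunc g n y = min (g y) (of_nat n) * indicator {..real n} y"

lemma trunc_measurable [measurable]:
  assumes [measurable]: "g \<in> borel_measurable half_line"
  shows "trunc g n \<in> borel_measurable half_line"
  unfolding trunc_def by measurable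

lemma trunc_le: "trunc g n y \<le> g y"
  by (auto simp: trunc_def split: split_indicator)

lemma trunc_Suc: "trunc g n y \<le> trunc g (Suc n) y"
  unfolding trunc_def by (intro mult_mono min.mono) (auto split: split_indicator)

lemma SUP_trunc: "(SUP n. trunc g n y) = g y"
proof (rule order.antisym)
  show "g y \<le> (SUP n. trunc g n y)"
  proof (rule dense_le)
    fix z assume z: "z < g y"
    then have "z < top" using less_top_ennreal order.strict_trans2 top_greatest by blast
    then obtain m where m: "z < of_nat m" using ennreal_Ex_less_of_nat by auto
    obtain n where n: "y \<le> real n" using real_arch_simple by blast
    have "z \<le> trunc g (max m n) y"
      using z m n by (auto simp: trunc_def split: split_indicator intro: less_imp_le
          order.trans[OF less_imp_le[OF m]] of_nat_mono)
    then show "z \<le> (SUP n. trunc g n y)" by (rule SUP_upper2[OF UNIV_I])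
  qed
qed (intro SUP_least trunc_le)

text \<open>On \<open>[0, n]\<close> the two almost monotonicities bound the kernel by a multiple of
  the finite number \<open>K (real n) 0\<close>. For \<open>t\<close> beyond
  \<open>U (real n)\<close> the truncated function lives to the left of \<xi> t, where the kernel
  vanishes.\<close>

lemma J_phi_trunc_finite:
  assumes [measurable]: "g \<in> borel_measurable half_line"
  shows "J (phi (trunc g n)) < \<infinity>"
proof -
  let ?I = "indicator {0..real n} :: real \<Rightarrow> ennreal"
  let ?c = "\<alpha> * (\<alpha> * K (real n) 0) * of_nat n"
  have [measurable]: "?I \<in> borel_measurable half_line" by (intro borel_measurable_half_line) simp
  have 1: "K y (\<xi> t) * trunc g n y \<le> ?c * ?I y" if "0 \<le> y" for t y
  proof (cases "y \<le> real n")
    case True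
    have "K y (\<xi> t) \<le> \<alpha> * K (real n) (\<xi> t)" by (rule K_right[OF True])
    also have "\<dots> \<le> \<alpha> * (\<alpha> * K (real n) 0)" by (intro mult_left_mono K_left) auto
    finally show ?thesis using True that by (auto simp: trunc_def intro!: mult_mono)
  qed (simp add: trunc_def)
  have "phi (trunc g n) t \<le> ?c * Nrm q ?I * indicator {0..U (real n)} t" if "0 \<le> t" for t
  proof (cases "t \<in> T \<and> t \<le> U (real n)")
    case True
    have "Nrm q (\<lambda>y. K y (\<xi> t) * trunc g n y) \<le> Nrm q (\<lambda>y. ?c * ?I y)"
      using 1 q by (intro Nrm_mono) auto
    also have "\<dots> = ?c * Nrm q ?I" by (intro Nrm_cmult q) auto
    finally show ?thesis using True that by (simp add: phi_def)
  next
    case False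
    show ?thesis
    proof (cases "t \<in> T")
      case True
      then have *: "real n < \<xi> t" using False xi_le_iff[of t "real n"] by (simp add: not_le[symmetric])
      have "K y (\<xi> t) * trunc g n y = 0" for y
        using * K_zero[of y "\<xi> t"] by (cases "y \<le> real n") (auto simp: trunc_def)
      then have "Nrm q (\<lambda>y. K y (\<xi> t) * trunc g n y) = Nrm q (\<lambda>y. 0)" by presburger
      then show ?thesis using q by (simp add: phi_def)
    qed (simp add: phi_def)
  qed
  then have "J (phi (trunc g n)) \<le> J (\<lambda>t. ?c * Nrm q ?I * indicator {0..U (real n)} t)"
    by (intro J_mono) auto
  also have "\<dots> = ?c * Nrm q ?I * J (indicator {0..U (real n)})"
    by (intro J_cmult) auto
  also have "\<dots> < \<infinity>"
    using K_finite[of "real n" 0] Nrm_indicator_finite[OF q, of "real n"] r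
      Nrm_indicator_finite[of "ennreal r" "U (real n)"]
    by (auto intro!: ennreal_mult_less_top[THEN iffD2] simp: ennreal_of_nat_eq_real_of_nat)
  finally show ?thesis .
qed

text \<open>The constant of the finite case does not see the truncation, so monotone convergence in
  the inner and in the outer norm removes it.\<close>

lemma J_phi:
  assumes [measurable]: "g \<in> borel_measurable half_line"
  shows "J (phi g) \<le> ennreal Rcst * (J (En 2 g) + J (be 2 g))"
proof -
  have "phi g t = (SUP n. phi (trunc g n) t)" for t
  proof -
    have "Nrm q (\<lambda>y. K y (\<xi> t) * g y) = Nrm q (\<lambda>y. SUP n. K y (\<xi> t) * trunc g n y)"
      by (simp add: SUP_trunc flip: SUP_mult_left_ennreal)
    also have "\<dots> = (SUP n. Nrm q (\<lambda>y. K y (\<xi> t) * trunc g n y))"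
      by (intro Nrm_SUP q mult_left_mono trunc_Suc) auto
    finally show ?thesis by (simp add: phi_def SUP_mult_left_ennreal)
  qed
  then have "J (phi g) = J (\<lambda>t. SUP n. phi (trunc g n) t)" by presburger
  also have "\<dots> = (SUP n. J (phi (trunc g n)))"
    using r by (intro Nrm_SUP) (auto intro: borel_measurable_half_line phi_mono trunc_Suc)
  also have "\<dots> \<le> ennreal Rcst * (J (En 2 g) + J (be 2 g))"
  proof (rule SUP_least)
    fix n
    have "J (phi (trunc g n)) \<le> ennreal Rcst * (J (En 2 (trunc g n)) + J (be 2 (trunc g n)))"
      by (intro J_phi_finite_case J_phi_trunc_finite) auto
    also have "J (En 2 (trunc g n)) \<le> J (En 2 g)"
      unfolding En_def
      by (intro J_mono En_measurable[unfolded En_def] phi_mono mult_left_mono trunc_le) auto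
    also have "J (be 2 (trunc g n)) \<le> J (be 2 g)"
      by (intro J_mono be_mono trunc_le) auto
    finally show "J (phi (trunc g n)) \<le> ennreal Rcst * (J (En 2 g) + J (be 2 g))"
      by (simp add: add_mono mult_left_mono)
  qed
  finally show ?thesis .
qed

end

section \<open>The local part\<close>

lemma indicator_Collect: "indicator (Collect P) z = (if P z then 1 else 0)"
  by (simp add: indicator_def)

text \<open>According to which of \<open>d\<close> and \<open>c epowr (P - 1)\<close> is larger, a
  single summand already dominates the product. The sharp weights \<open>1/P\<close> and
  \<open>1/Q\<close> are given up.\<close>

lemma ennreal_young_crude:
  fixes c d :: ennreal
  assumes "1 < P" "1 < Q" "1 / P + 1 / Q = 1"
  shows "c * d \<le> c epowr P + d epowr Q"
proof (cases "d \<le> c epowr (P - 1)")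
  case True
  then have "c * d \<le> (c epowr 1) * (c epowr (P - 1))" by (simp add: mult_left_mono)
  also have "\<dots> = c epowr P" using assms epowr_add[of 1 "P - 1" c] by simp
  finally show ?thesis by (simp add: add_increasing2)
next
  case False
  have Q: "1 / (P - 1) = Q - 1" using assms by (simp add: field_simps)
  have "c epowr (P - 1) \<le> d" using False by simp
  then have "c \<le> d epowr (1 / (P - 1))" using assms by (intro iffD1[OF epowr_le_iff]) auto
  then have "c \<le> d epowr (Q - 1)" by (simp only: Q)
  then have "c * d \<le> (d epowr (Q - 1)) * (d epowr 1)" by (simp add: mult_right_mono)
  also have "\<dots> = d epowr Q" using assms epowr_add[of "Q - 1" 1 d] by simp
  finally show ?thesis by (simp add: add_increasing)
qed

text \<open>Normalise both functions and apply the crude Young inequality; each factor contributes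
  1, hence the 2. Normalisation requires norms that are neither 0 nor infinite. If one norm is 0 the
  product vanishes almost everywhere, in accordance with \<open>0 * \<infinity> = 0\<close>.\<close>

lemma nn_integral_Holder_crude:
  assumes [measurable]: "a \<in> borel_measurable M" "b \<in> borel_measurable M"
    and PQ: "1 < P" "1 < Q" "1 / P + 1 / Q = 1"
  shows "(\<integral>\<^sup>+x. a x * b x \<partial>M) \<le>
    2 * (((\<integral>\<^sup>+x. a x epowr P \<partial>M) epowr (1 / P)) * ((\<integral>\<^sup>+x. b x epowr Q \<partial>M) epowr (1 / Q)))"
proof -
  define X where "X = (\<integral>\<^sup>+x. a x epowr P \<partial>M)"
  define Y where "Y = (\<integral>\<^sup>+x. b x epowr Q \<partial>M)"
  have zero: "(\<integral>\<^sup>+x. a x * b x \<partial>M) = 0" if "X = 0 \<or> Y = 0"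
  proof -
    from that have "(AE x in M. a x = 0) \<or> (AE x in M. b x = 0)"
      unfolding X_def Y_def by (auto simp: nn_integral_0_iff_AE epowr_eq_0_iff)
    then have "AE x in M. a x * b x = 0" by (auto elim: eventually_mono)
    then show ?thesis by (simp add: nn_integral_0_iff_AE)
  qed
  show ?thesis
  proof (cases "X = 0 \<or> Y = 0 \<or> X = \<infinity> \<or> Y = \<infinity>")
    case True
    show ?thesis
    proof (cases "X = 0 \<or> Y = 0")
      case False
      then have "(X epowr (1 / P)) * (Y epowr (1 / Q)) = \<infinity>"
        using True by (auto simp: ennreal_mult_eq_top_iff epowr_eq_0_iff)
      then show ?thesis by (simp add: X_def Y_def ennreal_mult_top)
    qed (simp add: zero)
  next
    case False
    define x where "x = X epowr (1 / P)"
    define y where "y = Y epowr (1 / Q)"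
    have xy: "x \<noteq> 0" "y \<noteq> 0" "x < top" "y < top"
      using False by (auto simp: x_def y_def epowr_eq_0_iff epowr_less_top_iff less_top)
    have dist: "(z / c) epowr P' = z epowr P' / (c epowr P')" if "c \<noteq> 0" "c < top" "0 < P'" for z c :: ennreal and P'
    proof -
      have "((z / c) * c) epowr P' = z epowr P'"
        using that by (simp add: ennreal_divide_times)
      then have "((z / c) epowr P') * (c epowr P') = z epowr P'" using that by (simp add: epowr_mult)
      then have "((z / c) epowr P') * (c epowr P') / (c epowr P') = z epowr P' / (c epowr P')" by simp
      then show ?thesis using that
        by (subst (asm) ennreal_mult_divide_eq) (auto simp: epowr_eq_0_iff epowr_less_top_iff less_top)
    qed
    have "(\<integral>\<^sup>+z. a z * b z \<partial>M) \<le> (\<integral>\<^sup>+z. x * y * (a z epowr P / X + b z epowr Q / Y) \<partial>M)"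
    proof (intro nn_integral_mono)
      fix z
      have "a z * b z = x * y * ((a z / x) * (b z / y))"
      proof -
        have "x * y * ((a z / x) * (b z / y)) = (x * (a z / x)) * (y * (b z / y))" by (simp add: mult_ac)
        also have "\<dots> = a z * b z"
          using xy by (simp add: ennreal_times_divide ennreal_mult_divide_eq mult.commute[of x] mult.commute[of y])
        finally show ?thesis by simp
      qed
      also have "\<dots> \<le> x * y * ((a z / x) epowr P + (b z / y) epowr Q)"
        using PQ by (intro mult_left_mono ennreal_young_crude) auto
      also have "\<dots> = x * y * (a z epowr P / X + b z epowr Q / Y)"
        using xy PQ by (simp add: dist) (simp add: x_def y_def epowr_inverse')
      finally show "a z * b z \<le> x * y * (a z epowr P / X + b z epowr Q / Y)" .
    qed
    also have "\<dots> = x * y * (X / X + Y / Y)"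
      by (simp add: nn_integral_cmult nn_integral_add nn_integral_divide X_def Y_def)
    also have "\<dots> = 2 * (x * y)"
      using False by (simp add: less_top ennreal_divide_self mult.commute)
    finally show ?thesis by (simp add: x_def y_def X_def Y_def)
  qed
qed

section \<open>The local operator and its dyadic window\<close>

context weights
begin

text \<open>What is left of the local part over \<open>[x, \<sigma> x)\<close> once
  \<open>prim f x\<close> has been split off from \<open>prim f y\<close>.\<close>

definition Eloc :: "(real \<Rightarrow> ennreal) \<Rightarrow> real \<Rightarrow> ennreal" where
  "Eloc f x = Nrm q (\<lambda>y. indicator {y. U y < 2 * U x} y * (K y x * om y * prim (\<lambda>z. f z * indicator {x..} z) y))"

definition Gam :: "(real \<Rightarrow> ennreal) \<Rightarrow> real \<Rightarrow> ennreal" where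
  "Gam f x = (\<integral>\<^sup>+y. (f y epowr p) * v y * indicator {y. x \<le> y \<and> U y < 2 * U x} y \<partial>half_line)"

lemma prim_tail_measurable:
  assumes "f \<in> Mplus"
  shows "(\<lambda>(x, y). prim (\<lambda>z. f z * indicator {x..} z) y) \<in> borel_measurable (borel \<Otimes>\<^sub>M half_line)"
proof -
  have [measurable]: "f \<in> borel_measurable half_line" using assms by (simp add: Mplus_def)
  have [measurable]: "(\<lambda>s. snd (fst s)) \<in> borel_measurable ((borel \<Otimes>\<^sub>M half_line) \<Otimes>\<^sub>M half_line)"
    using measurable_compose[OF measurable_fst half_line_snd] .
  have "(\<lambda>s. \<integral>\<^sup>+z. f z * (if fst s \<le> z then 1 else 0) * (if z \<le> snd s then 1 else 0) \<partial>half_line)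
      \<in> borel_measurable (borel \<Otimes>\<^sub>M half_line)"
    by measurable
  also have "(\<lambda>s. \<integral>\<^sup>+z. f z * (if fst s \<le> z then 1 else 0) * (if z \<le> snd s then 1 else 0) \<partial>half_line) =
     (\<lambda>(x, y). prim (\<lambda>z. f z * indicator {x..} z) y)"
    by (auto simp: prim_eq fun_eq_iff intro!: nn_integral_cong split: split_indicator)
  finally show ?thesis .
qed

lemma Eloc_measurable:
  assumes "f \<in> Mplus"
  shows "Eloc f \<in> borel_measurable borel"
proof -
  have [measurable]: "(\<lambda>s. U (snd s)) \<in> borel_measurable (borel \<Otimes>\<^sub>M half_line)"
    "(\<lambda>s. U (fst s)) \<in> borel_measurable (borel \<Otimes>\<^sub>M half_line)"
    "(\<lambda>s. om (snd s)) \<in> borel_measurable (borel \<Otimes>\<^sub>M half_line)"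
    using measurable_compose[OF half_line_snd U_measurable] measurable_compose[OF measurable_fst U_measurable]
      measurable_compose[OF measurable_snd om_measurable] by auto
  have [measurable]: "(\<lambda>s. prim (\<lambda>z. f z * indicator {fst s..} z) (snd s)) \<in> borel_measurable (borel \<Otimes>\<^sub>M half_line)"
    using prim_tail_measurable[OF assms] by (simp add: case_prod_beta')
  show ?thesis unfolding Eloc_def[abs_def]
    by (rule Nrm_measurable[OF q]) (simp add: indicator_Collect case_prod_beta')
qed

lemma Gam_measurable:
  assumes "f \<in> Mplus"
  shows "Gam f \<in> borel_measurable borel"
proof -
  have [measurable]: "f \<in> borel_measurable half_line" using assms by (simp add: Mplus_def)
  show ?thesis unfolding Gam_def[abs_def] indicator_def by measurable
qed

lemma fnorm_eq: "fnorm f = (\<integral>\<^sup>+y. (f y epowr p) * v y \<partial>half_line) epowr (1 / p)"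
  unfolding Lnorm_def nn_integral_half_line using p by simp

lemma Gam_le: assumes "f \<in> Mplus" shows "Gam f x \<le> fnorm f epowr p"
proof -
  have "Gam f x \<le> (\<integral>\<^sup>+y. (f y epowr p) * v y \<partial>half_line)"
    unfolding Gam_def by (intro nn_integral_mono) (auto split: split_indicator)
  then show ?thesis using p by (simp add: fnorm_eq epowr_inverse')
qed

lemma T_half_line [measurable]: "T \<in> sets half_line"
  using measurable_sets[OF measurable_id_half_line T_sets]
  by (simp add: Int_absorb2 subset_iff T_pos less_imp_le)

text \<open>After Tonelli a fixed \<open>y\<close> meets only those \<open>t\<close> with
  \<open>U y / 2 < t \<le> U y\<close>. There \<open>1 / t\<close> is at most \<open>2 / U y\<close>
  and the interval has length \<open>U y / 2\<close>, so the mass of \<open>dt/t\<close> is at most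
  1. For \<open>U y = 0\<close> the interval is empty.\<close>

lemma Gam_integral:
  assumes "f \<in> Mplus"
  shows "(\<integral>\<^sup>+t. indicator T t * (ennreal (1 / t) * Gam f (\<xi> t)) \<partial>half_line) \<le> fnorm f epowr p"
proof -
  interpret pair_sigma_finite half_line half_line ..
  have [measurable]: "f \<in> borel_measurable half_line" using assms by (simp add: Mplus_def)
  let ?F = "\<lambda>y. (f y epowr p) * v y"
  have [measurable]: "indicator T \<in> borel_measurable half_line" "\<xi> \<in> borel_measurable half_line"
    by (auto intro!: borel_measurable_half_line)
  let ?k = "\<lambda>t y. if t \<in> T \<and> t \<le> U y \<and> U y < 2 * t then ennreal (1 / t) else 0 :: ennreal"
  have "(\<integral>\<^sup>+t. indicator T t * (ennreal (1 / t) * Gam f (\<xi> t)) \<partial>half_line) =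
      (\<integral>\<^sup>+t. (\<integral>\<^sup>+y. ?k t y * ?F y \<partial>half_line) \<partial>half_line)"
  proof (intro nn_integral_cong)
    fix t
    show "indicator T t * (ennreal (1 / t) * Gam f (\<xi> t)) = (\<integral>\<^sup>+y. ?k t y * ?F y \<partial>half_line)"
    proof (cases "t \<in> T")
      case True
      have "ennreal (1 / t) * Gam f (\<xi> t) =
          (\<integral>\<^sup>+y. ennreal (1 / t) * (?F y * indicator {y. \<xi> t \<le> y \<and> U y < 2 * U (\<xi> t)} y) \<partial>half_line)"
        unfolding Gam_def by (subst nn_integral_cmult) auto
      also have "\<dots> = (\<integral>\<^sup>+y. ?k t y * ?F y \<partial>half_line)"
        using True by (intro nn_integral_cong) (auto simp: xi_le_iff U_xi split: split_indicator)
      finally show ?thesis using True by simp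
    qed simp
  qed
  also have "\<dots> = (\<integral>\<^sup>+y. (\<integral>\<^sup>+t. ?k t y * ?F y \<partial>half_line) \<partial>half_line)"
    by (rule Fubini'[symmetric]) measurable
  also have "\<dots> \<le> (\<integral>\<^sup>+y. ?F y \<partial>half_line)"
  proof (intro nn_integral_mono)
    fix y
    have "(\<integral>\<^sup>+t. ?k t y \<partial>half_line) \<le> (\<integral>\<^sup>+t. ennreal (2 / U y) * indicator {U y / 2<..U y} t \<partial>half_line)"
    proof (intro nn_integral_mono)
      fix t
      show "?k t y \<le> ennreal (2 / U y) * indicator {U y / 2<..U y} t"
      proof (cases "t \<in> T \<and> t \<le> U y \<and> U y < 2 * t")
        case True
        then have "0 < t" "0 < U y" using T_pos by fastforce+
        then have "1 / t \<le> 2 / U y" using True by (simp add: field_simps)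
        then show ?thesis using True by (simp add: ennreal_leI)
      qed auto
    qed
    also have "\<dots> = ennreal (2 / U y) * emeasure half_line {U y / 2<..U y}"
      using U_nonneg[of y] by (intro nn_integral_cmult_indicator) (auto simp: sets_restrict_space_iff)
    also have "emeasure half_line {U y / 2<..U y} = ennreal (U y / 2)"
      using U_nonneg[of y] by (subst emeasure_restrict_space) auto
    also have "ennreal (2 / U y) * ennreal (U y / 2) \<le> 1"
      using U_nonneg[of y] by (simp add: ennreal_mult[symmetric])
    finally have "(\<integral>\<^sup>+t. ?k t y \<partial>half_line) * ?F y \<le> 1 * ?F y"
      by (rule mult_right_mono) simp
    then show "(\<integral>\<^sup>+t. ?k t y * ?F y \<partial>half_line) \<le> ?F y"
      by (subst nn_integral_multc) auto
  qed
  also have "\<dots> = fnorm f epowr p" using p by (simp add: fnorm_eq epowr_inverse')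
  finally show ?thesis .
qed

lemma Lnorm_r_mono:
  assumes "\<And>x. 0 \<le> x \<Longrightarrow> g x \<le> h x"
  shows "Lnorm (ennreal r) u g \<le> Lnorm (ennreal r) u h"
  unfolding Lnorm_r using r assms
  by (intro epowr_mono nn_integral_mono mult_left_mono) auto

abbreviation gf :: "(real \<Rightarrow> ennreal) \<Rightarrow> real \<Rightarrow> ennreal" where "gf f y \<equiv> om y * prim f y"

lemma T_norm_eq:
  "Lnorm (ennreal r) u (\<lambda>x. Nrm q (\<lambda>y. K y x * gf f y)) = J (phi (gf f))"
proof -
  have [measurable]: "(\<lambda>x. Nrm q (\<lambda>y. K y x * gf f y)) \<in> borel_measurable borel"
    by (rule Nrm_measurable[OF q]) measurable
  show ?thesis unfolding phi_def
    by (subst Lnorm_weight_eq) (auto simp: r mult.commute[of "Nrm _ _"])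
qed

text \<open>By \<open>sigma2_eq\<close>, \<open>\<xi> (4 * U x)\<close> is the second iterate of
  \<sigma> wherever \<open>U x > 0\<close>, so \<open>be 4\<close> is the operator of
  \<open>B1\<close> in the variable \<open>t\<close>. The inequality comes from dropping the points
  with \<open>U x = 0\<close>.\<close>

lemma J_be_4_le: "J (be 4 (gf f)) \<le> Lnorm (ennreal r) u (B1_op f)"
proof -
  let ?\<Psi> = "\<lambda>x. indicator T (4 * U x) * (K (\<xi> (4 * U x)) x * Nrm q (\<lambda>y. indicator {\<xi> (4 * U x)..} y * gf f y))"
  have "(\<lambda>t. Nrm q (\<lambda>y. indicator {\<xi> (4 * t)..} y * gf f y)) \<in> borel_measurable borel"
    by (rule Nrm_measurable[OF q]) (simp add: indicator_def, measurable)
  from measurable_compose[OF U_measurable this]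
  have [measurable]: "(\<lambda>x. Nrm q (\<lambda>y. indicator {\<xi> (4 * U x)..} y * gf f y)) \<in> borel_measurable borel" .
  have "J (be 4 (gf f)) = J (\<lambda>t. ?\<Psi> (\<xi> t) * indicator T t)"
  proof (intro Nrm_cong)
    fix t
    show "be 4 (gf f) t = ?\<Psi> (\<xi> t) * indicator T t"
    proof (cases "t \<in> T")
      case False
      then have "4 * t \<notin> T" using T_down[of "4 * t" t] T_pos[of "4 * t"] by auto
      then show ?thesis using False by (simp add: be_def)
    qed (simp add: be_def U_xi)
  qed
  also have "\<dots> = Lnorm (ennreal r) u ?\<Psi>"
    by (intro Lnorm_weight_eq[symmetric] r) measurable
  also have "\<dots> \<le> Lnorm (ennreal r) u (B1_op f)"
  proof (intro Lnorm_r_mono)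
    fix x
    show "?\<Psi> x \<le> B1_op f x"
    proof (cases "4 * U x \<in> T")
      case True
      then have "0 < U x" using T_pos[OF True] by simp
      then show ?thesis using True sigma2_eq[of x] by (simp add: B1_op_def)
    qed simp
  qed
  finally show ?thesis .
qed

lemma J_be_2_le:
  "J (be 2 (gf f)) \<le> \<alpha> * (ennreal (2 powr (1 / r)) * Lnorm (ennreal r) u (B1_op f))"
proof -
  have [measurable]: "gf f \<in> borel_measurable half_line" by measurable
  have "J (be 2 (gf f)) \<le> J (\<lambda>t. \<alpha> * be 4 (gf f) (1 / 2 * t))"
    by (intro J_mono be_2_le_4) auto
  also have "\<dots> = \<alpha> * J (\<lambda>t. be 4 (gf f) (1 / 2 * t))"
    by (intro J_cmult) measurable
  also have "J (\<lambda>t. be 4 (gf f) (1 / 2 * t)) = ennreal ((1 / 2) powr (- 1 / r)) * J (be 4 (gf f))"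
    using r by (intro Nrm_scale) auto
  also have "(1 / 2) powr (- 1 / r) = 2 powr (1 / r)"
    by (simp add: powr_divide powr_minus_divide)
  also have "\<alpha> * (ennreal (2 powr (1 / r)) * J (be 4 (gf f))) \<le>
      \<alpha> * (ennreal (2 powr (1 / r)) * Lnorm (ennreal r) u (B1_op f))"
    by (intro mult_left_mono J_be_4_le) auto
  finally show ?thesis .
qed

lemma J_En_2_le:
  assumes f: "f \<in> Mplus"
  shows "J (En 2 (gf f)) \<le> \<alpha>\<^sup>2 * (Lnorm (ennreal r) u (\<lambda>x. Nrm q (\<lambda>y. K y x * om y) * prim f x) +
    J (\<lambda>t. indicator T t * Eloc f (\<xi> t)))"
proof -
  note [measurable] = Eloc_measurable[OF f] prim_tail_measurable[OF f]
  have [measurable]: "(\<lambda>x. Nrm q (\<lambda>y. K y x * om y)) \<in> borel_measurable borel"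
    by (rule Nrm_measurable[OF q]) measurable
  let ?E0 = "\<lambda>t. (Nrm q (\<lambda>y. K y (\<xi> t) * om y) * prim f (\<xi> t)) * indicator T t"
  let ?E1 = "\<lambda>t. indicator T t * Eloc f (\<xi> t)"
  have "En 2 (gf f) t \<le> \<alpha> * (?E0 t + ?E1 t)" for t
  proof (cases "t \<in> T")
    case True
    let ?h0 = "\<lambda>y. prim f (\<xi> t) * (K y (\<xi> t) * om y)"
    let ?h1 = "\<lambda>y. indicator {y. U y < 2 * t} y * (K y (\<xi> t) * om y * prim (\<lambda>z. f z * indicator {\<xi> t..} z) y)"
    have "En 2 (gf f) t = Nrm q (\<lambda>y. K y (\<xi> t) * (indicator {y. U y < 2 * t} y * gf f y))"
      using True by (simp add: En_def phi_def)
    also have "\<dots> \<le> Nrm q (\<lambda>y. ?h0 y + ?h1 y)"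
    proof (intro Nrm_mono q)
      fix y
      have "K y (\<xi> t) * om y * prim f y \<le> K y (\<xi> t) * om y * (prim f (\<xi> t) + prim (\<lambda>z. f z * indicator {\<xi> t..} z) y)"
        by (intro mult_left_mono prim_split_le f) simp
      then show "K y (\<xi> t) * (indicator {y. U y < 2 * t} y * gf f y) \<le> ?h0 y + ?h1 y"
        by (cases "U y < 2 * t") (simp_all add: distrib_left mult_ac)
    qed measurable
    also have "\<dots> \<le> \<alpha> * (Nrm q ?h0 + Nrm q ?h1)" by (intro Nrm_q_add) measurable
    also have "Nrm q ?h0 = prim f (\<xi> t) * Nrm q (\<lambda>y. K y (\<xi> t) * om y)"
      by (intro Nrm_cmult q) measurable
    finally show ?thesis using True by (simp add: Eloc_def U_xi mult_ac)
  qed (simp add: En_def phi_def)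
  then have "J (En 2 (gf f)) \<le> J (\<lambda>t. \<alpha> * (?E0 t + ?E1 t))"
    by (intro J_mono) measurable
  also have "\<dots> = \<alpha> * J (\<lambda>t. ?E0 t + ?E1 t)" by (intro J_cmult) measurable
  also have "\<dots> \<le> \<alpha> * (\<alpha> * (J ?E0 + J ?E1))" by (intro mult_left_mono J_add) measurable
  also have "J ?E0 = Lnorm (ennreal r) u (\<lambda>x. Nrm q (\<lambda>y. K y x * om y) * prim f x)"
    using r by (subst Lnorm_weight_eq) auto
  finally show ?thesis by (simp add: power2_eq_square mult.assoc)
qed

text \<open>Restricting \<open>f\<close> to the window leaves the local part unchanged but replaces
  the global norm on the right by \<open>Gam\<close>, which is summable over the scales.\<close>

definition floc :: "(real \<Rightarrow> ennreal) \<Rightarrow> real \<Rightarrow> real \<Rightarrow> ennreal" where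
  "floc f x y = f y * indicator {y. x \<le> y \<and> U y < 2 * U x} y"

lemma floc_Mplus: "f \<in> Mplus \<Longrightarrow> floc f x \<in> Mplus"
proof -
  have "(indicator {y. x \<le> y \<and> U y < 2 * U x} :: real \<Rightarrow> ennreal) \<in> borel_measurable half_line"
    by (intro borel_measurable_half_line) measurable
  then show "f \<in> Mplus \<Longrightarrow> floc f x \<in> Mplus"
    unfolding Mplus_def floc_def[abs_def] by (intro borel_measurable_times_ennreal)
qed

lemma fnorm_floc: "fnorm (floc f x) = Gam f x epowr (1 / p)"
  using p unfolding fnorm_eq Gam_def floc_def
  by (intro arg_cong2[where f="(epowr)"] nn_integral_cong) (auto split: split_indicator)

lemma prim_floc: "U y < 2 * U x \<Longrightarrow> prim (\<lambda>z. f z * indicator {x..} z) y = prim (floc f x) y"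
  unfolding prim_eq floc_def
  using U_mono by (intro nn_integral_cong) (auto split: split_indicator dest: le_less_trans)

lemma Eloc_le_Hop:
  assumes f: "f \<in> Mplus" and x: "0 \<le> x" and fin: "opnorm p v q (\<lambda>y. w y * ennreal (k y x)) (Hop x) < \<infinity>"
    and ff: "fnorm f < \<infinity>"
  shows "Eloc f x \<le> opnorm p v q (\<lambda>y. w y * ennreal (k y x)) (Hop x) * (Gam f x epowr (1 / p))"
proof -
  note [measurable] = prim_tail_measurable[OF f]
  have fl: "fnorm (floc f x) < \<infinity>"
    using Gam_le[OF f, of x] ff by (auto simp: fnorm_floc epowr_less_top_iff intro: le_less_trans)
  have "Eloc f x \<le> Nrm q (\<lambda>y. K y x * om y * Hop x (floc f x) y)"
    unfolding Eloc_def
    by (intro Nrm_mono q) (auto simp: Hop_def prim_floc K_zero split: split_indicator)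
  also have "\<dots> \<le> opnorm p v q (\<lambda>y. w y * ennreal (k y x)) (Hop x) * fnorm (floc f x)"
    using fin unfolding opnorm_eq[OF x] by (intro least_const_apply fl floc_Mplus f) auto
  finally show ?thesis by (simp add: fnorm_floc)
qed

text \<open>The window of the local part lies inside the range of \<open>Hop_cd\<close>, and the
  integral there starts before \<open>x\<close>; so on the window \<open>Hop_cd\<close> of the
  localised function is its full primitive. The base point of the kernel moves from \<open>x\<close>
  back to \<open>sigma_inv u x\<close> by \<open>K_left\<close>.\<close>

lemma Eloc_le_Hop_cd:
  assumes f: "f \<in> Mplus" and x: "0 < U x"
    and fin: "opnorm p v q (\<lambda>y. w y * ennreal (k y (sigma_inv u x))) (Hop_cd u (sigma_inv u x) (sigma2 u x)) < \<infinity>"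
    (is "?N < \<infinity>")
    and ff: "fnorm f < \<infinity>"
  shows "Eloc f x \<le> \<alpha> * ?N * (Gam f x epowr (1 / p))"
proof -
  note [measurable] = prim_tail_measurable[OF f]
  have T2: "U x / 2 \<in> T" using x by (intro T_I[of _ x]) auto
  let ?c = "sigma_inv u x"
  have c: "?c = \<xi> (U x / 2)" by (rule sigma_inv_eq[OF x])
  have Uc: "U ?c = U x / 2" using U_xi[OF T2] by (simp add: c)
  have cx: "0 \<le> ?c" "?c \<le> x" using x xi_le_iff[OF T2, of x] by (simp_all add: c)
  have T4: "U x / 4 \<in> T" using x by (intro T_I[of _ x]) auto
  have c': "sigma_inv u ?c = \<xi> (U x / 4)" using sigma_inv_eq[of ?c] x by (simp add: Uc)
  have c'x: "0 \<le> sigma_inv u ?c" "sigma_inv u ?c \<le> x"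
    using x xi_le_iff[OF T4, of x] by (simp_all add: c')
  have fl: "fnorm (floc f x) < \<infinity>"
    using Gam_le[OF f, of x] ff by (auto simp: fnorm_floc epowr_less_top_iff intro: le_less_trans)
  let ?H = "Hop_cd u ?c (sigma2 u x) (floc f x)"
  have "prim (\<lambda>z. floc f x z * indicator {sigma_inv u ?c..} z) y = prim (floc f x) y" for y
    unfolding prim_eq floc_def using c'x by (intro nn_integral_cong) (auto split: split_indicator)
  then have H: "?H y = (if ?c \<le> y \<and> ereal y < sigma2 u x then prim (floc f x) y else 0)" for y
    using c'x by (simp add: Hop_cd_def Icc_integral_eq_prim)
  \<comment> \<open>The upper limit is not felt: \<open>U y < 2 * U x < 4 * U x\<close> puts
    \<open>y\<close> below \<open>sigma2 u x\<close>.\<close>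
  have H': "?H y = prim (floc f x) y" if "x \<le> y" "U y < 2 * U x" for y
  proof -
    have "ereal y < sigma2 u x"
      using that x xi_le_iff[of "4 * U x" y] by (auto simp: sigma2_eq not_le[symmetric])
    then show ?thesis using that cx by (simp add: H)
  qed
  have [measurable]: "{y. ereal y < sigma2 u x} \<in> sets borel" by measurable
  have Hm [measurable]: "?H \<in> borel_measurable half_line"
    unfolding H[abs_def] by (intro borel_measurable_half_line) measurable
  have "Eloc f x \<le> Nrm q (\<lambda>y. \<alpha> * (K y ?c * om y * ?H y))"
    unfolding Eloc_def
  proof (intro Nrm_mono q)
    fix y
    show "indicator {y. U y < 2 * U x} y * (K y x * om y * prim (\<lambda>z. f z * indicator {x..} z) y)
        \<le> \<alpha> * (K y ?c * om y * ?H y)"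
    proof (cases "x \<le> y \<and> U y < 2 * U x")
      case True
      have "K y x * om y * ?H y \<le> (\<alpha> * K y ?c) * om y * ?H y"
        using cx by (intro mult_right_mono K_left) auto
      then show ?thesis using True by (simp add: prim_floc H' mult.assoc)
    qed (auto simp: K_zero)
  qed measurable
  also have "\<dots> = \<alpha> * Nrm q (\<lambda>y. K y ?c * om y * ?H y)"
    by (intro Nrm_cmult q) measurable
  also have "\<dots> \<le> \<alpha> * (?N * fnorm (floc f x))"
    using fin unfolding opnorm_eq[OF cx(1)]
    by (intro mult_left_mono least_const_apply fl floc_Mplus f) auto
  finally show ?thesis by (simp add: fnorm_floc mult.assoc)
qed


lemma J_eq: "J g = (\<integral>\<^sup>+t. g t epowr r \<partial>half_line) epowr (1 / r)"
  using r by (simp add: Nrm_def)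

text \<open>Because \<open>r \<ge> p\<close>, the surplus power \<open>r / p - 1\<close> of
  \<open>Gam\<close> can be estimated by the full norm of \<open>f\<close>. What remains is linear
  in \<open>Gam / t\<close>, as \<open>Gam_integral\<close> wants it.\<close>

lemma J_Eloc_le_if_p_le_r:
  assumes pr: "p \<le> r" and B2: "B2 p q r u v w k < \<infinity>" and f: "f \<in> Mplus" and F: "fnorm f < \<infinity>"
  shows "J (\<lambda>t. indicator T t * Eloc f (\<xi> t)) \<le> B2 p q r u v w k * fnorm f"
proof -
  note [measurable] = Eloc_measurable[OF f] Gam_measurable[OF f]
  define B where "B = B2 p q r u v w k"
  \<comment> \<open>The case \<open>p = r\<close> is set apart because \<open>0 epowr 0 = 0\<close>,
    not 1.\<close>
  define c where "c = (if p = r then 1 else fnorm f epowr (r - p))"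
  have c: "c * (fnorm f epowr p) = fnorm f epowr r"
    using p pr epowr_add[of "r - p" p "fnorm f"] by (auto simp: c_def)
  have Gam: "Gam f x epowr (r / p) \<le> c * Gam f x" for x
  proof (cases "p = r")
    case True
    then show ?thesis using p by (simp add: c_def)
  next
    case False
    then have "Gam f x epowr (r / p) = (Gam f x epowr (r / p - 1)) * (Gam f x epowr 1)"
      using p pr epowr_add[of "r / p - 1" 1 "Gam f x"] by simp
    also have "\<dots> \<le> ((fnorm f epowr p) epowr (r / p - 1)) * Gam f x"
      using False p pr by (simp add: mult_right_mono epowr_mono Gam_le f)
    also have "(fnorm f epowr p) epowr (r / p - 1) = c"
      using False p pr by (simp add: epowr_epowr c_def right_diff_distrib)
    finally show ?thesis .
  qed
  have main: "(indicator T t * Eloc f (\<xi> t)) epowr r \<le> (B epowr r) * c * (indicator T t * (ennreal (1 / t) * Gam f (\<xi> t)))" for t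
  proof (cases "t \<in> T")
    case True
    let ?x = "\<xi> t" and ?t = "ennreal t epowr (1 / r)"
    have t: "0 < t" using True by (rule T_pos)
    let ?N = "opnorm p v q (\<lambda>y. w y * ennreal (k y ?x)) (Hop ?x)"
    have le: "?t * ?N \<le> B"
      using pr xi_pos[OF True] unfolding B_def B2_def by (auto simp: prim_u U_xi[OF True] intro!: SUP_upper2[of ?x])
    have "?N < \<infinity>"
    proof (rule ccontr)
      assume "\<not> ?N < \<infinity>"
      then have "?t * ?N = \<infinity>" using t by (auto simp: less_top[symmetric] ennreal_mult_top epowr_eq_0_iff)
      then show False using le B2 by (simp add: B_def top_unique)
    qed
    then have "Eloc f ?x \<le> ?N * (Gam f ?x epowr (1 / p))"
      using f F by (intro Eloc_le_Hop) auto
    then have "?t * Eloc f ?x \<le> ?t * (?N * (Gam f ?x epowr (1 / p)))" by (rule mult_left_mono) simp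
    also have "\<dots> \<le> B * (Gam f ?x epowr (1 / p))"
      using mult_right_mono[OF le, of "Gam f ?x epowr (1 / p)"] by (simp add: mult.assoc)
    finally have "(?t * Eloc f ?x) epowr r \<le> (B * (Gam f ?x epowr (1 / p))) epowr r"
      using r by (intro epowr_mono)
    then have "ennreal t * (Eloc f ?x epowr r) \<le> (B epowr r) * (Gam f ?x epowr (r / p))"
      using r p by (simp add: epowr_mult epowr_epowr)
    also have "\<dots> \<le> (B epowr r) * (c * Gam f ?x)"
      by (intro mult_left_mono Gam) simp
    finally have "ennreal (1 / t) * (ennreal t * (Eloc f ?x epowr r)) \<le> ennreal (1 / t) * ((B epowr r) * (c * Gam f ?x))"
      by (rule mult_left_mono) simp
    also have "ennreal (1 / t) * (ennreal t * (Eloc f ?x epowr r)) = Eloc f ?x epowr r"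
      using t by (simp add: mult.assoc[symmetric] ennreal_mult[symmetric])
    finally show ?thesis using True by (simp add: mult_ac)
  qed simp
  have "(\<integral>\<^sup>+t. (indicator T t * Eloc f (\<xi> t)) epowr r \<partial>half_line)
      \<le> (\<integral>\<^sup>+t. (B epowr r) * c * (indicator T t * (ennreal (1 / t) * Gam f (\<xi> t))) \<partial>half_line)"
    by (intro nn_integral_mono main)
  also have "\<dots> = (B epowr r) * c * (\<integral>\<^sup>+t. (indicator T t * (ennreal (1 / t) * Gam f (\<xi> t))) \<partial>half_line)"
    by (intro nn_integral_cmult borel_measurable_half_line) measurable
  also have "\<dots> \<le> (B epowr r) * c * (fnorm f epowr p)"
    by (intro mult_left_mono Gam_integral f) simp
  also have "\<dots> = (B * fnorm f) epowr r"
    using r c by (simp add: mult.assoc epowr_mult)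
  finally show ?thesis
    using r epowr_mono[of _ "(B * fnorm f) epowr r" "1 / r"] by (simp add: J_eq epowr_inverse B_def)
qed

text \<open>Now \<open>r / p < 1\<close>, and Hoelder's inequality with exponents
  \<open>s / r\<close> and \<open>p / r\<close> takes over; they are conjugate by the definition of
  \<open>s\<close>. Its constant 2 appears as \<open>2 powr (1 / r)\<close> after the root.\<close>

lemma J_Eloc_le_if_r_less_p:
  assumes rp: "r < p" and B2: "B2 p q r u v w k < \<infinity>" and f: "f \<in> Mplus" and F: "fnorm f < \<infinity>"
  shows "J (\<lambda>t. indicator T t * Eloc f (\<xi> t)) \<le> ennreal (2 powr (1 / r)) * (\<alpha> * (B2 p q r u v w k * fnorm f))"
proof -
  note [measurable] = Eloc_measurable[OF f] Gam_measurable[OF f]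
  define B where "B = B2 p q r u v w k"
  define s where "s = 1 / (1 / r - 1 / p)"
  have diff: "0 < 1 / r - 1 / p" using r rp p by (simp add: field_simps)
  have s: "0 < s" and sr: "1 / s = 1 / r - 1 / p" using diff by (simp_all add: s_def)
  have smax: "s = 1 / max (1 / r - 1 / p) 0" using diff by (simp add: s_def)
  have PQ: "1 / (s / r) + 1 / (p / r) = 1"
    using sr r p s by (simp add: field_simps)
  have "1 / s < 1 / r" using sr p by simp
  then have "r < s" using s r by (simp add: field_simps)
  then have sr1: "1 < s / r" using r by simp
  have pr1: "1 < p / r" using r rp by simp
  let ?N = "\<lambda>x. opnorm p v q (\<lambda>y. w y * ennreal (k y (sigma_inv u x))) (Hop_cd u (sigma_inv u x) (sigma2 u x))"
  let ?G = "\<lambda>x. Gam f x epowr (1 / p)"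
  let ?h = "\<lambda>x. (Eloc f x / \<alpha>) / ?G x"
  have \<alpha>0: "0 < \<alpha>" "\<alpha> < top" using alpha_ge_1 by (auto intro: less_le_trans[of 0 1])
  have G_fin: "?G x < top" for x
    using Gam_le[OF f, of x] F by (auto simp: epowr_less_top_iff intro: le_less_trans)
  \<comment> \<open>The operator norm \<open>?N\<close> may fail to be measurable; \<open>?h\<close> is a measurable minorant, with
     \<open>?h x = \<infinity>\<close> if the denominator vanishes but the numerator does not.\<close>
  have h_le: "?h x \<le> ?N x" if "0 < U x" for x
  proof (cases "?N x < \<infinity>")
    case True
    have "Eloc f x \<le> \<alpha> * (?N x * ?G x)"
      using Eloc_le_Hop_cd[OF f that True F] by (simp add: mult.assoc)
    then have *: "Eloc f x / \<alpha> \<le> ?N x * ?G x"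
      using \<alpha>0 by (simp add: divide_le_iff_ennreal)
    show ?thesis
    proof (cases "?G x = 0")
      case False
      then have "0 < ?G x" by (simp add: zero_less_iff_neq_zero)
      then show ?thesis using * G_fin[of x] by (simp add: divide_le_iff_ennreal mult.commute)
    qed (use * in auto)
  qed (simp add: less_top[symmetric])
  define \<psi> where "\<psi> = (\<lambda>x. (prim u x epowr (s / p)) * (?h x epowr s))"
  have [measurable]: "\<psi> \<in> borel_measurable borel" unfolding \<psi>_def by measurable
  have X: "(\<integral>\<^sup>+t. \<psi> (\<xi> t) * indicator T t \<partial>half_line) \<le> B epowr s"
  proof -
    have "(\<integral>\<^sup>+t. \<psi> (\<xi> t) * indicator T t \<partial>half_line) = (\<integral>\<^sup>+x. \<psi> x * u x \<partial>half_line)"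
      by (rule nn_integral_weight_eq[symmetric]) measurable
    also have "\<dots> \<le> (\<integral>\<^sup>+x. (if prim u x = 0 then 0
             else u x * (prim u x epowr (s / p)) * (?N x epowr s)) \<partial>half_line)"
    proof (intro nn_integral_mono)
      fix x
      show "\<psi> x * u x \<le> (if prim u x = 0 then 0 else u x * (prim u x epowr (s / p)) * (?N x epowr s))"
      proof (cases "prim u x = 0")
        case False
        then have "0 < U x" using U_nonneg[of x] by (simp add: prim_u order.strict_iff_order)
        then show ?thesis using False s h_le[of x]
          by (auto simp: \<psi>_def mult_ac intro!: mult_left_mono epowr_mono)
      qed (use s p in \<open>simp add: \<psi>_def\<close>)
    qed
    also have "\<dots> = B epowr s"
      unfolding B_def B2_def Let_def nn_integral_half_line smax[symmetric] using rp s by (simp add: epowr_inverse')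
    finally show ?thesis .
  qed
  \<comment> \<open>\<open>?h\<close> is infinite where \<open>Gam\<close> vanishes but the local
    part does not. Finiteness of \<open>B2\<close> confines this to a null set of \<open>t\<close>,
    outside of which dividing by \<open>?G\<close> can be undone.\<close>
  have h_fin: "AE t in half_line. t \<in> T \<longrightarrow> ?h (\<xi> t) \<noteq> \<infinity>"
  proof -
    have "(\<integral>\<^sup>+t. \<psi> (\<xi> t) * indicator T t \<partial>half_line) \<noteq> \<infinity>"
    proof -
      have "B epowr s < top" using B2 by (simp add: B_def epowr_less_top_iff)
      then show ?thesis using X by (auto simp: top_unique)
    qed
    moreover have "(\<lambda>t. \<psi> (\<xi> t) * indicator T t) \<in> borel_measurable half_line"
      using measurable_compose[OF xi_measurable \<open>\<psi> \<in> borel_measurable borel\<close>]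
      by (intro borel_measurable_half_line borel_measurable_times_ennreal borel_measurable_indicator T_sets)
    ultimately have "AE t in half_line. \<psi> (\<xi> t) * indicator T t \<noteq> \<infinity>"
      by (intro nn_integral_PInf_AE)
    then show ?thesis
    proof eventually_elim
      case (elim t)
      show ?case
      proof
        assume t: "t \<in> T"
        show "?h (\<xi> t) \<noteq> \<infinity>"
        proof
          assume "?h (\<xi> t) = \<infinity>"
          then have "\<psi> (\<xi> t) * indicator T t = \<infinity>"
            using t T_pos[OF t] by (simp add: \<psi>_def prim_u U_xi ennreal_mult_top epowr_eq_0_iff)
          then show False using elim by simp
        qed
      qed
    qed
  qed
  \<comment> \<open>The powers \<open>t^(1/p)\<close> and \<open>t^(-1/p)\<close> are distributed so
    that \<open>?a\<close> to the power \<open>s / r\<close> becomes the transported minorant \<psi>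
    of the integrand of \<open>B2\<close>, and \<open>?b\<close> to the power \<open>p / r\<close>
    the integrand of \<open>Gam_integral\<close>.\<close>
  let ?a = "\<lambda>t. indicator T t * (((ennreal t epowr (1 / p)) * ?h (\<xi> t)) epowr r)"
  let ?b = "\<lambda>t. indicator T t * ((ennreal (1 / t) * Gam f (\<xi> t)) epowr (r / p))"
  have "(\<integral>\<^sup>+t. (indicator T t * Eloc f (\<xi> t)) epowr r \<partial>half_line) \<le> (\<integral>\<^sup>+t. (\<alpha> epowr r) * (?a t * ?b t) \<partial>half_line)"
  proof (intro nn_integral_mono_AE)
    show "AE t in half_line. (indicator T t * Eloc f (\<xi> t)) epowr r \<le> (\<alpha> epowr r) * (?a t * ?b t)"
      using h_fin
    proof eventually_elim
      case (elim t)
      show ?case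
      proof (cases "t \<in> T")
        case True
        let ?x = "\<xi> t"
        have t: "0 < t" using True by (rule T_pos)
        have hn: "?h ?x \<noteq> \<infinity>" using True elim by simp
        have "Eloc f ?x / \<alpha> \<le> ?h ?x * ?G ?x"
        proof (cases "?G ?x = 0")
          case True
          then have "Eloc f ?x / \<alpha> = 0" using hn by (simp split: if_splits)
          then show ?thesis by simp
        next
          case False
          then have "?h ?x * ?G ?x = Eloc f ?x / \<alpha>"
            using G_fin[of ?x] by (simp add: ennreal_divide_times ennreal_divide_self)
          then show ?thesis by simp
        qed
        then have "Eloc f ?x \<le> \<alpha> * (?h ?x * ?G ?x)" using \<alpha>0 by (simp add: divide_le_iff_ennreal)
        also have "\<dots> = \<alpha> * (((ennreal t epowr (1 / p)) * ?h ?x) * ((ennreal (1 / t) * Gam f ?x) epowr (1 / p)))"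
        proof -
          have "(ennreal t epowr (1 / p)) * (ennreal (1 / t) epowr (1 / p)) = 1"
            using t p by (simp add: epowr_mult[symmetric] ennreal_mult[symmetric])
          then have "?h ?x * ?G ?x = ((ennreal t epowr (1 / p)) * (ennreal (1 / t) epowr (1 / p))) * (?h ?x * ?G ?x)"
            by simp
          then show ?thesis using p by (simp add: epowr_mult mult_ac)
        qed
        finally have "Eloc f ?x epowr r \<le> (\<alpha> * (((ennreal t epowr (1 / p)) * ?h ?x) * ((ennreal (1 / t) * Gam f ?x) epowr (1 / p)))) epowr r"
          using r by (intro epowr_mono)
        also have "\<dots> = (\<alpha> epowr r) * ((((ennreal t epowr (1 / p)) * ?h ?x) epowr r) * ((ennreal (1 / t) * Gam f ?x) epowr (r / p)))"
          using r p by (simp add: epowr_mult[of r] epowr_epowr)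
        finally show ?thesis using True by simp
      qed simp
    qed
  qed
  also have "\<dots> = (\<alpha> epowr r) * (\<integral>\<^sup>+t. ?a t * ?b t \<partial>half_line)"
    by (intro nn_integral_cmult borel_measurable_half_line) measurable
  also have "\<dots> \<le> (\<alpha> epowr r) * (2 * (((\<integral>\<^sup>+t. ?a t epowr (s / r) \<partial>half_line) epowr (1 / (s / r))) *
      ((\<integral>\<^sup>+t. ?b t epowr (p / r) \<partial>half_line) epowr (1 / (p / r)))))"
  proof (intro mult_left_mono nn_integral_Holder_crude sr1 pr1 PQ)
    show "?a \<in> borel_measurable half_line" by (intro borel_measurable_half_line) measurable
    show "?b \<in> borel_measurable half_line" by (intro borel_measurable_half_line) measurable
  qed simp
  also have "(\<integral>\<^sup>+t. ?a t epowr (s / r) \<partial>half_line) = (\<integral>\<^sup>+t. \<psi> (\<xi> t) * indicator T t \<partial>half_line)"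
  proof (intro nn_integral_cong)
    fix t
    show "?a t epowr (s / r) = \<psi> (\<xi> t) * indicator T t"
      using r s p by (cases "t \<in> T") (simp_all add: \<psi>_def prim_u U_xi epowr_mult epowr_epowr)
  qed
  also have "(\<integral>\<^sup>+t. ?b t epowr (p / r) \<partial>half_line) = (\<integral>\<^sup>+t. indicator T t * (ennreal (1 / t) * Gam f (\<xi> t)) \<partial>half_line)"
  proof (intro nn_integral_cong)
    fix t
    show "?b t epowr (p / r) = indicator T t * (ennreal (1 / t) * Gam f (\<xi> t))"
      using r p by (cases "t \<in> T") (simp_all add: epowr_mult epowr_epowr)
  qed
  also have "(\<alpha> epowr r) * (2 * (((\<integral>\<^sup>+t. \<psi> (\<xi> t) * indicator T t \<partial>half_line) epowr (1 / (s / r))) *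
      ((\<integral>\<^sup>+t. indicator T t * (ennreal (1 / t) * Gam f (\<xi> t)) \<partial>half_line) epowr (1 / (p / r)))))
    \<le> (\<alpha> epowr r) * (2 * (((B epowr s) epowr (1 / (s / r))) * ((fnorm f epowr p) epowr (1 / (p / r)))))"
    using r s p by (intro mult_left_mono mult_mono epowr_mono X Gam_integral f) auto
  also have "\<dots> = 2 * ((\<alpha> * (B * fnorm f)) epowr r)"
    using r s p by (simp add: epowr_epowr epowr_mult mult_ac)
  finally have "J (\<lambda>t. indicator T t * Eloc f (\<xi> t)) \<le> (2 * ((\<alpha> * (B * fnorm f)) epowr r)) epowr (1 / r)"
    unfolding J_eq using r by (intro epowr_mono) auto
  also have "\<dots> = ennreal (2 powr (1 / r)) * (\<alpha> * (B * fnorm f))"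
    using r epowr_ennreal[of 2 "1 / r"] by (simp add: epowr_mult epowr_inverse)
  finally show ?thesis by (simp add: B_def)
qed

text \<open>The factor \<open>2 powr (1 / r)\<close> covers the crude Hoelder constant in the local
  part and the halving of \<open>t\<close> in the tail. The cube is reached by the \<open>B2\<close>
  term: a square from \<open>J_En_2_le\<close> and one \<alpha> from the change of base
  point.\<close>

definition c_suff :: real where "c_suff = Rcst * (A ^ 3 * 2 powr (1 / r))"

lemma sufficiency:
  "C_T p q r u v w k \<le> ennreal c_suff * (B0 p q r u v w k + B1 p q r u v w k + B2 p q r u v w k)"
    (is "_ \<le> _ * ?B")
proof (cases "?B < \<infinity>")
  case True
  then have fin: "B0 p q r u v w k < \<infinity>" "B1 p q r u v w k < \<infinity>" "B2 p q r u v w k < \<infinity>"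
    by (auto simp: less_top[symmetric])
  let ?c = "ennreal (2 powr (1 / r))"
  have c1: "1 \<le> ?c" using r by (simp add: ge_one_powr_ge_zero)
  have one_mult: "x \<le> c * x" if "1 \<le> c" for c x :: ennreal
    using mult_right_mono[OF that, of x] by simp
  show ?thesis unfolding C_T_eq
  proof (rule least_const_le)
    fix f assume f: "f \<in> Mplus" and F: "fnorm f < \<infinity>"
    let ?X0 = "B0 p q r u v w k * fnorm f" and ?X1 = "B1 p q r u v w k * fnorm f" and ?X2 = "B2 p q r u v w k * fnorm f"
    have 0: "Lnorm (ennreal r) u (\<lambda>x. Nrm q (\<lambda>y. K y x * om y) * prim f x) \<le> ?X0"
      using fin(1) unfolding B0_eq by (intro least_const_apply f F)
    have 1: "Lnorm (ennreal r) u (B1_op f) \<le> ?X1"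
      using fin(2) unfolding B1_eq by (intro least_const_apply f F)
    have 2: "J (\<lambda>t. indicator T t * Eloc f (\<xi> t)) \<le> ?c * (\<alpha> * ?X2)"
    proof (cases "p \<le> r")
      case True
      have "J (\<lambda>t. indicator T t * Eloc f (\<xi> t)) \<le> ?X2" by (rule J_Eloc_le_if_p_le_r[OF True fin(3) f F])
      also have "\<dots> \<le> \<alpha> * ?X2" by (rule alpha_le_mult)
      also have "\<dots> \<le> ?c * (\<alpha> * ?X2)" by (rule one_mult[OF c1])
      finally show ?thesis .
    next
      case False
      then show ?thesis using J_Eloc_le_if_r_less_p[OF _ fin(3) f F] by simp
    qed
    have "J (En 2 (gf f)) \<le> \<alpha>\<^sup>2 * (?X0 + ?c * (\<alpha> * ?X2))"
      by (rule order.trans[OF J_En_2_le[OF f]]) (intro mult_left_mono add_mono 0 2, simp)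
    also have "\<dots> \<le> \<alpha>\<^sup>2 * (?c * (\<alpha> * ?X0) + ?c * (\<alpha> * ?X2))"
      by (intro mult_left_mono add_right_mono order.trans[OF alpha_le_mult(1) one_mult[OF c1]]) simp
    also have "\<dots> = \<alpha> ^ 3 * ?c * (?X0 + ?X2)"
      by (simp add: distrib_left mult_ac power2_eq_square power3_eq_cube)
    finally have En: "J (En 2 (gf f)) \<le> \<alpha> ^ 3 * ?c * (?X0 + ?X2)" .
    have "J (be 2 (gf f)) \<le> \<alpha> * (?c * ?X1)"
      by (rule order.trans[OF J_be_2_le]) (intro mult_left_mono 1, simp_all)
    also have "\<dots> \<le> \<alpha>\<^sup>2 * (\<alpha> * (?c * ?X1))" by (rule alpha_le_mult)
    also have "\<dots> = \<alpha> ^ 3 * ?c * ?X1" by (simp add: mult_ac power2_eq_square power3_eq_cube)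
    finally have be: "J (be 2 (gf f)) \<le> \<alpha> ^ 3 * ?c * ?X1" .
    have "Lnorm (ennreal r) u (\<lambda>x. Nrm q (\<lambda>y. K y x * gf f y)) = J (phi (gf f))" by (rule T_norm_eq)
    also have "\<dots> \<le> ennreal Rcst * (J (En 2 (gf f)) + J (be 2 (gf f)))" by (intro J_phi) measurable
    also have "\<dots> \<le> ennreal Rcst * (\<alpha> ^ 3 * ?c * (?X0 + ?X2) + \<alpha> ^ 3 * ?c * ?X1)"
      by (intro mult_left_mono add_mono En be) simp
    also have "\<dots> = (ennreal Rcst * (\<alpha> ^ 3 * ?c)) * ?B * fnorm f"
      by (simp add: distrib_left distrib_right mult_ac add_ac)
    also have "ennreal Rcst * (\<alpha> ^ 3 * ?c) = ennreal c_suff"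
      using A_ge_1 by (simp add: c_suff_def Rcst_def ennreal_mult ennreal_power)
    finally show "Lnorm (ennreal r) u (\<lambda>x. Nrm q (\<lambda>y. K y x * gf f y)) \<le> ennreal c_suff * ?B * fnorm f" .
  qed
next
  case False
  moreover have "0 < c_suff" using A_ge_1 by (simp add: c_suff_def Rcst_def)
  moreover have "?B = top" using False by (simp add: less_top[symmetric])
  ultimately have "ennreal c_suff * ?B = top" by (simp only: ennreal_mult_top) simp
  then show ?thesis by simp
qed

end

section \<open>Necessity\<close>

context weights
begin

abbreviation Cst :: ennreal where "Cst \<equiv> C_T p q r u v w k"

abbreviation Tf :: "(real \<Rightarrow> ennreal) \<Rightarrow> real \<Rightarrow> ennreal" where
  "Tf f x \<equiv> Nrm q (\<lambda>y. K y x * gf f y)"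

abbreviation Hnorm :: "real \<Rightarrow> ennreal" where
  "Hnorm t \<equiv> opnorm p v q (\<lambda>y. w y * ennreal (k y t)) (Hop t)"

lemma Tf_measurable [measurable]: "Tf f \<in> borel_measurable borel"
  by (rule Nrm_measurable[OF q]) measurable

lemma Tf_half_line [measurable]: "Tf f \<in> borel_measurable half_line"
  by (intro borel_measurable_half_line Tf_measurable)

lemma T_bound:
  assumes "Cst < \<infinity>" "f \<in> Mplus" "fnorm f < \<infinity>"
  shows "Lnorm (ennreal r) u (Tf f) \<le> Cst * fnorm f"
  using assms unfolding C_T_eq by (intro least_const_apply)

lemma T_bound_alpha:
  assumes "Cst < \<infinity>" "f \<in> Mplus" "fnorm f < \<infinity>"
  shows "Lnorm (ennreal r) u (\<lambda>x. \<alpha> * Tf f x) \<le> \<alpha> * Cst * fnorm f"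
proof -
  have "(\<integral>\<^sup>+x. u x * ((\<alpha> * Tf f x) epowr r) \<partial>half_line) = (\<integral>\<^sup>+x. (\<alpha> epowr r) * (u x * (Tf f x epowr r)) \<partial>half_line)"
    using r by (simp add: epowr_mult mult_ac)
  also have "\<dots> = (\<alpha> epowr r) * (\<integral>\<^sup>+x. u x * (Tf f x epowr r) \<partial>half_line)"
    by (intro nn_integral_cmult) measurable
  finally have "Lnorm (ennreal r) u (\<lambda>x. \<alpha> * Tf f x) = \<alpha> * Lnorm (ennreal r) u (Tf f)"
    using r by (simp add: Lnorm_r epowr_mult epowr_inverse)
  then show ?thesis using T_bound[OF assms] by (simp add: mult.assoc mult_left_mono)
qed

lemma B0_le: assumes "Cst < \<infinity>" shows "B0 p q r u v w k \<le> Cst"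
  unfolding B0_eq
proof (rule least_const_le)
  fix f assume f: "f \<in> Mplus" and F: "fnorm f < \<infinity>"
  have "Lnorm (ennreal r) u (\<lambda>x. Nrm q (\<lambda>y. K y x * om y) * prim f x) \<le> Lnorm (ennreal r) u (Tf f)"
  proof (intro Lnorm_r_mono)
    fix x
    have "Nrm q (\<lambda>y. K y x * om y) * prim f x = Nrm q (\<lambda>y. prim f x * (K y x * om y))"
      by (subst Nrm_cmult) (simp_all add: q mult.commute)
    also have "\<dots> \<le> Tf f x"
    proof (intro Nrm_mono q)
      fix y
      show "prim f x * (K y x * om y) \<le> K y x * gf f y"
        using prim_mono[of x y f] by (cases "x \<le> y") (auto simp: K_zero mult_ac intro!: mult_right_mono)
    qed measurable
    finally show "Nrm q (\<lambda>y. K y x * om y) * prim f x \<le> Tf f x" .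
  qed
  also have "\<dots> \<le> Cst * fnorm f" by (rule T_bound[OF assms f F])
  finally show "Lnorm (ennreal r) u (\<lambda>x. Nrm q (\<lambda>y. K y x * om y) * prim f x) \<le> Cst * fnorm f" .
qed

lemma B1_le: assumes "Cst < \<infinity>" shows "B1 p q r u v w k \<le> \<alpha> * Cst"
  unfolding B1_eq
proof (rule least_const_le)
  fix f assume f: "f \<in> Mplus" and F: "fnorm f < \<infinity>"
  have "Lnorm (ennreal r) u (B1_op f) \<le> Lnorm (ennreal r) u (\<lambda>x. \<alpha> * Tf f x)"
  proof (intro Lnorm_r_mono)
    fix x
    let ?z = "real_of_ereal (sigma2 u x)"
    show "B1_op f x \<le> \<alpha> * Tf f x"
    proof (cases "sigma2 u x = \<infinity>")
      case False
      then have "B1_op f x = Nrm q (\<lambda>y. K ?z x * (indicator {?z..} y * gf f y))"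
        unfolding B1_op_def by (subst Nrm_cmult) (simp_all add: q)
      also have "\<dots> \<le> Nrm q (\<lambda>y. \<alpha> * (K y x * gf f y))"
      proof (intro Nrm_mono q)
        fix y
        show "K ?z x * (indicator {?z..} y * gf f y) \<le> \<alpha> * (K y x * gf f y)"
        proof (cases "?z \<le> y")
          case True
          then show ?thesis using mult_right_mono[OF K_right[OF True, of x], of "gf f y"]
            by (simp add: mult.assoc)
        qed simp
      qed measurable
      also have "\<dots> = \<alpha> * Tf f x" by (intro Nrm_cmult q) measurable
      finally show ?thesis .
    qed (simp add: B1_op_def)
  qed
  also have "\<dots> \<le> \<alpha> * Cst * fnorm f" by (rule T_bound_alpha[OF assms f F])
  finally show "Lnorm (ennreal r) u (B1_op f) \<le> \<alpha> * Cst * fnorm f" .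
qed

lemma Hop_half_line [measurable]: "Hop t f \<in> borel_measurable half_line"
  unfolding Hop_def[abs_def] by (intro borel_measurable_half_line) measurable

lemma Hop_integrand_measurable: "(\<lambda>y. K y t * om y * Hop t f y) \<in> borel_measurable half_line"
  by measurable

text \<open>By \<open>K_left\<close> the kernel based at \<open>t\<close> is dominated by the kernel
  based at any earlier \<open>x\<close>. Hence one number, the norm of \<open>Hop t f\<close>,
  bounds \<open>Tf f\<close> from below on all of \<open>[0, t]\<close>.\<close>

lemma Hop_le_Tf:
  assumes "0 \<le> x" "x \<le> t"
  shows "Nrm q (\<lambda>y. K y t * om y * Hop t f y) \<le> \<alpha> * Tf f x"
proof -
  have "Nrm q (\<lambda>y. K y t * om y * Hop t f y) \<le> Nrm q (\<lambda>y. \<alpha> * (K y x * gf f y))"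
  proof (intro Nrm_mono q)
    fix y
    have "K y t * om y * Hop t f y \<le> (\<alpha> * K y x) * om y * prim f y"
      using assms by (intro mult_mono K_left order.refl) (auto simp: Hop_def)
    then show "K y t * om y * Hop t f y \<le> \<alpha> * (K y x * gf f y)" by (simp add: mult.assoc)
  qed measurable
  also have "\<dots> = \<alpha> * Tf f x" by (intro Nrm_cmult q) measurable
  finally show ?thesis .
qed

text \<open>Integrating the r-th power of the lower bound in \<open>Hop_le_Tf\<close> over
  \<open>[0, t]\<close> against \<open>u\<close> produces the factor
  \<open>prim u t\<close>.\<close>

lemma Hnorm_bound:
  assumes C: "Cst < \<infinity>" and t: "0 \<le> t"
  shows "(prim u t epowr (1 / r)) * Hnorm t \<le> \<alpha> * Cst"
proof (cases "prim u t = 0")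
  case False
  let ?P = "prim u t epowr (1 / r)"
  have P: "0 < ?P" "?P < top"
    using False by (simp_all add: zero_less_iff_neq_zero epowr_eq_0_iff epowr_less_top_iff prim_u)
  have "Hnorm t \<le> (\<alpha> * Cst) / ?P"
    unfolding opnorm_eq[OF t]
  proof (rule least_const_le)
    fix f assume f: "f \<in> Mplus" and F: "fnorm f < \<infinity>"
    let ?n = "Nrm q (\<lambda>y. K y t * om y * Hop t f y)"
    have "(?n epowr r) * prim u t = (\<integral>\<^sup>+x. (?n epowr r) * (u x * indicator {..t} x) \<partial>half_line)"
      unfolding prim_eq by (subst nn_integral_cmult) auto
    also have "\<dots> \<le> (\<integral>\<^sup>+x. u x * ((\<alpha> * Tf f x) epowr r) \<partial>half_line)"
    proof (intro nn_integral_mono)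
      fix x assume "x \<in> space half_line"
      then have x: "0 \<le> x" by simp
      show "(?n epowr r) * (u x * indicator {..t} x) \<le> u x * ((\<alpha> * Tf f x) epowr r)"
      proof (cases "x \<le> t")
        case True
        then have "u x * (?n epowr r) \<le> u x * ((\<alpha> * Tf f x) epowr r)"
          by (intro mult_left_mono epowr_mono Hop_le_Tf x r) auto
        then show ?thesis using True by (simp add: mult.commute)
      qed simp
    qed
    finally have "((?n epowr r) * prim u t) epowr (1 / r) \<le> Lnorm (ennreal r) u (\<lambda>x. \<alpha> * Tf f x)"
      unfolding Lnorm_r using r by (intro epowr_mono) auto
    also have "\<dots> \<le> \<alpha> * Cst * fnorm f" by (rule T_bound_alpha[OF C f F])
    finally have "?P * ?n \<le> \<alpha> * Cst * fnorm f"
      using r by (simp add: epowr_mult epowr_inverse mult.commute)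
    then have "?n * ?P / ?P \<le> \<alpha> * Cst * fnorm f / ?P"
      by (intro divide_right_mono_ennreal) (simp only: mult.commute)
    moreover have "?n * ?P / ?P = ?n" using P by (intro ennreal_mult_divide_eq) auto
    ultimately have "?n \<le> \<alpha> * Cst * fnorm f / ?P" by simp
    then show "?n \<le> \<alpha> * Cst / ?P * fnorm f"
      by (simp add: divide_ennreal_def mult_ac)
  qed
  then have "?P * Hnorm t \<le> ?P * ((\<alpha> * Cst) / ?P)" by (rule mult_left_mono) simp
  also have "\<dots> = \<alpha> * Cst"
    using P by (simp add: ennreal_times_divide ennreal_mult_divide_eq mult.commute[of ?P])
  finally show ?thesis .
qed simp

lemma B2_le_if_p_le_r:
  assumes "Cst < \<infinity>" "p \<le> r"
  shows "B2 p q r u v w k \<le> \<alpha> * Cst"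
  using assms Hnorm_bound by (auto simp: B2_def intro!: SUP_least)

section \<open>Dyadic test functions\<close>

lemma Hop_cmult:
  assumes "f \<in> Mplus"
  shows "Nrm q (\<lambda>y. K y t * om y * Hop t (\<lambda>z. c * f z) y) = c * Nrm q (\<lambda>y. K y t * om y * Hop t f y)"
proof -
  have "Hop t (\<lambda>z. c * f z) y = c * Hop t f y" for y
    using assms by (simp add: Hop_def prim_cmult)
  then have "Nrm q (\<lambda>y. K y t * om y * Hop t (\<lambda>z. c * f z) y) = Nrm q (\<lambda>y. c * (K y t * om y * Hop t f y))"
    by (simp add: mult_ac)
  also have "\<dots> = c * Nrm q (\<lambda>y. K y t * om y * Hop t f y)"
    by (intro Nrm_cmult q) measurable
  finally show ?thesis .
qed

lemma fnorm_cmult: assumes "f \<in> Mplus" shows "fnorm (\<lambda>z. c * f z) = c * fnorm f"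
proof -
  have [measurable]: "f \<in> borel_measurable half_line" using assms by (simp add: Mplus_def)
  have "(\<integral>\<^sup>+y. ((c * f y) epowr p) * v y \<partial>half_line) = (c epowr p) * (\<integral>\<^sup>+y. (f y epowr p) * v y \<partial>half_line)"
    using p by (simp add: epowr_mult mult.assoc nn_integral_cmult)
  then show ?thesis using p by (simp add: fnorm_eq epowr_mult epowr_inverse)
qed

lemma almost_extremal:
  assumes t: "0 \<le> t" and fin: "Hnorm t < \<infinity>"
  obtains f where "f \<in> Mplus" "fnorm f \<le> 1" "Hnorm t / 2 \<le> Nrm q (\<lambda>y. K y t * om y * Hop t f y)"
proof (cases "Hnorm t = 0")
  case True
  show ?thesis
  proof (rule that)
    show "(\<lambda>_. 0) \<in> Mplus" by (simp add: Mplus_def)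
    show "fnorm (\<lambda>_. 0) \<le> 1" by (simp add: fnorm_eq)
  qed (simp add: True)
next
  case False
  let ?n = "\<lambda>f. Nrm q (\<lambda>y. K y t * om y * Hop t f y)"
  have "Hnorm t / 2 < Hnorm t"
    using False fin by (cases "Hnorm t") (auto simp: ennreal_divide_numeral ennreal_less_iff)
  then obtain f where f: "f \<in> Mplus" "fnorm f < \<infinity>" "\<not> ?n f \<le> Hnorm t / 2 * fnorm f"
    unfolding opnorm_eq[OF t] by (rule least_const_greater)
  \<comment> \<open>If \<open>fnorm f = 0\<close> the factor is infinite: the norm stays 0 by
    \<open>\<infinity> * 0 = 0\<close>, and the nonzero image is scaled to norm
    \<open>\<infinity>\<close>.\<close>
  let ?c = "1 / fnorm f"
  show ?thesis
  proof (rule that)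
    show "(\<lambda>z. ?c * f z) \<in> Mplus" using f(1) by (simp add: Mplus_def)
    show "fnorm (\<lambda>z. ?c * f z) \<le> 1"
    proof (cases "fnorm f = 0")
      case False
      have "fnorm (\<lambda>z. ?c * f z) = ?c * fnorm f" by (rule fnorm_cmult[OF f(1)])
      also have "\<dots> = 1" using False f(2) by (simp only: ennreal_divide_times) simp
      finally show ?thesis by simp
    qed (simp only: fnorm_cmult[OF f(1)], simp)
    show "Hnorm t / 2 \<le> ?n (\<lambda>z. ?c * f z)"
    proof (cases "fnorm f = 0")
      case True
      then have "?n (\<lambda>z. ?c * f z) = top"
        using f(3) unfolding Hop_cmult[OF f(1)] by (simp add: ennreal_top_mult)
      then show ?thesis by (simp only:) simp
    next
      case False
      have "?c * (Hnorm t / 2 * fnorm f) \<le> ?c * ?n f"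
        using f(3) by (intro mult_left_mono) auto
      moreover have "?c * (Hnorm t / 2 * fnorm f) = Hnorm t / 2"
        using False f(2) mult_ac(2)[of "?c" "Hnorm t / 2 * fnorm f"]
        by (simp add: ennreal_times_divide ennreal_mult_divide_eq less_top)
      ultimately show ?thesis by (simp add: Hop_cmult[OF f(1)])
    qed
  qed
qed

abbreviation tau :: "int \<Rightarrow> real" where "tau m \<equiv> 2 powr real_of_int m"

text \<open>The duality argument in discrete form: the weights \<open>a m\<close> turn both sides of
  the bound for the test function into powers of one sum \<open>S\<close>, and dividing by the
  smaller power isolates \<open>S\<close>. The factor \<open>2 powr s\<close> compensates for using
  functions that reach only half of the operator norm.\<close>

lemma dyadic_sum_bound:
  assumes C: "Cst < \<infinity>" and rp: "r < p" and s: "1 / s = 1 / r - 1 / p"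
    and M: "finite M" "\<And>m. m \<in> M \<Longrightarrow> tau m \<in> T"
  shows "(\<Sum>m\<in>M. ((ennreal (tau m) epowr (1 / r)) * Hnorm (\<xi> (tau m))) epowr s)
     \<le> ennreal (2 powr s * 2 powr (s / r)) * ((\<alpha> * Cst) epowr s)"
proof -
  have diff: "0 < 1 / r - 1 / p" using r rp p by (simp add: field_simps)
  have s0: "0 < s" using diff s by (metis zero_less_divide_1_iff)
  have sr: "s / p + 1 = s / r" using s s0 p r by (simp add: field_simps)
  let ?H = "\<lambda>m. Hnorm (\<xi> (tau m))" and ?n = "\<lambda>m f. Nrm q (\<lambda>y. K y (\<xi> (tau m)) * om y * Hop (\<xi> (tau m)) f y)"
  have Hfin: "?H m < \<infinity>" if "m \<in> M" for m
  proof (rule ccontr)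
    assume "\<not> ?H m < \<infinity>"
    then have "(prim u (\<xi> (tau m)) epowr (1 / r)) * ?H m = \<infinity>"
      using M(2)[OF that] by (simp add: prim_u U_xi ennreal_mult_top epowr_eq_0_iff less_top[symmetric])
    moreover have "\<alpha> * Cst < \<infinity>" using C by (simp add: ennreal_mult_less_top)
    ultimately show False using Hnorm_bound[OF C, of "\<xi> (tau m)"] by (simp add: top_unique)
  qed
  have "\<forall>m\<in>M. \<exists>f. f \<in> Mplus \<and> fnorm f \<le> 1 \<and> ?H m / 2 \<le> ?n m f"
  proof
    fix m assume "m \<in> M"
    then obtain f where "f \<in> Mplus" "fnorm f \<le> 1" "?H m / 2 \<le> ?n m f"
      by (rule almost_extremal[OF xi_nonneg Hfin])
    then show "\<exists>f. f \<in> Mplus \<and> fnorm f \<le> 1 \<and> ?H m / 2 \<le> ?n m f" by (intro exI conjI)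
  qed
  from bchoice[OF this] obtain ff where "\<forall>m\<in>M. ff m \<in> Mplus \<and> fnorm (ff m) \<le> 1 \<and> ?H m / 2 \<le> ?n m (ff m)" ..
  then have ff: "\<And>m. m \<in> M \<Longrightarrow> ff m \<in> Mplus" "\<And>m. m \<in> M \<Longrightarrow> fnorm (ff m) \<le> 1"
      "\<And>m. m \<in> M \<Longrightarrow> ?H m / 2 \<le> ?n m (ff m)"
    by blast+
  define b where "b m = (ennreal (tau m) epowr (1 / r)) * (?H m / 2)" for m
  \<comment> \<open>Since \<open>s / p + 1 = s / r\<close>, both \<open>a m epowr p\<close> and
    \<open>(a m * b m) epowr r\<close> equal \<open>b m epowr s\<close>.\<close>
  define a where "a m = b m epowr (s / p)" for m
  define S where "S = (\<Sum>m\<in>M. b m epowr s)"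
  have bfin: "b m < top" if "m \<in> M" for m
  proof -
    have "?H m / 2 < top" using Hfin[OF that] by (cases "?H m") (auto simp: ennreal_divide_numeral)
    then show ?thesis by (simp add: b_def ennreal_mult_less_top epowr_less_top_iff)
  qed
  \<comment> \<open>Finiteness allows the later division by a power of \<open>S\<close>; this is the
    reason for a finite index set \<open>M\<close>.\<close>
  have Sfin: "S < top" unfolding S_def using M(1) bfin by (simp add: epowr_less_top_iff)
  \<comment> \<open>A supremum dominates every \<open>a m * ff m\<close>, and its p-th power is at
    most the sum of the p-th powers with constant 1; a sum of functions would lack the second
    property.\<close>
  define f where "f x = (SUP m\<in>M. a m * ff m x)" for x
  have [measurable]: "ff m \<in> borel_measurable half_line" if "m \<in> M" for m
    using ff(1)[OF that] by (simp add: Mplus_def)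
  have f: "f \<in> Mplus"
    unfolding Mplus_def f_def[abs_def] using M(1) by (intro borel_measurable_SUP countable_finite) auto
  have Fp: "fnorm f epowr p \<le> S"
  proof -
    have "fnorm f epowr p = (\<integral>\<^sup>+y. (f y epowr p) * v y \<partial>half_line)"
      using p by (simp add: fnorm_eq epowr_inverse')
    also have "\<dots> \<le> (\<integral>\<^sup>+y. (\<Sum>m\<in>M. (a m epowr p) * ((ff m y epowr p) * v y)) \<partial>half_line)"
    proof (intro nn_integral_mono)
      fix y
      have "f y epowr p \<le> (\<Sum>m\<in>M. (a m * ff m y) epowr p)"
        unfolding f_def using p M(1) by (subst epowr_SUP) (auto intro!: SUP_least member_le_sum)
      then have "(f y epowr p) * v y \<le> (\<Sum>m\<in>M. (a m * ff m y) epowr p) * v y"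
        by (rule mult_right_mono) simp
      also have "\<dots> = (\<Sum>m\<in>M. (a m epowr p) * ((ff m y epowr p) * v y))"
        using p by (simp add: sum_distrib_right epowr_mult mult.assoc)
      finally show "(f y epowr p) * v y \<le> (\<Sum>m\<in>M. (a m epowr p) * ((ff m y epowr p) * v y))" .
    qed
    also have "\<dots> = (\<Sum>m\<in>M. \<integral>\<^sup>+y. (a m epowr p) * ((ff m y epowr p) * v y) \<partial>half_line)"
      by (rule nn_integral_sum) measurable
    also have "\<dots> = (\<Sum>m\<in>M. (a m epowr p) * (fnorm (ff m) epowr p))"
      using p by (intro sum.cong refl) (simp add: nn_integral_cmult fnorm_eq epowr_inverse')
    also have "\<dots> \<le> (\<Sum>m\<in>M. (a m epowr p) * (1 epowr p))"
      using p ff(2) by (intro sum_mono mult_left_mono epowr_mono) auto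
    also have "\<dots> = S"
      using p s0 by (simp add: S_def a_def epowr_epowr)
    finally show ?thesis .
  qed
  have F: "fnorm f < \<infinity>"
    using le_less_trans[OF Fp Sfin] by (simp add: epowr_less_top_iff)
  have lower: "a m * (?H m / 2) \<le> \<alpha> * Tf f x" if "m \<in> M" "0 \<le> x" "x \<le> \<xi> (tau m)" for m x
  proof -
    have "a m * (?H m / 2) \<le> a m * ?n m (ff m)"
      by (intro mult_left_mono ff(3) that) simp
    also have "\<dots> = ?n m (\<lambda>z. a m * ff m z)"
      by (rule Hop_cmult[symmetric, OF ff(1)[OF that(1)]])
    also have "\<dots> \<le> ?n m f"
    proof (intro Nrm_mono q mult_left_mono)
      fix y
      have "prim (\<lambda>z. a m * ff m z) y \<le> prim f y"
        using that(1) by (intro prim_mono_fun) (auto simp: f_def intro: SUP_upper)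
      then show "Hop (\<xi> (tau m)) (\<lambda>z. a m * ff m z) y \<le> Hop (\<xi> (tau m)) f y"
        by (simp add: Hop_def)
    qed (simp_all add: Hop_integrand_measurable)
    also have "\<dots> \<le> \<alpha> * Tf f x" by (rule Hop_le_Tf[OF that(2,3)])
    finally show ?thesis .
  qed
  let ?I = "\<lambda>m. {tau (m - 1)<..tau m}"
  have disj: "m = n" if "t \<in> ?I m" "t \<in> ?I n" for m n :: int and t :: real
  proof (rule ccontr)
    assume "m \<noteq> n"
    then consider "m \<le> n - 1" | "n \<le> m - 1" by linarith
    then show False
    proof cases
      case 1
      then have le: "tau m \<le> tau (n - 1)" by (intro powr_mono) auto
      have "tau (n - 1) < t" "t \<le> tau m" using that by simp_all
      then have "tau (n - 1) < tau m" by (rule less_le_trans)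
      with leD[OF le] show False by contradiction
    next
      case 2
      then have le: "tau n \<le> tau (m - 1)" by (intro powr_mono) auto
      have "tau (m - 1) < t" "t \<le> tau n" using that by simp_all
      then have "tau (m - 1) < tau n" by (rule less_le_trans)
      with leD[OF le] show False by contradiction
    qed
  qed
  \<comment> \<open>The interval \<open>?I m\<close> has length \<open>tau m / 2\<close>, hence the
    1/2. The intervals are disjoint, so at each \<open>t\<close> only one summand has to be compared
    with \<open>Tf f\<close>.\<close>
  have "ennreal (1 / 2) * S = (\<Sum>m\<in>M. \<integral>\<^sup>+t. ((a m * (?H m / 2)) epowr r) * indicator (?I m) t \<partial>half_line)"
    unfolding S_def sum_distrib_left
  proof (intro sum.cong refl)
    fix m assume m: "m \<in> M"
    have "tau m = 2 * tau (m - 1)" by (simp add: powr_diff)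
    then have len: "tau m - tau (m - 1) = tau m / 2" by simp
    have sub: "?I m \<subseteq> {0..}"
      by (auto intro: less_imp_le[OF le_less_trans[OF powr_ge_zero]])
    have "tau (m - 1) \<le> tau m" by (intro powr_mono) auto
    then have "emeasure half_line (?I m) = ennreal (tau m / 2)"
      unfolding len[symmetric] using sub by (subst emeasure_restrict_space) auto
    then have "(\<integral>\<^sup>+t. ((a m * (?H m / 2)) epowr r) * indicator (?I m) t \<partial>half_line) = ((a m * (?H m / 2)) epowr r) * ennreal (tau m / 2)"
      using sub by (subst nn_integral_cmult_indicator) (simp_all add: sets_restrict_space_iff)
    also have "\<dots> = ((a m * b m) epowr r) * ennreal (1 / 2)"
    proof -
      have "ennreal (tau m / 2) = ennreal (tau m) * ennreal (1 / 2)"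
        by (subst ennreal_mult[symmetric]) simp_all
      moreover have "(a m * (?H m / 2)) epowr r * ennreal (tau m) = (a m * b m) epowr r"
        using r by (simp add: b_def epowr_mult epowr_epowr mult_ac)
      ultimately show ?thesis by (simp add: mult.assoc[symmetric])
    qed
    also have "a m * b m = b m epowr (s / r)"
      using epowr_add[of "s / p" 1 "b m"] s0 p by (simp add: a_def sr)
    also have "(b m epowr (s / r)) epowr r = b m epowr s"
      using s0 r by (simp add: epowr_epowr)
    finally show "ennreal (1 / 2) * (b m epowr s) = (\<integral>\<^sup>+t. ((a m * (?H m / 2)) epowr r) * indicator (?I m) t \<partial>half_line)"
      by (simp add: mult.commute)
  qed
  also have "\<dots> = (\<integral>\<^sup>+t. (\<Sum>m\<in>M. ((a m * (?H m / 2)) epowr r) * indicator (?I m) t) \<partial>half_line)"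
    by (intro nn_integral_sum[symmetric] borel_measurable_half_line) measurable
  also have "\<dots> \<le> (\<integral>\<^sup>+t. ((\<alpha> * Tf f (\<xi> t)) epowr r) * indicator T t \<partial>half_line)"
  proof (intro nn_integral_mono)
    fix t
    show "(\<Sum>m\<in>M. ((a m * (?H m / 2)) epowr r) * indicator (?I m) t) \<le> ((\<alpha> * Tf f (\<xi> t)) epowr r) * indicator T t"
    proof (cases "\<exists>m\<in>M. t \<in> ?I m")
      case True
      then obtain m where m: "m \<in> M" "t \<in> ?I m" by blast
      have "tau (m - 1) < t" "t \<le> tau m" using m(2) by simp_all
      then have "0 < t" by (intro le_less_trans[OF powr_ge_zero])
      have tT: "t \<in> T" by (rule T_down[OF M(2)[OF m(1)] \<open>0 < t\<close> \<open>t \<le> tau m\<close>])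
      have "\<xi> t \<le> \<xi> (tau m)" by (rule xi_mono[OF M(2)[OF m(1)] \<open>0 < t\<close> \<open>t \<le> tau m\<close>])
      have "indicator (?I n) t = (0 :: ennreal)" if "n \<in> M - {m}" for n
        using disj[OF _ m(2), of n] that by (cases "t \<in> ?I n") auto
      then have "(\<Sum>n\<in>M. ((a n * (?H n / 2)) epowr r) * indicator (?I n) t) = (\<Sum>n\<in>{m}. ((a n * (?H n / 2)) epowr r) * indicator (?I n) t)"
        using m(1) by (intro sum.mono_neutral_right M(1)) simp_all
      also have "\<dots> = (a m * (?H m / 2)) epowr r" using m(2) by simp
      also have "\<dots> \<le> (\<alpha> * Tf f (\<xi> t)) epowr r"
        by (intro epowr_mono lower m(1) r xi_nonneg \<open>\<xi> t \<le> \<xi> (tau m)\<close>)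
      finally show ?thesis using tT by simp
    next
      case False
      then have "(\<Sum>m\<in>M. ((a m * (?H m / 2)) epowr r) * indicator (?I m) t) = 0"
        by (intro sum.neutral) auto
      then show ?thesis by simp
    qed
  qed
  also have "\<dots> = (\<integral>\<^sup>+x. ((\<alpha> * Tf f x) epowr r) * u x \<partial>half_line)"
    by (rule nn_integral_weight_eq[symmetric]) measurable
  also have "\<dots> = Lnorm (ennreal r) u (\<lambda>x. \<alpha> * Tf f x) epowr r"
    using r by (simp add: Lnorm_r epowr_inverse' mult.commute)
  also have "\<dots> \<le> (\<alpha> * Cst * fnorm f) epowr r"
    using r by (intro epowr_mono T_bound_alpha C f F)
  also have "\<dots> = ((\<alpha> * Cst) epowr r) * ((fnorm f epowr p) epowr (r / p))"
    using r p by (simp add: epowr_mult epowr_epowr)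
  also have "\<dots> \<le> ((\<alpha> * Cst) epowr r) * (S epowr (r / p))"
    using r p by (intro mult_left_mono epowr_mono Fp) auto
  finally have key: "ennreal (1 / 2) * S \<le> ((\<alpha> * Cst) epowr r) * (S epowr (r / p))" .
  \<comment> \<open>From \<open>r / s + r / p = 1\<close>, cancelling \<open>S epowr (r / p)\<close>
    leaves \<open>S epowr (r / s)\<close>; the power \<open>s / r\<close> then turns the factor 2
    into \<open>2 powr (s / r)\<close>.\<close>
  have "S \<le> ennreal (2 powr (s / r)) * ((\<alpha> * Cst) epowr s)"
  proof (cases "S = 0")
    case False
    let ?c = "S epowr (r / p)"
    have c: "0 < ?c" "?c < top"
      using False Sfin by (simp_all add: zero_less_iff_neq_zero epowr_eq_0_iff epowr_less_top_iff)
    have "r / s + r / p = 1" using s r p s0 by (simp add: field_simps)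
    then have "(S epowr (r / s)) * ?c = S"
      using epowr_add[of "r / s" "r / p" S] r s0 p by simp
    moreover have "S = 2 * (ennreal (1 / 2) * S)"
    proof -
      have "ennreal 2 * ennreal (1 / 2) = 1" by (subst ennreal_mult[symmetric]) simp_all
      then have "2 * (ennreal (1 / 2) * S) = 1 * S" by (simp only: mult.assoc[symmetric] ennreal_numeral)
      then show ?thesis by simp
    qed
    ultimately have "(S epowr (r / s)) * ?c \<le> 2 * ((\<alpha> * Cst) epowr r) * ?c"
      using mult_left_mono[OF key, of 2] by (simp add: mult.assoc)
    then have "(S epowr (r / s)) * ?c / ?c \<le> 2 * ((\<alpha> * Cst) epowr r) * ?c / ?c"
      by (rule divide_right_mono_ennreal)
    then have "S epowr (r / s) \<le> 2 * ((\<alpha> * Cst) epowr r)"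
      using c by (simp add: ennreal_mult_divide_eq)
    then have "(S epowr (r / s)) epowr (s / r) \<le> (2 * ((\<alpha> * Cst) epowr r)) epowr (s / r)"
      using r s0 by (intro epowr_mono) auto
    then show ?thesis
      using r s0 epowr_ennreal[of 2 "s / r"] by (simp add: epowr_epowr epowr_mult)
  qed simp
  moreover have "(\<Sum>m\<in>M. ((ennreal (tau m) epowr (1 / r)) * ?H m) epowr s) = ennreal (2 powr s) * S"
    unfolding S_def sum_distrib_left
  proof (intro sum.cong refl)
    fix m
    have "(ennreal (tau m) epowr (1 / r)) * ?H m = 2 * b m"
    proof -
      have "?H m = 2 * (?H m / 2)"
        by (simp add: ennreal_times_divide mult_divide_eq_ennreal mult.commute[of 2])
      then have "(ennreal (tau m) epowr (1 / r)) * ?H m = (ennreal (tau m) epowr (1 / r)) * (2 * (?H m / 2))"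
        by (rule arg_cong)
      also have "\<dots> = 2 * b m" unfolding b_def by (rule mult.left_commute)
      finally show ?thesis .
    qed
    then show "((ennreal (tau m) epowr (1 / r)) * ?H m) epowr s = ennreal (2 powr s) * (b m epowr s)"
      using s0 epowr_ennreal[of 2 s] by (simp add: epowr_mult)
  qed
  ultimately show ?thesis
    by (simp add: ennreal_mult mult.assoc mult_left_mono)
qed

text \<open>The factors, in order: the length \<open>2 * tau m\<close> of a dyadic block, the bound
  \<open>t < 4 * tau m\<close> on it, the comparison \<open>Hop_cd_norm_le\<close>, the constant of
  \<open>dyadic_sum_bound\<close>, and the \<alpha> that accompanies \<open>Cst\<close>
  there.\<close>

definition c_nec :: real where
  "c_nec = (let s = 1 / (1 / r - 1 / p) in
     (2 * 4 powr (s / p) * A powr s * (2 powr s * 2 powr (s / r)) * A powr s) powr (1 / s))"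

text \<open>The hypothesis places \<xi> t to the left of \<open>sigma_inv u x\<close>. Starting
  earlier and removing the upper limit only enlarges the operator, and \<open>K_left\<close> adjusts
  the kernel.\<close>

lemma Hop_cd_norm_le:
  assumes t: "t \<in> T" and tx: "t \<le> U x / 2"
  shows "opnorm p v q (\<lambda>y. w y * ennreal (k y (sigma_inv u x))) (Hop_cd u (sigma_inv u x) (sigma2 u x))
    \<le> \<alpha> * Hnorm (\<xi> t)"
proof (cases "Hnorm (\<xi> t) < \<infinity>")
  case True
  let ?c = "sigma_inv u x" and ?d = "sigma2 u x"
  have t0: "0 < t" using t by (rule T_pos)
  have x: "0 < U x" using T_pos[OF t] tx by simp
  have T2: "U x / 2 \<in> T" using x by (intro T_I[of _ x]) auto
  have c: "?c = \<xi> (U x / 2)" by (rule sigma_inv_eq[OF x])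
  have Uc: "U ?c = U x / 2" using U_xi[OF T2] by (simp add: c)
  have xc: "\<xi> t \<le> ?c" using t0 tx by (simp add: c xi_mono[OF T2])
  have c': "0 \<le> sigma_inv u ?c" using sigma_inv_eq[of ?c] x by (simp add: Uc)
  have c0: "0 \<le> ?c" by (simp add: c)
  show ?thesis unfolding opnorm_eq[OF c0]
  proof (rule least_const_le)
    fix f assume f: "f \<in> Mplus" and F: "fnorm f < \<infinity>"
    have H: "Hop_cd u ?c ?d f y = (if ?c \<le> y \<and> ereal y < ?d then prim (\<lambda>z. f z * indicator {sigma_inv u ?c..} z) y else 0)" for y
      by (simp add: Hop_cd_def Icc_integral_eq_prim c')
    have [measurable]: "Hop_cd u ?c ?d f \<in> borel_measurable half_line"
      unfolding H[abs_def] by (intro borel_measurable_half_line) measurable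
    have "Nrm q (\<lambda>y. K y ?c * om y * Hop_cd u ?c ?d f y) \<le> Nrm q (\<lambda>y. \<alpha> * (K y (\<xi> t) * om y * Hop (\<xi> t) f y))"
    proof (intro Nrm_mono q)
      fix y
      have "Hop_cd u ?c ?d f y \<le> Hop (\<xi> t) f y"
        using xc by (auto simp: H Hop_def intro!: prim_mono_fun split: split_indicator)
      then have "K y ?c * om y * Hop_cd u ?c ?d f y \<le> (\<alpha> * K y (\<xi> t)) * om y * Hop (\<xi> t) f y"
        using xc by (intro mult_mono K_left) auto
      then show "K y ?c * om y * Hop_cd u ?c ?d f y \<le> \<alpha> * (K y (\<xi> t) * om y * Hop (\<xi> t) f y)"
        by (simp add: mult.assoc)
    qed measurable
    also have "\<dots> = \<alpha> * Nrm q (\<lambda>y. K y (\<xi> t) * om y * Hop (\<xi> t) f y)"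
      by (intro Nrm_cmult q) measurable
    also have "\<dots> \<le> \<alpha> * (Hnorm (\<xi> t) * fnorm f)"
      using True unfolding opnorm_eq[OF xi_nonneg] by (intro mult_left_mono least_const_apply f F) auto
    finally show "Nrm q (\<lambda>y. K y ?c * om y * Hop_cd u ?c ?d f y) \<le> \<alpha> * Hnorm (\<xi> t) * fnorm f"
      by (simp add: mult.assoc)
  qed
next
  case False
  have "\<alpha> \<noteq> 0" using alpha_ge_1 by auto
  then have "\<alpha> * Hnorm (\<xi> t) = top" using False by (simp add: less_top[symmetric] ennreal_mult_top)
  then show ?thesis by simp
qed

text \<open>Replacing each norm by the one at a dyadic level below \<open>U x / 2\<close> gives a
  measurable majorant that depends on \<open>x\<close> through \<open>U x\<close> alone. Transported
  to the variable \<open>t\<close>, its integral is controlled block by block.\<close>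

lemma B2_le_if_r_less_p:
  assumes C: "Cst < \<infinity>" and rp: "r < p"
  shows "B2 p q r u v w k \<le> ennreal c_nec * Cst"
proof -
  define s where "s = 1 / (1 / r - 1 / p)"
  have diff: "0 < 1 / r - 1 / p" using r rp p by (simp add: field_simps)
  have s0: "0 < s" and s: "1 / s = 1 / r - 1 / p" using diff by (simp_all add: s_def)
  have smax: "s = 1 / max (1 / r - 1 / p) 0" using diff by (simp add: s_def)
  have sr: "s / p + 1 = s / r" using s s0 p r by (simp add: field_simps)
  let ?N = "\<lambda>x. opnorm p v q (\<lambda>y. w y * ennreal (k y (sigma_inv u x))) (Hop_cd u (sigma_inv u x) (sigma2 u x))"
  define H where "H m = Hnorm (\<xi> (tau m))" for m :: int
  \<comment> \<open>The shift by 1 places the level at or below \<open>t / 2\<close>, as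
    \<open>Hop_cd_norm_le\<close> demands; therefore \<open>t\<close> lies between
    \<open>2 * tau\<close> and \<open>4 * tau\<close>.\<close>
  define ix where "ix t = \<lfloor>log 2 t\<rfloor> - 1" for t
  have ix: "2 * tau (ix t) \<le> t" "t < 4 * tau (ix t)" if "0 < t" for t
  proof -
    have e: "tau (ix t) = tau \<lfloor>log 2 t\<rfloor> / 2" by (simp add: ix_def powr_diff)
    have "tau \<lfloor>log 2 t\<rfloor> \<le> 2 powr (log 2 t)" by (intro powr_mono) auto
    then show "2 * tau (ix t) \<le> t" using that by (simp add: e)
    have "2 powr (log 2 t) < 2 powr (real_of_int \<lfloor>log 2 t\<rfloor> + 1)" by (intro powr_less_mono) auto
    then show "t < 4 * tau (ix t)" using that by (simp add: e powr_add)
  qed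
  define \<Psi> where "\<Psi> t = (ennreal t epowr (s / p)) * ((\<alpha> * H (ix t)) epowr s)" for t
  have [measurable]: "(\<lambda>t. H (ix t)) \<in> borel_measurable borel"
    unfolding ix_def by measurable
  have \<Psi>m [measurable]: "\<Psi> \<in> borel_measurable borel" unfolding \<Psi>_def by measurable
  let ?R = "ennreal (2 * 4 powr (s / p) * A powr s * (2 powr s * 2 powr (s / r)) * A powr s) * (Cst epowr s)"
  have part: "(\<integral>\<^sup>+t. \<Psi> t * indicator T t * (if \<bar>ix t\<bar> \<le> int n then 1 else 0) \<partial>half_line) \<le> ?R" for n
  proof -
    define M where "M = {m \<in> {- int n..int n}. tau m \<in> T}"
    have M: "finite M" "\<And>m. m \<in> M \<Longrightarrow> tau m \<in> T" by (auto simp: M_def intro: finite_subset[of _ "{- int n..int n}"])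
    let ?c = "\<lambda>m. ennreal (4 powr (s / p) * A powr s) * ((ennreal (tau m) epowr (s / p)) * (H m epowr s))"
    let ?I = "\<lambda>m. {2 * tau m..<4 * tau m}"
    have "(\<integral>\<^sup>+t. \<Psi> t * indicator T t * (if \<bar>ix t\<bar> \<le> int n then 1 else 0) \<partial>half_line)
        \<le> (\<integral>\<^sup>+t. (\<Sum>m\<in>M. ?c m * indicator (?I m) t) \<partial>half_line)"
    proof (intro nn_integral_mono)
      fix t
      show "\<Psi> t * indicator T t * (if \<bar>ix t\<bar> \<le> int n then 1 else 0) \<le> (\<Sum>m\<in>M. ?c m * indicator (?I m) t)"
      proof (cases "t \<in> T \<and> \<bar>ix t\<bar> \<le> int n")
        case True
        then have t: "0 < t" using T_pos by blast
        let ?m = "ix t"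
        have "tau ?m \<le> t" using ix(1)[OF t] powr_ge_zero[of 2 "real_of_int ?m"] by linarith
        then have mM: "?m \<in> M" using True by (auto simp: M_def intro: T_down)
        have "ennreal t epowr (s / p) \<le> ennreal (4 * tau ?m) epowr (s / p)"
          using ix(2)[OF t] s0 p by (intro epowr_mono ennreal_leI) auto
        also have "\<dots> = ennreal (4 powr (s / p)) * (ennreal (tau ?m) epowr (s / p))"
          by (subst (1 2) epowr_ennreal) (simp_all add: powr_mult ennreal_mult)
        finally have "\<Psi> t \<le> (ennreal (4 powr (s / p)) * (ennreal (tau ?m) epowr (s / p))) * ((\<alpha> * H ?m) epowr s)"
          unfolding \<Psi>_def by (rule mult_right_mono) simp
        also have "\<dots> = ?c ?m"
          using s0 A_ge_1 by (simp add: epowr_mult epowr_ennreal ennreal_mult mult_ac)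
        also have "\<dots> = ?c ?m * indicator (?I ?m) t" using ix[OF t] by simp
        also have "\<dots> \<le> (\<Sum>m\<in>M. ?c m * indicator (?I m) t)"
          using mM M(1) by (intro member_le_sum) auto
        finally show ?thesis using True by simp
      qed auto
    qed
    also have "\<dots> = (\<Sum>m\<in>M. \<integral>\<^sup>+t. ?c m * indicator (?I m) t \<partial>half_line)"
      by (intro nn_integral_sum borel_measurable_half_line) measurable
    also have "\<dots> = (\<Sum>m\<in>M. ennreal (2 * 4 powr (s / p) * A powr s) * (((ennreal (tau m) epowr (1 / r)) * H m) epowr s))"
    proof (intro sum.cong refl)
      fix m
      have sub: "?I m \<subseteq> {0..}" by (auto intro: order.trans[of 0 "2 * tau m"])
      then have "emeasure half_line (?I m) = ennreal (2 * tau m)"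
        by (subst emeasure_restrict_space) auto
      then have "(\<integral>\<^sup>+t. ?c m * indicator (?I m) t \<partial>half_line) = ?c m * ennreal (2 * tau m)"
        using sub by (subst nn_integral_cmult_indicator) (simp_all add: sets_restrict_space_iff)
      also have "\<dots> = ennreal (2 * 4 powr (s / p) * A powr s) * (((ennreal (tau m) epowr (s / p)) * (ennreal (tau m) epowr 1)) * (H m epowr s))"
        by (simp add: ennreal_mult mult_ac)
      also have "(ennreal (tau m) epowr (s / p)) * (ennreal (tau m) epowr 1) = ennreal (tau m) epowr (s / r)"
        using s0 p by (subst epowr_add[symmetric]) (simp_all add: sr)
      also have "(ennreal (tau m) epowr (s / r)) * (H m epowr s) = ((ennreal (tau m) epowr (1 / r)) * H m) epowr s"
        using s0 r by (simp add: epowr_mult epowr_epowr)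
      finally show "(\<integral>\<^sup>+t. ?c m * indicator (?I m) t \<partial>half_line) =
        ennreal (2 * 4 powr (s / p) * A powr s) * (((ennreal (tau m) epowr (1 / r)) * H m) epowr s)" .
    qed
    also have "\<dots> = ennreal (2 * 4 powr (s / p) * A powr s) * (\<Sum>m\<in>M. ((ennreal (tau m) epowr (1 / r)) * H m) epowr s)"
      by (simp add: sum_distrib_left)
    also have "\<dots> \<le> ennreal (2 * 4 powr (s / p) * A powr s) * (ennreal (2 powr s * 2 powr (s / r)) * ((\<alpha> * Cst) epowr s))"
      unfolding H_def by (intro mult_left_mono dyadic_sum_bound C rp s M) simp_all
    also have "\<dots> = ?R"
      using s0 A_ge_1 by (simp add: epowr_mult epowr_ennreal ennreal_mult mult_ac)
    finally show ?thesis .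
  qed
  have "(\<integral>\<^sup>+x. (if prim u x = 0 then 0
             else u x * (prim u x epowr (s / p)) * (?N x epowr s)) \<partial>half_line)
      \<le> (\<integral>\<^sup>+x. \<Psi> (U x) * u x \<partial>half_line)"
  proof (intro nn_integral_mono)
    fix x
    show "(if prim u x = 0 then 0 else u x * (prim u x epowr (s / p)) * (?N x epowr s)) \<le> \<Psi> (U x) * u x"
    proof (cases "prim u x = 0")
      case False
      then have x: "0 < U x" using U_nonneg[of x] by (simp add: prim_u order.strict_iff_order)
      have "tau (ix (U x)) \<le> U x / 2" using ix(1)[OF x] by simp
      moreover have "tau (ix (U x)) \<in> T"
        using calculation x by (intro T_I[of _ x]) auto
      ultimately have "?N x \<le> \<alpha> * H (ix (U x))"
        unfolding H_def by (rule_tac Hop_cd_norm_le)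
      then have "?N x epowr s \<le> (\<alpha> * H (ix (U x))) epowr s" using s0 by (intro epowr_mono)
      then have "u x * (prim u x epowr (s / p)) * (?N x epowr s) \<le> u x * (prim u x epowr (s / p)) * ((\<alpha> * H (ix (U x))) epowr s)"
        by (rule mult_left_mono) simp
      then show ?thesis using False by (simp add: \<Psi>_def prim_u mult_ac)
    qed simp
  qed
  also have "\<dots> = (\<integral>\<^sup>+t. \<Psi> (U (\<xi> t)) * indicator T t \<partial>half_line)"
    by (rule nn_integral_weight_eq) measurable
  also have "\<dots> = (\<integral>\<^sup>+t. \<Psi> t * indicator T t \<partial>half_line)"
    by (intro nn_integral_cong) (auto simp: U_xi split: split_indicator)
  also have "\<dots> = (\<integral>\<^sup>+t. (SUP n. \<Psi> t * indicator T t * (if \<bar>ix t\<bar> \<le> int n then 1 else 0)) \<partial>half_line)"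
  proof (intro nn_integral_cong order.antisym)
    fix t
    show "\<Psi> t * indicator T t \<le> (SUP n. \<Psi> t * indicator T t * (if \<bar>ix t\<bar> \<le> int n then 1 else 0))"
      by (rule SUP_upper2[of "nat \<bar>ix t\<bar>"]) auto
    show "(SUP n. \<Psi> t * indicator T t * (if \<bar>ix t\<bar> \<le> int n then 1 else 0)) \<le> \<Psi> t * indicator T t"
      by (intro SUP_least) auto
  qed
  also have "\<dots> = (SUP n. \<integral>\<^sup>+t. \<Psi> t * indicator T t * (if \<bar>ix t\<bar> \<le> int n then 1 else 0) \<partial>half_line)"
  proof (rule nn_integral_monotone_convergence_SUP)
    show "incseq (\<lambda>n t. \<Psi> t * indicator T t * (if \<bar>ix t\<bar> \<le> int n then 1 else 0))"
      by (auto simp: incseq_def le_fun_def intro!: mult_left_mono)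
    show "(\<lambda>t. \<Psi> t * indicator T t * (if \<bar>ix t\<bar> \<le> int n then 1 else 0)) \<in> borel_measurable half_line" for n
    proof (intro borel_measurable_half_line)
      have "ix \<in> borel \<rightarrow>\<^sub>M count_space UNIV" unfolding ix_def[abs_def] by measurable
      from measurable_compose[OF this, of "\<lambda>m. if \<bar>m\<bar> \<le> int n then 1 else 0 :: ennreal" borel]
      have [measurable]: "(\<lambda>t. if \<bar>ix t\<bar> \<le> int n then 1 else 0 :: ennreal) \<in> borel_measurable borel" by simp
      show "(\<lambda>t. \<Psi> t * indicator T t * (if \<bar>ix t\<bar> \<le> int n then 1 else 0)) \<in> borel_measurable borel"
        by measurable
    qed
  qed
  also have "\<dots> \<le> ?R" by (intro SUP_least part)
  finally have "B2 p q r u v w k \<le> ?R epowr (1 / s)"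
    unfolding B2_def Let_def nn_integral_half_line smax[symmetric] using rp s0
    by (auto intro!: epowr_mono)
  also have "\<dots> = ennreal c_nec * Cst"
    unfolding c_nec_def Let_def s_def[symmetric] using s0 by (simp add: epowr_mult epowr_inverse epowr_ennreal)
  finally show ?thesis .
qed

text \<open>The summand 1 is for \<open>B0\<close>, one \<open>A\<close> for \<open>B1\<close>, and
  \<open>A + c_nec\<close> covers both cases of \<open>B2\<close>.\<close>

definition c_total :: real where "c_total = 1 + 2 * A + c_nec"

lemma necessity:
  "B0 p q r u v w k + B1 p q r u v w k + B2 p q r u v w k \<le> ennreal c_total * Cst"
proof -
  have pos: "0 \<le> c_nec" "1 \<le> A" using A_ge_1 by (simp_all add: c_nec_def Let_def)
  show ?thesis
  proof (cases "Cst < \<infinity>")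
    case True
    have B2: "B2 p q r u v w k \<le> \<alpha> * Cst + ennreal c_nec * Cst"
      using B2_le_if_p_le_r[OF True] B2_le_if_r_less_p[OF True] by (cases "p \<le> r") (auto intro: add_increasing add_increasing2)
    have "B0 p q r u v w k + B1 p q r u v w k + B2 p q r u v w k \<le> Cst + \<alpha> * Cst + (\<alpha> * Cst + ennreal c_nec * Cst)"
      by (intro add_mono B0_le B1_le B2 True)
    also have "\<dots> = (1 + \<alpha> + (\<alpha> + ennreal c_nec)) * Cst" by (simp add: distrib_right)
    also have "1 + \<alpha> + (\<alpha> + ennreal c_nec) = ennreal c_total"
      using pos by (simp add: c_total_def flip: ennreal_plus ennreal_1)
    finally show ?thesis .
  next
    case False
    have "0 < c_total" using pos by (simp add: c_total_def)
    moreover have "Cst = top" using False by (simp add: less_top[symmetric])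
    ultimately have "ennreal c_total * Cst = top" by (simp only: ennreal_mult_top) simp
    then show ?thesis by simp
  qed
qed

end

theorem theorem4p1:
  fixes p r D :: real and q :: ennreal
  assumes "1 \<le> p" and "0 < r" and "0 < q" and "1 \<le> D"
  shows "\<exists>c1 c2 :: real. 0 < c1 \<and> 0 < c2 \<and>
    (\<forall>u\<in>Mplus. \<forall>v\<in>Mplus. \<forall>w\<in>Mplus. \<forall>k :: real \<Rightarrow> real \<Rightarrow> real.
       (\<forall>t>0. (\<integral>\<^sup>+x\<in>{0..t}. u x \<partial>lebesgue) < \<infinity>) \<longrightarrow> oinarov_kernel D k \<longrightarrow>
       (let C = C_T p q r u v w k;
            B = B0 p q r u v w k + B1 p q r u v w k + B2 p q r u v w k
        in (C < \<infinity> \<longleftrightarrow> B < \<infinity>) \<and> C \<le> ennreal c1 * B \<and> B \<le> ennreal c2 * C))"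
proof -
  \<comment> \<open>Outside the locale these constants take only exponents and \<open>D\<close> as
    arguments, which is the required uniformity in the weights and the kernel; the maximum with 1
    ensures positivity.\<close>
  let ?c1 = "max 1 (weights.c_suff r D q)" and ?c2 = "max 1 (weights.c_total p r D q)"
  show ?thesis
  proof (rule exI[of _ ?c1], rule exI[of _ ?c2], intro conjI ballI allI impI)
    fix u v w :: "real \<Rightarrow> ennreal" and k :: "real \<Rightarrow> real \<Rightarrow> real"
    assume "u \<in> Mplus" "v \<in> Mplus" "w \<in> Mplus"
      and "\<forall>t>0. (\<integral>\<^sup>+x\<in>{0..t}. u x \<partial>lebesgue) < \<infinity>" and "oinarov_kernel D k"
    then interpret weights u p r D q v w k
      using assms by unfold_locales (auto simp: prim_def)
    let ?B = "B0 p q r u v w k + B1 p q r u v w k + B2 p q r u v w k"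
    have 1: "Cst \<le> ennreal ?c1 * ?B"
      by (rule order.trans[OF sufficiency]) (intro mult_right_mono ennreal_leI; simp)
    have 2: "?B \<le> ennreal ?c2 * Cst"
      by (rule order.trans[OF necessity]) (intro mult_right_mono ennreal_leI; simp)
    have "Cst < \<infinity> \<longleftrightarrow> ?B < \<infinity>"
    proof
      assume "Cst < \<infinity>"
      then have "ennreal ?c2 * Cst < \<infinity>" by (simp add: ennreal_mult_less_top)
      with 2 show "?B < \<infinity>" by (rule le_less_trans)
    next
      assume "?B < \<infinity>"
      then have "ennreal ?c1 * ?B < \<infinity>" by (simp add: ennreal_mult_less_top)
      with 1 show "Cst < \<infinity>" by (rule le_less_trans)
    qed
    with 1 2 show "let C = C_T p q r u v w k; B = ?B
        in (C < \<infinity> \<longleftrightarrow> B < \<infinity>) \<and> C \<le> ennreal ?c1 * B \<and> B \<le> ennreal ?c2 * C"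
      unfolding Let_def by (intro conjI)
  qed simp_all
qed

end
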